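(* Let $k\geq 4$ be an even integer and let $M_k(z)=\sum_{n=0}^{\infty}r_ne^{2\pi i n z}$ be a modular form of weight $k$ under $SL_2(\mathbb{Z})$ which is not a cusp form (i.e. $r_0\neq 0$). For real $s$ put $M_{k,s}(x)=\sum_{n=1}^{\infty}\frac{r_n}{n^s}\sin(2\pi n x)$. Let $x\in\mathbb{R}\setminus\mathbb{Q}$ and let $\alpha_{k,s}(x)$ be the H\"older regularity exponent of $M_{k,s}$ at $x$. Assume that $$s>k+\frac{k}{\nu(x)}-\frac{k}{\mu(x)}.$$ Then $$\alpha_{k,s}(x)=s-k+\frac{k}{\mu(x)}.$$
   Context: A modular form of weight $k$ under $SL_2(\mathbb{Z})$ is a holomorphic function $M_k$ on $\mathbb{H}=\{z\in\mathbb{C}:\mathrm{Im}(z)>0\}$ with $M_k\big(\frac{az+b}{cz+d}\big)=(cz+d)^kM_k(z)$ for all $\begin{pmatrix}a&b\\c&d\end{pmatrix}\in SL_2(\mathbb{Z})$, holomorphic at infinity, with Fourier expansion $\sum_{n\ge0}r_ne^{2\pi inz}$; it is a cusp form when $r_0=0$. For $s>k$ the series $M_{k,s}$ converges normally on $\mathbb{R}$. H\"older regularity: for $f:\mathbb{R}\to\mathbb{R}$, $x_0\in\mathbb{R}$ and $\alpha>0$, one writes $f\in C^{\alpha}(x_0)$ if there exist a polynomial $P$ of degree at most $[\alpha]$ and a constant $C$ with $|f(x)-P(x-x_0)|\leq C|x-x_0|^{\alpha}$ as $x\to x_0$; the H\"older regularity exponent of $f$ at $x_0$ is $\sup\{\beta: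 f\in C^{\beta}(x_0)\}$ (it may be an integer without $f$ being that many times differentiable). Diophantine quantities: for irrational $x=[a_0;a_1,a_2,\dots]$ (continued fraction) with convergents $\frac{p_n}{q_n}=[a_0;a_1,\dots,a_n]$, define $\kappa_n$ by $\big|x-\frac{p_n}{q_n}\big|=q_n^{-\kappa_n}$, and set $\mu(x)=\limsup_{n\to\infty}\kappa_n$, $\nu(x)=\liminf_{n\to\infty}\kappa_n$. If $\mu(x)=\infty$ or $\nu(x)=\infty$, the convention $\frac{1}{\infty}=0$ is used. *)

theory Defs
  imports "HOL-Analysis.Analysis" "HOL-Computational_Algebra.Polynomial"
begin

section \<open>Modular forms for the full modular group\<close>

text \<open>
  Holomorphy at infinity: \<open>f(z) = F(e\<^sup>2\<^sup>\<pi>\<^sup>i\<^sup>z)\<close> on the upper half-plane, where \<open>F\<close> is holomorphic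
  on the whole open unit disc, including the point \<open>0\<close> that corresponds to the cusp.
\<close>

definition holomorphic_at_infinity :: "(complex \<Rightarrow> complex) \<Rightarrow> bool" where
  "holomorphic_at_infinity f \<longleftrightarrow>
     (\<exists>F. F holomorphic_on ball 0 1 \<and>
          (\<forall>z. Im z > 0 \<longrightarrow> f z = F (exp (2 * of_real pi * \<i> * z))))"

definition modular_form :: "nat \<Rightarrow> (complex \<Rightarrow> complex) \<Rightarrow> bool" where
  "modular_form k f \<longleftrightarrow>
     f holomorphic_on {z. Im z > 0} \<and>
     (\<forall>a b c d :: int. a * d - b * c = 1 \<longrightarrow>
        (\<forall>z. Im z > 0 \<longrightarrow>
           f ((of_int a * z + of_int b) / (of_int c * z + of_int d)) =
             (of_int c * z + of_int d) ^ k * f z)) \<and>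
     holomorphic_at_infinity f"

definition has_fourier_expansion :: "(complex \<Rightarrow> complex) \<Rightarrow> (nat \<Rightarrow> complex) \<Rightarrow> bool" where
  "has_fourier_expansion f r \<longleftrightarrow>
     (\<forall>z. Im z > 0 \<longrightarrow> (\<lambda>n. r n * exp (2 * of_real pi * \<i> * of_nat n * z)) sums f z)"

text \<open>
  The coefficients of a modular form are complex in general, so the sine series takes complex
  values; it is real-valued when the coefficients are real.
\<close>

definition sine_series :: "(nat \<Rightarrow> complex) \<Rightarrow> real \<Rightarrow> real \<Rightarrow> complex" where
  "sine_series r s x =
     (\<Sum>n. r (Suc n) / of_real (real (Suc n) powr s) * of_real (sin (2 * pi * real (Suc n) * x)))"


section \<open>Pointwise Hoelder regularity\<close>

text \<open>
  The type \<open>'a\<close> is \<open>real\<close> in the classical definition; \<open>complex\<close> is needed for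
  \<^const>\<open>sine_series\<close>. The lemma \<open>pointwise_holder_of_real\<close> below shows that for real-valued
  functions both instances agree.
\<close>

definition pointwise_holder :: "(real \<Rightarrow> 'a::real_normed_field) \<Rightarrow> real \<Rightarrow> real \<Rightarrow> bool" where
  "pointwise_holder f x0 \<alpha> \<longleftrightarrow>
     (\<exists>(P :: 'a poly) (C :: real). int (degree P) \<le> \<lfloor>\<alpha>\<rfloor> \<and>
        (\<forall>\<^sub>F x in at x0. norm (f x - poly P (of_real (x - x0))) \<le> C * \<bar>x - x0\<bar> powr \<alpha>))"

text \<open>Valued in \<^typ>\<open>ereal\<close>: the supremum may be infinite.\<close>

definition holder_exponent :: "(real \<Rightarrow> 'a::real_normed_field) \<Rightarrow> real \<Rightarrow> ereal" where
  "holder_exponent f x0 = Sup {ereal \<beta> |\<beta>. \<beta> > 0 \<and> pointwise_holder f x0 \<beta>}"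

lemma pointwise_holder_of_real:
  fixes f :: "real \<Rightarrow> real"
  shows "pointwise_holder (\<lambda>x. complex_of_real (f x)) x0 \<alpha> \<longleftrightarrow> pointwise_holder f x0 \<alpha>"
proof
  assume "pointwise_holder f x0 \<alpha>"
  then obtain P C where P: "int (degree P) \<le> \<lfloor>\<alpha>\<rfloor>"
    and C: "\<forall>\<^sub>F x in at x0. norm (f x - poly P (of_real (x - x0))) \<le> C * \<bar>x - x0\<bar> powr \<alpha>"
    unfolding pointwise_holder_def by blast
  have poly: "poly (map_poly complex_of_real P) (of_real y) = complex_of_real (poly P y)" for y
    by (induction P) (simp_all add: map_poly_pCons)
  show "pointwise_holder (\<lambda>x. complex_of_real (f x)) x0 \<alpha>"
    unfolding pointwise_holder_def
  proof (intro exI conjI)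
    show "int (degree (map_poly complex_of_real P)) \<le> \<lfloor>\<alpha>\<rfloor>"
      using P by (simp add: degree_map_poly)
    show "\<forall>\<^sub>F x in at x0. norm (complex_of_real (f x) - poly (map_poly complex_of_real P) (of_real (x - x0)))
            \<le> C * \<bar>x - x0\<bar> powr \<alpha>"
      using C unfolding poly of_real_diff[symmetric] norm_of_real by simp
  qed
next
  assume "pointwise_holder (\<lambda>x. complex_of_real (f x)) x0 \<alpha>"
  then obtain P C where P: "int (degree P) \<le> \<lfloor>\<alpha>\<rfloor>"
    and C: "\<forall>\<^sub>F x in at x0. norm (complex_of_real (f x) - poly P (of_real (x - x0)))
              \<le> C * \<bar>x - x0\<bar> powr \<alpha>"
    unfolding pointwise_holder_def by blast
  have poly: "poly (map_poly Re P) y = Re (poly P (of_real y))" for y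
    by (induction P) (simp_all add: map_poly_pCons)
  have deg: "degree (map_poly Re P) \<le> degree P"
    by (rule degree_le) (simp add: coeff_map_poly coeff_eq_0)
  have "\<bar>f x - poly (map_poly Re P) (x - x0)\<bar>
          \<le> norm (complex_of_real (f x) - poly P (of_real (x - x0)))" for x
    unfolding poly using abs_Re_le_cmod[of "complex_of_real (f x) - poly P (of_real (x - x0))"]
    by simp
  then have "\<forall>\<^sub>F x in at x0. norm (f x - poly (map_poly Re P) (of_real (x - x0)))
              \<le> C * \<bar>x - x0\<bar> powr \<alpha>"
    using C by (auto elim!: eventually_mono intro: order_trans)
  with P deg show "pointwise_holder f x0 \<alpha>"
    unfolding pointwise_holder_def by (intro exI[of _ "map_poly Re P"] exI[of _ C]) auto
qed


section \<open>Continued fractions\<close>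

fun complete_quotient :: "real \<Rightarrow> nat \<Rightarrow> real" where
  "complete_quotient x 0 = x"
| "complete_quotient x (Suc n) = 1 / frac (complete_quotient x n)"

definition partial_quotient :: "real \<Rightarrow> nat \<Rightarrow> int" where
  "partial_quotient x n = \<lfloor>complete_quotient x n\<rfloor>"

fun conv_num :: "real \<Rightarrow> nat \<Rightarrow> int" where
  "conv_num x 0 = partial_quotient x 0"
| "conv_num x (Suc 0) = partial_quotient x 1 * partial_quotient x 0 + 1"
| "conv_num x (Suc (Suc n)) =
     partial_quotient x (Suc (Suc n)) * conv_num x (Suc n) + conv_num x n"

fun conv_denom :: "real \<Rightarrow> nat \<Rightarrow> int" where
  "conv_denom x 0 = 1"
| "conv_denom x (Suc 0) = partial_quotient x 1"
| "conv_denom x (Suc (Suc n)) =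
     partial_quotient x (Suc (Suc n)) * conv_denom x (Suc n) + conv_denom x n"

text \<open>
  The lemmas \<open>convergent_eq\<close> and \<open>coprime_conv\<close> below show that these recurrences give the value of
  the finite continued fraction \<open>[a\<^sub>0; a\<^sub>1, \<dots>, a\<^sub>n]\<close>, in lowest terms.
\<close>

fun cf_value :: "real list \<Rightarrow> real" where
  "cf_value [] = 0"
| "cf_value [a] = a"
| "cf_value (a # b # bs) = a + 1 / cf_value (b # bs)"

lemma complete_quotient_irrational:
  assumes "x \<notin> \<rat>"
  shows "complete_quotient x n \<notin> \<rat>"
proof (induction n)
  case (Suc n)
  show ?case
  proof
    assume "complete_quotient x (Suc n) \<in> \<rat>"
    then have "inverse (complete_quotient x (Suc n)) \<in> \<rat>" by (rule Rats_inverse)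
    then have "frac (complete_quotient x n) \<in> \<rat>" by (simp add: inverse_eq_divide del: Rats_inverse_iff)
    then have "frac (complete_quotient x n) + of_int \<lfloor>complete_quotient x n\<rfloor> \<in> \<rat>"
      by (intro Rats_add) simp_all
    with Suc show False by (simp add: frac_def)
  qed
qed (use assms in simp)

lemma partial_quotient_pos:
  assumes "x \<notin> \<rat>"
  shows "partial_quotient x (Suc n) \<ge> 1"
proof -
  have "frac (complete_quotient x n) \<noteq> 0"
    using complete_quotient_irrational[OF assms, of n] Ints_subset_Rats by (auto simp: frac_eq_0_iff)
  then have "frac (complete_quotient x n) > 0" by (simp add: order_less_le)
  moreover have "frac (complete_quotient x n) \<le> 1"
    using frac_lt_1[of "complete_quotient x n"] by linarith
  ultimately show ?thesis by (simp add: partial_quotient_def le_floor_iff)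
qed

lemma conv_denom_pos:
  assumes "x \<notin> \<rat>"
  shows "conv_denom x n \<ge> 1"
proof (induction n rule: less_induct)
  case (less n)
  consider "n = 0" | "n = Suc 0" | m where "n = Suc (Suc m)"
    by (metis not0_implies_Suc)
  then show ?case
  proof cases
    case 2
    then show ?thesis using partial_quotient_pos[OF assms, of 0] by simp
  next
    case (3 m)
    have "1 * 1 \<le> partial_quotient x (Suc (Suc m)) * conv_denom x (Suc m)"
      using less[of "Suc m"] 3 partial_quotient_pos[OF assms, of "Suc m"] by (intro mult_mono) auto
    moreover have "1 \<le> conv_denom x m" using less[of m] 3 by simp
    ultimately show ?thesis using 3 by simp
  qed simp
qed

lemma cf_value_snoc2: "cf_value (xs @ [u, t]) = cf_value (xs @ [u + 1 / t])"
proof (induction xs rule: cf_value.induct)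
qed auto

lemma cf_value_append:
  assumes "x \<notin> \<rat>" and "t > 0"
  shows "cf_value (map (\<lambda>i. of_int (partial_quotient x i)) [0..<Suc (Suc n)] @ [t]) =
           (t * of_int (conv_num x (Suc n)) + of_int (conv_num x n)) /
           (t * of_int (conv_denom x (Suc n)) + of_int (conv_denom x n))"
  using assms(2)
proof (induction n arbitrary: t)
  case 0
  have "real_of_int (partial_quotient x 1) > 0"
    using partial_quotient_pos[OF assms(1), of 0] by simp
  with 0 have "t * real_of_int (partial_quotient x 1) + 1 > 0" by (intro add_pos_pos) auto
  with 0 show ?case by (simp add: field_simps)
next
  case (Suc n)
  define a where "a = real_of_int (partial_quotient x (Suc (Suc n)))"
  have a: "a > 0" using partial_quotient_pos[OF assms(1), of "Suc n"] by (simp add: a_def)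
  have q: "real_of_int (conv_denom x (Suc n)) > 0" "real_of_int (conv_denom x n) > 0"
    using conv_denom_pos[OF assms(1), of n] conv_denom_pos[OF assms(1), of "Suc n"] by auto
  have "a + 1 / t > 0" using a Suc.prems by (intro add_pos_pos) auto
  then have "cf_value (map (\<lambda>i. of_int (partial_quotient x i)) [0..<Suc (Suc n)] @ [a + 1 / t]) =
      ((a + 1 / t) * of_int (conv_num x (Suc n)) + of_int (conv_num x n)) /
      ((a + 1 / t) * of_int (conv_denom x (Suc n)) + of_int (conv_denom x n))"
    by (rule Suc.IH)
  also have "\<dots> = (t * ((a + 1 / t) * of_int (conv_num x (Suc n)) + of_int (conv_num x n))) /
      (t * ((a + 1 / t) * of_int (conv_denom x (Suc n)) + of_int (conv_denom x n)))"
    using Suc.prems by (intro mult_divide_mult_cancel_left[symmetric]) simp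
  also have "\<dots> = (t * of_int (conv_num x (Suc (Suc n))) + of_int (conv_num x (Suc n))) /
      (t * of_int (conv_denom x (Suc (Suc n))) + of_int (conv_denom x (Suc n)))"
    using Suc.prems by (simp add: a_def algebra_simps)
  finally show ?case
    using cf_value_snoc2[of "map (\<lambda>i. of_int (partial_quotient x i)) [0..<Suc (Suc n)]" a t]
    by (simp add: a_def)
qed

lemma convergent_eq:
  assumes "x \<notin> \<rat>"
  shows "cf_value (map (\<lambda>i. of_int (partial_quotient x i)) [0..<Suc n]) =
           of_int (conv_num x n) / of_int (conv_denom x n)"
proof -
  consider "n = 0" | "n = Suc 0" | m where "n = Suc (Suc m)"
    by (metis not0_implies_Suc)
  then show ?thesis
  proof cases
    case 2
    then show ?thesis using partial_quotient_pos[OF assms, of 0] by (simp add: field_simps)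
  next
    case (3 m)
    then show ?thesis
      using cf_value_append[OF assms, of "of_int (partial_quotient x n)" m]
        partial_quotient_pos[OF assms, of "Suc m"] by simp
  qed simp
qed

lemma conv_determinant:
  "conv_num x (Suc n) * conv_denom x n - conv_num x n * conv_denom x (Suc n) = (- 1) ^ n"
  by (induction n) (simp_all add: algebra_simps)

lemma coprime_conv: "coprime (conv_num x n) (conv_denom x n)"
proof (rule coprimeI)
  fix d assume "d dvd conv_num x n" "d dvd conv_denom x n"
  then have "d dvd (- 1) ^ n"
    unfolding conv_determinant[of x n, symmetric] by (intro dvd_diff dvd_mult dvd_mult2)
  then show "is_unit d"
    by (rule dvd_trans) simp
qed


section \<open>Diophantine exponents\<close>

text \<open>
  The defining equation determines the exponent only if the denominator exceeds 1. For irrational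
  \<open>x\<close> this excludes at most the indices 0 and 1, which do not affect the limits below.
\<close>

definition approx_exponent :: "real \<Rightarrow> nat \<Rightarrow> real" where
  "approx_exponent x n =
     (THE \<kappa>. \<bar>x - of_int (conv_num x n) / of_int (conv_denom x n)\<bar> =
             of_int (conv_denom x n) powr (- \<kappa>))"

definition mu_exponent :: "real \<Rightarrow> ereal" where
  "mu_exponent x = limsup (\<lambda>n. ereal (approx_exponent x n))"

definition nu_exponent :: "real \<Rightarrow> ereal" where
  "nu_exponent x = liminf (\<lambda>n. ereal (approx_exponent x n))"

lemma approx_exponent_eq:
  assumes "x \<notin> \<rat>" and "conv_denom x n > 1"
  shows "approx_exponent x n =
           - log (of_int (conv_denom x n)) \<bar>x - of_int (conv_num x n) / of_int (conv_denom x n)\<bar>"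
proof -
  define q where "q = real_of_int (conv_denom x n)"
  define y where "y = \<bar>x - of_int (conv_num x n) / q\<bar>"
  have "of_int (conv_num x n) / q \<in> \<rat>" by (simp add: q_def)
  with assms(1) have "y > 0" by (auto simp: y_def)
  moreover have "q > 1" using assms(2) by (simp add: q_def)
  ultimately have "(THE \<kappa>. y = q powr (- \<kappa>)) = - log q y"
    by (intro the_equality) (auto simp: log_powr)
  then show ?thesis by (simp add: approx_exponent_def y_def q_def)
qed

lemma approx_exponent_works:
  assumes "x \<notin> \<rat>" and "conv_denom x n > 1"
  shows "\<bar>x - of_int (conv_num x n) / of_int (conv_denom x n)\<bar> =
           of_int (conv_denom x n) powr (- approx_exponent x n)"
proof -
  have "of_int (conv_num x n) / real_of_int (conv_denom x n) \<in> \<rat>" by simp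
  with assms(1) have "x \<noteq> of_int (conv_num x n) / of_int (conv_denom x n)" by metis
  then have "\<bar>x - of_int (conv_num x n) / of_int (conv_denom x n)\<bar> > 0" by simp
  with assms show ?thesis by (simp add: approx_exponent_eq powr_log_cancel)
qed

end

theory Submission
  imports Defs "HOL-Analysis.Kronecker_Approximation_Theorem"
    "HOL-Complex_Analysis.Cauchy_Integral_Formula" "HOL-Real_Asymp.Real_Asymp"
begin

text \<open>
  Write \<open>H = M - r\<^sub>0\<close>. Up to a constant, \<open>sine_series r s t\<close> is \<open>\<Phi>(t) - \<Phi>(-t)\<close> with
  \<open>\<Phi>(t) = \<integral> y\<^bsup>s-1\<^esup> H(t + iy) dy\<close> over \<open>y > 0\<close>, so its regularity at \<open>x\<close> is governed by the growth of \<open>M\<close>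
  above \<open>x\<close>. Moving \<open>z\<close> up by a modular substitution gives \<open>|M(z)| \<le> B |cz + d|\<^bsup>-k\<^esup>\<close> for some
  \<open>c \<ge> 1\<close>, and a lower bound \<open>|qx - p| \<ge> c\<^sub>0 q\<^bsup>1-\<mu>\<^esup>\<close> turns this into
  \<open>|M(x + h + iy)| \<le> C y\<^bsup>-k\<^esup> (y + |h|)\<^bsup>k/\<mu>\<^esup>\<close>; Taylor expansion under the integral for \<open>y \<ge> 8|h|\<close>
  yields the exponent \<open>s - k + k/\<mu>\<close>. Averaging the same bound for \<open>M\<close> over a horizontal segment gives
  \<open>r\<^sub>n = O(n\<^bsup>k-1\<^esup>)\<close>, hence absolute convergence for \<open>s > k\<close>.

  Conversely, integrating the sine series over one period against the kernel
  \<open>\<Sum> l\<^bsup>m\<^esup> e\<^bsup>2\<pi>il(z-t)\<^esup>\<close>, which annihilates trigonometric polynomials with frequencies \<open>\<le> 0\<close>, and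
  then applying a fractional integral shows that regularity \<open>\<beta>\<close> at \<open>x\<close> forces \<open>|H(z)| \<le> C (Im z)\<^bsup>\<beta>-s\<^esup>\<close> on
  cones at \<open>x\<close>. These cones contain points above the convergents of \<open>x\<close>, where \<open>|M|\<close> is of size
  \<open>(q\<^sub>n Im z)\<^bsup>-k\<^esup>\<close> because \<open>r\<^sub>0 \<noteq> 0\<close>.
\<close>

section \<open>Approximation by convergents\<close>

text \<open>Since \<mu> is a limsup, a uniform bound |q x - p| \<ge> c0 q^(1-\<mu>') is available
  only for \<mu>' > \<mu>, and only exponents \<kappa> < \<mu> are certain to be exceeded infinitely
  often. Both inequalities are therefore proved up to an arbitrarily small loss, which a supremum
  does not see. The same freedom avoids integer exponents, where the Taylor splitting would produce
  a logarithm. In the converse direction there are two obstacles: the local polynomial is not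
  periodic, and a sine mixes the frequencies n and -n, of which only the positive ones extend
  holomorphically to the upper half-plane. A kernel with positive frequencies alone removes the
  second; the first is met by trading the polynomial for a trigonometric one that the kernel kills.
  The weight l^m makes the kernel decay like |z - t|^(-m-1), so for m > \<beta> the mass away from
  the point is harmless; the fractional integral of order m - s then restores the weight of M. The
  assumption on s enters through \<nu> \<le> \<mu>: it gives s > k, hence absolute convergence and a
  positive exponent.\<close>

text \<open>The linear form rather than the error of the fraction: it obeys the same three-term
  recurrence as numerators and denominators.\<close>

definition conv_error :: "real \<Rightarrow> nat \<Rightarrow> real" where
  "conv_error x n = of_int (conv_denom x n) * x - of_int (conv_num x n)"

lemma complete_quotient_pos:
  assumes "x \<notin> \<rat>"
  shows "complete_quotient x (Suc n) > 0"
  using partial_quotient_pos[OF assms, of n] unfolding partial_quotient_def by linarith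

lemma complete_quotient_frac:
  assumes "x \<notin> \<rat>"
  shows "frac (complete_quotient x n) * complete_quotient x (Suc n) = 1"
proof -
  have "frac (complete_quotient x n) \<noteq> 0"
    using complete_quotient_pos[OF assms, of n] by auto
  then show ?thesis by simp
qed

text \<open>With y the complete quotient of index n + 2, the recurrence and the induction hypothesis
  give an error of index n + 2 equal to (floor y - y) times the one of index n + 1, and 1 / frac y
  is the next complete quotient.\<close>

lemma conv_error_step:
  assumes "x \<notin> \<rat>"
  shows "conv_error x n = - complete_quotient x (Suc (Suc n)) * conv_error x (Suc n)"
proof (induction n)
  case 0
  define y where "y = complete_quotient x (Suc 0)"
  have 1: "frac x * y = 1"
    using complete_quotient_frac[OF assms, of 0] by (simp add: y_def)
  have 2: "frac y * complete_quotient x (Suc (Suc 0)) = 1"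
    using complete_quotient_frac[OF assms, of "Suc 0"] by (simp add: y_def)
  have e0: "conv_error x 0 = frac x"
    by (simp add: conv_error_def partial_quotient_def frac_def)
  have "conv_error x (Suc 0) = of_int \<lfloor>y\<rfloor> * frac x - 1"
    by (simp add: conv_error_def partial_quotient_def frac_def y_def algebra_simps)
  also have "\<dots> = - frac x * frac y"
    using 1 by (simp add: frac_def[of y] algebra_simps)
  finally have e1: "conv_error x (Suc 0) = - frac x * frac y" .
  have "- complete_quotient x (Suc (Suc 0)) * (- frac x * frac y) =
    frac x * (frac y * complete_quotient x (Suc (Suc 0)))" by (simp only: mult_ac minus_mult_minus mult_minus_left mult_minus_right minus_minus)
  then show ?case unfolding e0 e1 2 by simp
next
  case (Suc n)
  define y where "y = complete_quotient x (Suc (Suc n))"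
  have 2: "frac y * complete_quotient x (Suc (Suc (Suc n))) = 1"
    using complete_quotient_frac[OF assms, of "Suc (Suc n)"] by (simp add: y_def)
  have "conv_error x (Suc (Suc n)) = of_int \<lfloor>y\<rfloor> * conv_error x (Suc n) + conv_error x n"
    by (simp add: conv_error_def partial_quotient_def y_def algebra_simps)
  also have "\<dots> = - frac y * conv_error x (Suc n)"
    using Suc by (simp add: frac_def y_def algebra_simps)
  finally have e: "conv_error x (Suc (Suc n)) = - frac y * conv_error x (Suc n)" .
  have "- complete_quotient x (Suc (Suc (Suc n))) * (- frac y * conv_error x (Suc n)) =
    (frac y * complete_quotient x (Suc (Suc (Suc n)))) * conv_error x (Suc n)" by (simp only: mult_ac minus_mult_minus mult_minus_left mult_minus_right minus_minus)
  then show ?case unfolding e 2 by simp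
qed

text \<open>Consecutive errors have opposite signs, so the determinant identity becomes |d_n|
  q_(n+1) + |d_(n+1)| q_n = 1, a sum of nonnegative terms.\<close>

lemma abs_conv_error_le:
  assumes "x \<notin> \<rat>"
  shows "\<bar>conv_error x n\<bar> \<le> 1 / of_int (conv_denom x (Suc n))"
proof -
  define z where "z = complete_quotient x (Suc (Suc n))"
  define d where "d = conv_error x (Suc n)"
  have z: "z > 0" unfolding z_def by (rule complete_quotient_pos[OF assms])
  have q: "of_int (conv_denom x (Suc n)) > (0::real)" "of_int (conv_denom x n) > (0::real)"
    using conv_denom_pos[OF assms, of "Suc n"] conv_denom_pos[OF assms, of n] by auto
  have s: "conv_error x n = - z * d" using conv_error_step[OF assms, of n] by (simp add: z_def d_def)
  have "conv_error x n * of_int (conv_denom x (Suc n)) - d * of_int (conv_denom x n)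
      = of_int (conv_num x (Suc n) * conv_denom x n - conv_num x n * conv_denom x (Suc n))"
    unfolding d_def conv_error_def of_int_diff of_int_mult by (simp add: algebra_simps)
  also have "\<dots> = (- 1) ^ n" unfolding conv_determinant by simp
  finally have "- d * (z * of_int (conv_denom x (Suc n)) + of_int (conv_denom x n)) = (- 1) ^ n"
    unfolding s by (simp add: algebra_simps)
  then have "\<bar>- d * (z * of_int (conv_denom x (Suc n)) + of_int (conv_denom x n))\<bar> = 1"
    by (simp only: power_abs[symmetric]) simp
  then have "\<bar>d\<bar> * (z * of_int (conv_denom x (Suc n)) + of_int (conv_denom x n)) = 1"
    using z q by (simp add: abs_mult)
  then have "\<bar>conv_error x n\<bar> * of_int (conv_denom x (Suc n)) + \<bar>d\<bar> * of_int (conv_denom x n) = 1"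
    using z unfolding s by (simp add: abs_mult algebra_simps)
  moreover have "\<bar>d\<bar> * of_int (conv_denom x n) \<ge> 0" using q by simp
  ultimately have "\<bar>conv_error x n\<bar> * of_int (conv_denom x (Suc n)) \<le> 1" by linarith
  then show ?thesis using q by (simp add: pos_le_divide_eq)
qed

lemma conv_denom_mono:
  assumes "x \<notin> \<rat>"
  shows "conv_denom x n \<le> conv_denom x (Suc n)"
proof (cases n)
  case 0
  then show ?thesis using conv_denom_pos[OF assms, of "Suc 0"] by simp
next
  case (Suc m)
  have "conv_denom x (Suc m) \<le> partial_quotient x (Suc (Suc m)) * conv_denom x (Suc m)"
    using partial_quotient_pos[OF assms, of "Suc m"] conv_denom_pos[OF assms, of "Suc m"]
      by (simp add: mult_le_cancel_right1)
  then show ?thesis using Suc conv_denom_pos[OF assms, of m] by simp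
qed

lemma conv_denom_ge:
  assumes "x \<notin> \<rat>"
  shows "conv_denom x n \<ge> int n"
proof (induction n)
  case (Suc n)
  show ?case
  proof (cases n)
    case 0
    then show ?thesis using conv_denom_pos[OF assms, of "Suc 0"] by simp
  next
    case (Suc m)
    have "conv_denom x (Suc m) \<le> partial_quotient x (Suc (Suc m)) * conv_denom x (Suc m)"
      using partial_quotient_pos[OF assms, of "Suc m"] conv_denom_pos[OF assms, of "Suc m"]
      by (simp add: mult_le_cancel_right1)
    moreover have "conv_denom x (Suc m) \<ge> int (Suc m)" using Suc.IH Suc by simp
    ultimately show ?thesis unfolding Suc conv_denom.simps(3)
      using conv_denom_pos[OF assms, of m] by linarith
  qed
qed simp

lemma abs_diff_convergent:
  assumes "x \<notin> \<rat>"
  shows "\<bar>x - of_int (conv_num x n) / of_int (conv_denom x n)\<bar> =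
           \<bar>conv_error x n\<bar> / of_int (conv_denom x n)"
proof -
  have q: "of_int (conv_denom x n) > (0::real)" using conv_denom_pos[OF assms, of n] by simp
  then have "x - of_int (conv_num x n) / of_int (conv_denom x n) = conv_error x n / of_int (conv_denom x n)"
    by (simp add: conv_error_def field_simps)
  then show ?thesis using q by (simp add: abs_divide)
qed

text \<open>Follows from |q_n x - p_n| \<le> 1/q_(n+1) \<le> 1/q_n.\<close>

lemma approx_exponent_ge_2:
  assumes "x \<notin> \<rat>" "conv_denom x n > 1"
  shows "approx_exponent x n \<ge> 2"
proof -
  define q where "q = real_of_int (conv_denom x n)"
  have q: "q > 1" using assms by (simp add: q_def)
  have le: "q \<le> of_int (conv_denom x (Suc n))" using conv_denom_mono[OF assms(1)] by (simp add: q_def)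
  have "q powr (- approx_exponent x n) = \<bar>conv_error x n\<bar> / q"
    using approx_exponent_works[OF assms] abs_diff_convergent[OF assms(1)] by (simp add: q_def)
  also have "\<dots> \<le> (1 / q) / q"
    using abs_conv_error_le[OF assms(1), of n] le q
    by (intro divide_right_mono) (auto elim!: order_trans intro!: divide_left_mono)
  also have "\<dots> = q powr (-2)" using q by (simp add: powr_minus powr_numeral power2_eq_square divide_simps)
  finally show ?thesis using q by simp
qed

lemma eventually_conv_denom_gt:
  assumes "x \<notin> \<rat>"
  shows "eventually (\<lambda>n. real_of_int (conv_denom x n) > c) sequentially"
proof -
  have "filterlim (\<lambda>n. real_of_int (conv_denom x n)) at_top sequentially"
    by (rule filterlim_at_top_mono[OF filterlim_real_sequentially])
       (intro always_eventually allI, metis conv_denom_ge[OF assms] of_int_le_iff of_int_of_nat_eq)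
  then show ?thesis by (simp add: filterlim_at_top_dense)
qed

lemma nu_exponent_ge_2:
  assumes "x \<notin> \<rat>"
  shows "nu_exponent x \<ge> 2"
  unfolding nu_exponent_def
proof (rule Liminf_bounded)
  show "\<forall>\<^sub>F n in sequentially. (2::ereal) \<le> ereal (approx_exponent x n)"
    using eventually_conv_denom_gt[OF assms, of 1]
    by eventually_elim (metis approx_exponent_ge_2[OF assms] ereal_less_eq(3) numeral_eq_ereal of_int_less_iff of_int_1)
qed

lemma nu_le_mu_exponent: "nu_exponent x \<le> mu_exponent x"
  unfolding nu_exponent_def mu_exponent_def by (rule Liminf_le_Limsup) simp

text \<open>
  Two distinct fractions \<open>p/q\<close> and \<open>p\<^sub>n/q\<^sub>n\<close> are at least \<open>1/(q q\<^sub>n)\<close> apart.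
\<close>
lemma conv_denom_lower_bound:
  assumes "x \<notin> \<rat>" "0 < q" "2 * q < conv_denom x n"
  shows "\<bar>of_int q * x - of_int p\<bar> \<ge> 1 / (2 * of_int (conv_denom x n))"
proof -
  define Q P where "Q = conv_denom x n" and "P = conv_num x n"
  have Q: "Q > 0" using assms by (simp add: Q_def)
  have ne: "p * Q - q * P \<noteq> 0"
  proof
    assume "p * Q - q * P = 0"
    then have "Q dvd q * P" by (metis dvd_triv_right eq_iff_diff_eq_0)
    moreover have "coprime Q P" using coprime_conv[of x n] by (simp add: Q_def P_def coprime_commute)
    ultimately have "Q dvd q" by (simp add: coprime_dvd_mult_left_iff)
    then show False using assms by (auto simp: Q_def dest: zdvd_imp_le)
  qed
  have err: "\<bar>conv_error x n\<bar> \<le> 1 / of_int Q"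
  proof -
    have "1 / of_int (conv_denom x (Suc n)) \<le> 1 / (of_int Q :: real)"
      using conv_denom_mono[OF assms(1), of n] Q by (intro divide_left_mono) (auto simp: Q_def)
    then show ?thesis using abs_conv_error_le[OF assms(1), of n] by linarith
  qed
  have "(1::real) \<le> \<bar>of_int (p * Q - q * P)\<bar>"
    using ne by (metis abs_ge_zero of_int_abs of_int_1_le_iff abs_le_zero_iff linorder_not_less int_one_le_iff_zero_less)
  \<comment> \<open>The terms in x cancel. Since 2 q < Q, the first summand on the right is at most
    1/2 in absolute value, which leaves at least 1/2 for the second.\<close>
  also have "of_int (p * Q - q * P) = of_int q * conv_error x n - of_int Q * (of_int q * x - of_int p)"
    by (simp add: conv_error_def Q_def P_def algebra_simps)
  also have "\<bar>\<dots>\<bar> \<le> \<bar>of_int q * conv_error x n\<bar> + \<bar>of_int Q * (of_int q * x - of_int p)\<bar>"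
    by (rule abs_triangle_ineq4)
  also have "\<bar>of_int q * conv_error x n\<bar> \<le> of_int q * (1 / of_int Q)"
    using err assms(2) by (simp add: abs_mult mult_left_mono del: times_divide_eq_right)
  also have "\<dots> \<le> 1 / 2"
    using assms Q by (simp add: Q_def field_simps flip: of_int_mult)
  finally have "1 / 2 \<le> of_int Q * \<bar>of_int q * x - of_int p\<bar>" using Q by (simp add: abs_mult)
  then show ?thesis using Q by (simp add: Q_def field_simps)
qed

text \<open>The exponents control convergents only. For general q take the first denominator q_m
  above 2 q; then |q x - p| \<ge> 1/(2 q_m). The preceding denominator satisfies q_(m-1) \<le> 2 q,
  and the error there lies between q_(m-1)^(1-\<mu>) and 1/q_m, so 1/q_m \<ge> (2
  q)^(1-\<mu>).\<close>

lemma diophantine_lower_bound: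
  assumes x: "x \<notin> \<rat>" and mu: "mu_exponent x < ereal \<mu>"
  shows "\<exists>c>0. \<forall>q p. 0 < q \<longrightarrow> \<bar>of_int q * x - of_int p\<bar> \<ge> c * of_int q powr (1 - \<mu>)"
proof -
  have "eventually (\<lambda>n. approx_exponent x n < \<mu>) sequentially"
    using Limsup_lessD[OF mu[unfolded mu_exponent_def]] by simp
  then have "eventually (\<lambda>n. approx_exponent x n < \<mu> \<and> conv_denom x n > 1) sequentially"
    using eventually_conv_denom_gt[OF x, of 1] by eventually_elim simp
  then obtain N where N: "\<And>n. n \<ge> N \<Longrightarrow> approx_exponent x n < \<mu> \<and> conv_denom x n > 1"
    unfolding eventually_sequentially by blast
  have mu2: "\<mu> > 2" using N[of N] approx_exponent_ge_2[OF x, of N] by auto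
  \<comment> \<open>The first entry serves the finitely many q below half of the denominator of
    index \<open>N\<close>, where the exponents need not yet be below \<mu>; the second is the
    factor in (1/2) (2 q)^(1-\<mu>).\<close>
  define c where "c = min (1 / (2 * of_int (conv_denom x N))) (2 powr (- \<mu>))"
  have c: "c > 0" using N[of N] by (simp add: c_def)
  moreover have "\<bar>of_int q * x - of_int p\<bar> \<ge> c * of_int q powr (1 - \<mu>)" if q: "0 < q" for q p :: int
  proof (cases "2 * q < conv_denom x N")
    case True
    have "c * of_int q powr (1 - \<mu>) \<le> c * 1"
      using q c mu2 powr_mono[of "1 - \<mu>" 0 "of_int q"] by (intro mult_left_mono) auto
    also have "\<dots> \<le> 1 / (2 * of_int (conv_denom x N))" by (simp add: c_def)
    also have "\<dots> \<le> \<bar>of_int q * x - of_int p\<bar>"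
      by (rule conv_denom_lower_bound[OF x q True])
    finally show ?thesis .
  next
    case False
    have "\<exists>n. 2 * q < conv_denom x n"
      using conv_denom_ge[OF x, of "nat (2 * q + 1)"] q by (intro exI[of _ "nat (2 * q + 1)"]) auto
    define m where "m = (LEAST n. 2 * q < conv_denom x n)"
    have m: "2 * q < conv_denom x m"
      unfolding m_def using \<open>\<exists>n. _\<close> by (rule LeastI_ex)
    have mono: "conv_denom x i \<le> conv_denom x j" if "i \<le> j" for i j
      using that by (rule lift_Suc_mono_le[of "conv_denom x", OF conv_denom_mono[OF x]])
    have "m > N" using m False mono[of m N] by linarith
    then obtain n where n: "m = Suc n" "n \<ge> N" by (cases m) auto
    have nq: "conv_denom x n \<le> 2 * q"
      using not_less_Least[of n "\<lambda>n. 2 * q < conv_denom x n"] n(1) by (simp add: m_def)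
    define Q where "Q = real_of_int (conv_denom x n)"
    have Q: "Q > 1" using N[OF n(2)] by (simp add: Q_def)
    have Q': "real_of_int (conv_denom x m) > 0" using conv_denom_pos[OF x, of m] by simp
    have "Q powr (- \<mu>) \<le> Q powr (- approx_exponent x n)"
      using Q N[OF n(2)] by simp
    also have "\<dots> = \<bar>conv_error x n\<bar> / Q"
      using approx_exponent_works[OF x, of n] N[OF n(2)] abs_diff_convergent[OF x] by (simp add: Q_def)
    finally have "Q powr (1 - \<mu>) \<le> \<bar>conv_error x n\<bar>"
      using Q by (simp add: powr_diff powr_minus field_simps)
    also have "\<dots> \<le> 1 / of_int (conv_denom x m)"
      using abs_conv_error_le[OF x, of n] n(1) by simp
    finally have 1: "Q powr (1 - \<mu>) \<le> 1 / of_int (conv_denom x m)" .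
    have "c * of_int q powr (1 - \<mu>) \<le> 2 powr (- \<mu>) * of_int q powr (1 - \<mu>)"
      by (intro mult_right_mono) (auto simp: c_def)
    also have "\<dots> = (1 / 2) * (2 * of_int q) powr (1 - \<mu>)"
      using q by (simp add: powr_mult powr_diff powr_minus field_simps)
    also have "\<dots> \<le> (1 / 2) * Q powr (1 - \<mu>)"
    proof (intro mult_left_mono powr_mono2')
      show "Q \<le> 2 * of_int q" using nq unfolding Q_def by (metis of_int_le_iff of_int_mult of_int_numeral)
    qed (use mu2 Q in auto)
    also have "\<dots> \<le> (1 / 2) * (1 / of_int (conv_denom x m))"
      using 1 by (intro mult_left_mono) auto
    also have "\<dots> = 1 / (2 * of_int (conv_denom x m))" by simp
    also have "\<dots> \<le> \<bar>of_int q * x - of_int p\<bar>"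
      by (rule conv_denom_lower_bound[OF x q m])
    finally show ?thesis .
  qed
  ultimately show ?thesis by blast
qed

section \<open>Integrals of power type\<close>

text \<open>The scale \<open>c\<close> is where the dominating power changes: 1 for the Taylor
  coefficients, 8 |h| for the Taylor remainder, and Im z for the fractional integral.\<close>

lemma
  fixes f :: "real \<Rightarrow> complex"
  assumes meas: "f \<in> borel_measurable (lebesgue_on {0<..})" and c: "c > 0" and p: "p > -1" and q: "q < -1"
    and near: "\<And>t. 0 < t \<Longrightarrow> t \<le> c \<Longrightarrow> norm (f t) \<le> A * t powr p"
    and far: "\<And>t. t > c \<Longrightarrow> norm (f t) \<le> B * t powr q"
  shows absolutely_integrable_powr_bounds: "f absolutely_integrable_on {0<..}"
    and norm_integral_powr_bounds:
      "norm (integral {0<..} f) \<le> A * (c powr (p + 1) / (p + 1)) + B * (c powr (q + 1) / (- q - 1))"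
proof -
  define g where "g = (\<lambda>t. if t \<le> c then A * t powr p else B * t powr q)"
  have 1: "(g has_integral (A * (c powr (p + 1) / (p + 1)))) {0<..c}"
  proof -
    have "((\<lambda>t. A * t powr p) has_integral (A * (c powr (p + 1) / (p + 1)))) {0..c}"
      using has_integral_powr_from_0[of p c] p c by (intro has_integral_mult_right) auto
    then have "((\<lambda>t. A * t powr p) has_integral (A * (c powr (p + 1) / (p + 1)))) {0<..c}"
      by (rule has_integral_spike_set_eq[THEN iffD1, rotated 2]) (auto intro: negligible_subset[of "{0}"])
    then show ?thesis by (rule has_integral_eq[rotated]) (auto simp: g_def)
  qed
  have 2: "(g has_integral (B * (c powr (q + 1) / (- q - 1)))) {c<..}"
  proof -
    have "((\<lambda>t. B * t powr q) has_integral (B * (- (c powr (q + 1)) / (q + 1)))) {c..}"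
      using has_integral_powr_to_inf[of q c] q c by (intro has_integral_mult_right) auto
    then have "((\<lambda>t. B * t powr q) has_integral (B * (- (c powr (q + 1)) / (q + 1)))) {c<..}"
      by (rule has_integral_spike_set_eq[THEN iffD1, rotated 2]) (auto intro: negligible_subset[of "{c}"])
    moreover have "- (c powr (q + 1)) / (q + 1) = c powr (q + 1) / (- q - 1)"
      using q by (simp add: field_simps)
    ultimately have "((\<lambda>t. B * t powr q) has_integral (B * (c powr (q + 1) / (- q - 1)))) {c<..}"
      by (simp only:)
    then show ?thesis by (rule has_integral_eq[rotated]) (auto simp: g_def)
  qed
  have "{0<..c} \<union> {c<..} = {0<..}" using c by auto
  moreover have "(g has_integral (A * (c powr (p + 1) / (p + 1)) + B * (c powr (q + 1) / (- q - 1)))) ({0<..c} \<union> {c<..})"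
  proof (rule has_integral_Un[OF 1 2])
    have "{0<..c} \<inter> {c<..} = {}" by auto
    then show "negligible ({0<..c} \<inter> {c<..})" by (simp only: negligible_empty)
  qed
  ultimately have g: "(g has_integral (A * (c powr (p + 1) / (p + 1)) + B * (c powr (q + 1) / (- q - 1)))) {0<..}"
    by simp
  have le: "norm (f t) \<le> g t" if "t \<in> {0<..}" for t
    using that near far by (auto simp: g_def)
  show abs: "f absolutely_integrable_on {0<..}"
  proof (rule measurable_bounded_by_integrable_imp_absolutely_integrable)
    show "f \<in> borel_measurable (lebesgue_on {0<..})" by (rule meas)
    show "g integrable_on {0<..}" using g by (rule has_integral_integrable)
  qed (use le in auto)
  show "norm (integral {0<..} f) \<le> A * (c powr (p + 1) / (p + 1)) + B * (c powr (q + 1) / (- q - 1))"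
    using integral_norm_bound_integral[OF set_lebesgue_integral_eq_integral(1)[OF abs]
        has_integral_integrable[OF g] le] integral_unique[OF g] by simp
qed

lemma Gamma_integral_scaled:
  assumes "\<sigma> > 0" and a: "(a::real) > 0"
  shows "(\<lambda>t. t powr (\<sigma> - 1) * exp (- a * t)) absolutely_integrable_on {0<..}"
    and "integral {0<..} (\<lambda>t. t powr (\<sigma> - 1) * exp (- a * t)) = Gamma \<sigma> * a powr (- \<sigma>)"
proof -
  let ?f = "\<lambda>t. a powr (-\<sigma>) * (t powr (\<sigma> - 1) / exp t)"
  have "((\<lambda>t. t powr (\<sigma> - 1) / exp t) has_integral Gamma \<sigma>) {0..}"
    by (rule Gamma_integral_real[OF assms(1)])
  then have "((\<lambda>t. t powr (\<sigma> - 1) / exp t) has_integral Gamma \<sigma>) {0<..}"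
    by (rule has_integral_spike_set_eq[THEN iffD1, rotated 2]) (auto intro: negligible_subset[of "{0}"])
  then have *: "(?f has_integral a powr (-\<sigma>) * Gamma \<sigma>) {0<..}" by (rule has_integral_mult_right)
  have im: "(*) a ` {0<..} = {0::real<..}"
  proof (intro subset_antisym subsetI)
    fix x :: real assume "x \<in> {0<..}"
    then have "x = a * (x / a)" "x / a \<in> {0<..}" using a by auto
    then show "x \<in> (*) a ` {0<..}" by blast
  qed (use a in auto)
  have "?f absolutely_integrable_on {0<..} \<and> integral {0<..} ?f = a powr (-\<sigma>) * Gamma \<sigma>"
    using * by (auto intro!: nonnegative_absolutely_integrable_1 simp: has_integral_integrable integral_unique)
  then have "(\<lambda>t. \<bar>a\<bar> * ?f (a * t)) absolutely_integrable_on {0<..} \<and>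
     integral {0<..} (\<lambda>t. \<bar>a\<bar> * ?f (a * t)) = a powr (-\<sigma>) * Gamma \<sigma>"
    by (subst has_absolute_integral_change_of_variables_1'[where g = "\<lambda>t. a * t"])
       (use a im in \<open>auto intro!: derivative_eq_intros inj_onI\<close>)
  moreover have "\<bar>a\<bar> * ?f (a * t) = t powr (\<sigma> - 1) * exp (- a * t)" if "t \<in> {0<..}" for t
    using that a by (simp add: powr_mult powr_diff powr_minus exp_minus field_simps)
  ultimately show "(\<lambda>t. t powr (\<sigma> - 1) * exp (- a * t)) absolutely_integrable_on {0<..}"
     "integral {0<..} (\<lambda>t. t powr (\<sigma> - 1) * exp (- a * t)) = Gamma \<sigma> * a powr (- \<sigma>)"
    using set_integrable_cong[of lebesgue lebesgue "{0<..}" "{0<..}" "\<lambda>t. \<bar>a\<bar> * ?f (a * t)" "\<lambda>t. t powr (\<sigma> - 1) * exp (- a * t)"]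
      integral_cong[of "{0<..}" "\<lambda>t. \<bar>a\<bar> * ?f (a * t)" "\<lambda>t. t powr (\<sigma> - 1) * exp (- a * t)"]
    by (auto simp: mult.commute)
qed

text \<open>Integrating term by term is legitimate because the integrals of the norms are constant
  multiples of the summable sequence in the hypothesis. With \<sigma> = s this produces the weights
  n^(-s) of the sine series; with \<sigma> = m - s it acts as a fractional integral along a vertical
  ray.\<close>

lemma
  fixes b :: "nat \<Rightarrow> complex"
  assumes \<sigma>: "\<sigma> > 0" and b: "summable (\<lambda>n. norm (b n) * real (Suc n) powr (- \<sigma>))"
  defines "f \<equiv> \<lambda>t. t powr (\<sigma> - 1) *\<^sub>R (\<Sum>n. exp (- 2 * pi * real (Suc n) * t) *\<^sub>R b n)"
  shows Mellin_exp_series_integrable: "f absolutely_integrable_on {0<..}"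
    and Mellin_exp_series: "integral {0<..} f =
          (Gamma \<sigma> * (2 * pi) powr (- \<sigma>)) *\<^sub>R (\<Sum>n. real (Suc n) powr (- \<sigma>) *\<^sub>R b n)"
proof -
  define k where "k = (\<lambda>n t. t powr (\<sigma> - 1) * exp (- (2 * pi * real (Suc n)) * t))"
  define g where "g = (\<lambda>n t. indicator {0<..} t *\<^sub>R (k n t *\<^sub>R b n))"
  have kint: "k n absolutely_integrable_on {0<..}"
    and kval: "integral {0<..} (k n) = Gamma \<sigma> * (2 * pi) powr (- \<sigma>) * real (Suc n) powr (- \<sigma>)" for n
    using Gamma_integral_scaled[OF \<sigma>, of "2 * pi * real (Suc n)"]
    by (simp_all add: k_def powr_mult)
  have kL: "(LINT t:{0<..}|lebesgue. k n t) = Gamma \<sigma> * (2 * pi) powr (- \<sigma>) * real (Suc n) powr (- \<sigma>)" for n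
    using set_lebesgue_integral_eq_integral(2)[OF kint] kval by simp
  have g': "g n t = (indicator {0<..} t *\<^sub>R k n t) *\<^sub>R b n" for n t
    by (simp add: g_def)
  have gint: "integrable lebesgue (g n)" for n
    unfolding g' using kint[of n, unfolded set_integrable_def] by (intro integrable_scaleR_left) auto
  have gL: "integral\<^sup>L lebesgue (g n) = (Gamma \<sigma> * (2 * pi) powr (- \<sigma>)) *\<^sub>R (real (Suc n) powr (- \<sigma>) *\<^sub>R b n)" for n
    unfolding g' using kint[of n, unfolded set_integrable_def] kL[of n, unfolded set_lebesgue_integral_def]
    by (subst integral_scaleR_left) auto
  have gnorm: "(\<integral>t. norm (g n t) \<partial>lebesgue) = Gamma \<sigma> * (2 * pi) powr (- \<sigma>) * (norm (b n) * real (Suc n) powr (- \<sigma>))" for n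
  proof -
    have "norm (g n t) = norm (b n) *\<^sub>R (indicator {0<..} t *\<^sub>R k n t)" for t
      by (simp add: g_def k_def indicator_def)
    then have "(\<integral>t. norm (g n t) \<partial>lebesgue) = norm (b n) *\<^sub>R (\<integral>t. indicator {0<..} t *\<^sub>R k n t \<partial>lebesgue)"
      by simp
    then show ?thesis using kL[of n, unfolded set_lebesgue_integral_def] by simp
  qed
  have sum1: "summable (\<lambda>n. exp (- 2 * pi * real (Suc n) * t) * norm (b n))" if t: "t > 0" for t
  proof -
    have "(\<lambda>n. exp (- 2 * pi * real (Suc n) * t)) \<in> O(\<lambda>n. real (Suc n) powr (- \<sigma>))"
      using t \<sigma> by real_asymp
    then have "(\<lambda>n. exp (- 2 * pi * real (Suc n) * t) * norm (b n)) \<in> O(\<lambda>n. real (Suc n) powr (- \<sigma>) * norm (b n))"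
      by (rule landau_o.big.mult_right)
    then show ?thesis
      by (rule summable_comparison_test_bigo[rotated]) (use b in \<open>simp add: mult.commute\<close>)
  qed
  have AE: "AE t in lebesgue. summable (\<lambda>n. norm (g n t))"
  proof (rule AE_I2)
    fix t :: real
    show "summable (\<lambda>n. norm (g n t))"
    proof (cases "t > 0")
      case True
      have "norm (g n t) = t powr (\<sigma> - 1) * (exp (- 2 * pi * real (Suc n) * t) * norm (b n))" for n
        using True by (simp add: g_def k_def)
      then show ?thesis using summable_mult[OF sum1[OF True]] by simp
    qed (simp add: g_def)
  qed
  have S: "summable (\<lambda>n. \<integral>t. norm (g n t) \<partial>lebesgue)"
    unfolding gnorm by (intro summable_mult b)
  have eq: "(\<Sum>n. g n t) = indicator {0<..} t *\<^sub>R f t" for t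
  proof (cases "t > 0")
    case True
    have "summable (\<lambda>n. exp (- 2 * pi * real (Suc n) * t) *\<^sub>R b n)"
      by (rule summable_norm_cancel) (use sum1[OF True] in simp)
    from suminf_scaleR_right[OF this, of "t powr (\<sigma> - 1)"] True show ?thesis
      by (simp add: g_def k_def f_def)
  qed (simp add: g_def)
  show I: "f absolutely_integrable_on {0<..}"
    using integrable_suminf[OF gint AE S] unfolding eq set_integrable_def .
  have bs: "summable (\<lambda>n. real (Suc n) powr (- \<sigma>) *\<^sub>R b n)"
    by (rule summable_norm_cancel) (use b in \<open>simp add: mult.commute\<close>)
  have "integral {0<..} f = (\<integral>t. (\<Sum>n. g n t) \<partial>lebesgue)"
    unfolding eq using set_lebesgue_integral_eq_integral(2)[OF I] by (simp add: set_lebesgue_integral_def)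
  also have "\<dots> = (\<Sum>n. (Gamma \<sigma> * (2 * pi) powr (- \<sigma>)) *\<^sub>R (real (Suc n) powr (- \<sigma>) *\<^sub>R b n))"
    using integral_suminf[OF gint AE S] unfolding gL .
  also have "\<dots> = (Gamma \<sigma> * (2 * pi) powr (- \<sigma>)) *\<^sub>R (\<Sum>n. real (Suc n) powr (- \<sigma>) *\<^sub>R b n)"
    by (rule suminf_scaleR_right[OF bs, symmetric])
  finally show "integral {0<..} f =
          (Gamma \<sigma> * (2 * pi) powr (- \<sigma>)) *\<^sub>R (\<Sum>n. real (Suc n) powr (- \<sigma>) *\<^sub>R b n)" .
qed

section \<open>Cauchy estimates and Taylor remainders\<close>

text \<open>Cauchy's inequality on the disc of radius r/2 costs the factor 2^j. For |h| \<le> r/4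
  the Taylor terms are then dominated by a geometric series of ratio at most 1/2, whose tail is at
  most twice its leading term.\<close>

lemma
  assumes hol: "f holomorphic_on ball z r" and r: "r > 0" and B: "\<And>w. w \<in> ball z r \<Longrightarrow> norm (f w) \<le> B"
  shows norm_higher_deriv_le: "norm ((deriv ^^ j) f z / fact j) \<le> B / r ^ j * 2 ^ j"
    and norm_Taylor_remainder_le: "norm h \<le> r / 4 \<Longrightarrow>
      norm (f (z + h) - (\<Sum>j\<le>d. (deriv ^^ j) f z / fact j * h ^ j)) \<le> 2 * B * (2 * norm h / r) ^ Suc d"
proof -
  have deriv: "norm ((deriv ^^ j) f z / fact j) \<le> B / (r / 2) ^ j" for j
  proof -
    have sub: "cball z (r / 2) \<subseteq> ball z r" using r by auto
    have "norm ((deriv ^^ j) f z) \<le> fact j * B / (r / 2) ^ j"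
    proof (rule Cauchy_inequality)
      show "f holomorphic_on ball z (r / 2)" "continuous_on (cball z (r / 2)) f"
        using hol holomorphic_on_subset sub ball_subset_cball
        by (blast, meson holomorphic_on_imp_continuous_on holomorphic_on_subset)
    qed (use r B sub in \<open>auto simp: dist_norm subset_iff\<close>)
    then show ?thesis by (simp add: norm_divide field_simps)
  qed
  then show "norm ((deriv ^^ j) f z / fact j) \<le> B / r ^ j * 2 ^ j"
    by (simp add: power_divide)
  assume h: "norm h \<le> r / 4"
  define q where "q = 2 * norm h / r"
  have q: "0 \<le> q" "q \<le> 1 / 2" using h r by (auto simp: q_def field_simps)
  have "norm (f z) \<le> B" using B[of z] r by simp
  then have B0: "B \<ge> 0" using norm_ge_zero[of "f z"] by linarith
  have "(\<lambda>n. (deriv ^^ n) f z / fact n * (z + h - z) ^ n) sums f (z + h)"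
    by (rule holomorphic_power_series[OF hol]) (use h r in \<open>auto simp: dist_norm\<close>)
  then have s: "(\<lambda>n. (deriv ^^ n) f z / fact n * h ^ n) sums f (z + h)" by simp
  have "f (z + h) - (\<Sum>j<Suc d. (deriv ^^ j) f z / fact j * h ^ j) =
          (\<Sum>n. (deriv ^^ (n + Suc d)) f z / fact (n + Suc d) * h ^ (n + Suc d))"
    using suminf_minus_initial_segment[OF sums_summable[OF s], of "Suc d"] sums_unique[OF s] by simp
  also have "norm \<dots> \<le> (\<Sum>n. B * q ^ Suc d * (1 / 2) ^ n)"
  proof (rule norm_suminf_le)
    fix n
    have "norm ((deriv ^^ (n + Suc d)) f z / fact (n + Suc d) * h ^ (n + Suc d)) \<le>
            B / (r / 2) ^ (n + Suc d) * norm h ^ (n + Suc d)"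
      unfolding norm_mult norm_power by (intro mult_right_mono deriv) auto
    also have "\<dots> = B * q ^ (n + Suc d)"
      using r by (simp only: q_def power_divide power_mult_distrib) (simp add: field_simps)
    also have "\<dots> = B * q ^ Suc d * q ^ n" by (simp only: power_add mult_ac)
    also have "\<dots> \<le> B * q ^ Suc d * (1 / 2) ^ n"
      using q B0 by (intro mult_left_mono power_mono mult_nonneg_nonneg) auto
    finally show "norm ((deriv ^^ (n + Suc d)) f z / fact (n + Suc d) * h ^ (n + Suc d)) \<le> B * q ^ Suc d * (1 / 2) ^ n" .
  qed (intro summable_mult summable_geometric, simp)
  also have "\<dots> = 2 * B * q ^ Suc d"
    by (subst suminf_mult) (auto simp: suminf_geometric summable_geometric)
  finally show "norm (f (z + h) - (\<Sum>j\<le>d. (deriv ^^ j) f z / fact j * h ^ j)) \<le> 2 * B * (2 * norm h / r) ^ Suc d"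
    by (simp add: q_def lessThan_Suc_atMost)
qed

text \<open>Lets several powers of y on (0, c] be replaced by multiples of a single, smaller
  power.\<close>

lemma powr_le_powr_scaled:
  fixes y c e p :: real
  assumes "0 < y" "y \<le> c" "p \<le> e"
  shows "y powr e \<le> c powr (e - p) * y powr p"
proof -
  have "y powr e = y powr (e - p) * y powr p" by (simp flip: powr_add)
  also have "\<dots> \<le> c powr (e - p) * y powr p"
    using assms by (intro mult_right_mono powr_mono2) auto
  finally show ?thesis .
qed

text \<open>
  A weighted integral of vertical translates of \<open>H\<close>: Taylor's formula is used at heights that are large
  compared with the displacement \<open>h\<close>, and the growth bound below that.
\<close>
lemma vertical_integral_holder:
  fixes H :: "complex \<Rightarrow> complex" and x s A \<eta> C :: real
  assumes hol: "H holomorphic_on {z. Im z > 0}"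
    and A: "0 < A" "A < s" and \<eta>: "\<eta> \<ge> 0" and nonint: "s - A + \<eta> \<notin> \<int>"
    and C: "C \<ge> 0"
    and bound: "\<And>h y. y > 0 \<Longrightarrow> norm (H (Complex (x + h) y)) \<le> C * y powr (- A) * (y + \<bar>h\<bar>) powr \<eta>"
    and decay: "\<And>z. Im z \<ge> 1 / 2 \<Longrightarrow> norm (H z) \<le> C * Im z powr (- (s + 1))"
    and int: "\<And>u. (\<lambda>y. y powr (s - 1) *\<^sub>R H (Complex u y)) absolutely_integrable_on {0<..}"
  shows "\<exists>P K. int (degree P) \<le> \<lfloor>s - A + \<eta>\<rfloor> \<and>
     (\<forall>h. norm (integral {0<..} (\<lambda>y. y powr (s - 1) *\<^sub>R H (Complex (x + h) y)) - poly P (of_real h))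
            \<le> K * \<bar>h\<bar> powr (s - A + \<eta>))"
proof -
  define \<beta> where "\<beta> = s - A + \<eta>"
  define d where "d = nat \<lfloor>\<beta>\<rfloor>"
  have \<beta>0: "\<beta> > 0" using A \<eta> by (simp add: \<beta>_def)
  have d1: "real d \<le> \<beta>" "\<beta> < real d + 1" using \<beta>0 by (auto simp: d_def)
  \<comment> \<open>Strictness on both sides of d < \<beta> < d + 1 is what makes the integrals
    converge: the exponent \<beta> - 1 - d of the last Taylor coefficient exceeds -1 at 0, and the
    exponent \<beta> - d - 2 of the remainder is below -1 at infinity.\<close>
  have "real d \<noteq> \<beta>" using nonint unfolding \<beta>_def[symmetric] by (metis Ints_of_nat)
  then have d: "real d < \<beta>" "\<beta> < real d + 1" using d1 by auto
  define c where "c = (\<lambda>j y. y powr (s - 1) *\<^sub>R ((deriv ^^ j) H (Complex x y) / fact j))"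
  have oU: "open {z. Im z > (0::real)}" by (simp add: open_halfspace_Im_gt)
  have ball: "ball (Complex x y) (y / 2) \<subseteq> {z. y / 2 < Im z \<and> Im z < 2 * y \<and> \<bar>Re z - x\<bar> < y}" if "y > 0" for y
  proof
    fix z assume "z \<in> ball (Complex x y) (y / 2)"
    then have "norm (z - Complex x y) < y / 2" by (simp add: dist_norm norm_minus_commute)
    then have "\<bar>Im z - y\<bar> < y / 2" "\<bar>Re z - x\<bar> < y / 2"
      using abs_Im_le_cmod[of "z - Complex x y"] abs_Re_le_cmod[of "z - Complex x y"] by auto
    then show "z \<in> {z. y / 2 < Im z \<and> Im z < 2 * y \<and> \<bar>Re z - x\<bar> < y}" by (auto simp: abs_if split: if_splits)
  qed
  have holb: "H holomorphic_on ball (Complex x y) (y / 2)" if "y > 0" for y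
    using ball[OF that] that by (intro holomorphic_on_subset[OF hol]) (auto simp: subset_iff)
  \<comment> \<open>On the ball of radius y/2 the height exceeds y/2, which gives 2^A, and the
    height plus the horizontal offset stays below 3 y, which gives 3^\<eta>.\<close>
  define C1 where "C1 = C * 2 powr A * 3 powr \<eta>"
  have C1: "C1 \<ge> 0" using C by (simp add: C1_def)
  have Hb: "norm (H z) \<le> C1 * y powr (\<eta> - A)" if y: "y > 0" and z: "z \<in> ball (Complex x y) (y / 2)" for y z
  proof -
    have zz: "y / 2 < Im z" "Im z < 2 * y" "\<bar>Re z - x\<bar> < y" using ball[OF y] z by auto
    have "norm (H z) = norm (H (Complex (x + (Re z - x)) (Im z)))" by simp
    also have "\<dots> \<le> C * Im z powr (- A) * (Im z + \<bar>Re z - x\<bar>) powr \<eta>"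
      by (rule bound) (use zz y in linarith)
    also have "\<dots> \<le> C * (y / 2) powr (- A) * (3 * y) powr \<eta>"
      using zz y C A \<eta> by (intro mult_mono powr_mono2' powr_mono2) auto
    also have "\<dots> = C1 * y powr (\<eta> - A)"
      using y by (simp add: C1_def powr_divide powr_mult powr_diff powr_minus field_simps)
    finally show ?thesis .
  qed
  define C2 where "C2 = C * 2 powr (s + 1)"
  have C2: "C2 \<ge> 0" using C by (simp add: C2_def)
  have Hd: "norm (H z) \<le> C2 * y powr (- (s + 1))" if y: "y \<ge> 1" and z: "z \<in> ball (Complex x y) (y / 2)" for y z
  proof -
    have zz: "y / 2 < Im z" using ball[of y] y z by auto
    have "norm (H z) \<le> C * Im z powr (- (s + 1))" by (rule decay) (use zz y in linarith)
    also have "\<dots> \<le> C * (y / 2) powr (- (s + 1))"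
      using zz y C A by (intro mult_left_mono powr_mono2') auto
    also have "\<dots> = C2 * y powr (- (s + 1))"
    proof -
      have "(y / 2) powr (- (s + 1)) = y powr (- (s + 1)) / 2 powr (- (s + 1))"
        by (rule powr_divide)
      then show ?thesis by (simp only: C2_def powr_minus[of 2] divide_inverse inverse_inverse_eq mult_ac)
    qed
    finally show ?thesis .
  qed
  have cnear: "norm (c j y) \<le> C1 * 4 ^ j * y powr (\<beta> - 1 - real j)" if y: "y > 0" for j y
  proof -
    have "norm ((deriv ^^ j) H (Complex x y) / fact j) \<le> C1 * y powr (\<eta> - A) / (y / 2) ^ j * 2 ^ j"
      by (rule norm_higher_deriv_le[OF holb[OF y]]) (use y Hb in auto)
    also have "\<dots> = C1 * 4 ^ j * (y powr (\<eta> - A) / y powr real j)"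
      using y by (simp add: power_divide powr_realpow power_mult_distrib[symmetric] field_simps)
    finally have "norm (c j y) \<le> y powr (s - 1) * (C1 * 4 ^ j * (y powr (\<eta> - A) / y powr real j))"
      unfolding c_def norm_scaleR abs_of_nonneg[OF powr_ge_zero] by (rule mult_left_mono) simp
    also have "\<dots> = C1 * 4 ^ j * (y powr (s - 1) * y powr (\<eta> - A) / y powr real j)" by simp
    also have "y powr (s - 1) * y powr (\<eta> - A) / y powr real j = y powr (\<beta> - 1 - real j)"
      by (simp add: \<beta>_def flip: powr_add powr_diff) (simp add: algebra_simps)
    finally show ?thesis .
  qed
  have cfar: "norm (c j y) \<le> C2 * 4 ^ j * y powr (- 2)" if y: "y > 1" for j y
  proof -
    have "norm ((deriv ^^ j) H (Complex x y) / fact j) \<le> C2 * y powr (- (s + 1)) / (y / 2) ^ j * 2 ^ j"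
      by (rule norm_higher_deriv_le[OF holb]) (use y Hd in auto)
    also have "\<dots> = C2 * 4 ^ j * y powr (- (s + 1)) / y ^ j"
      using y by (simp add: power_divide power_mult_distrib[symmetric] field_simps)
    also have "\<dots> \<le> C2 * 4 ^ j * y powr (- (s + 1))"
      using y C2 divide_left_mono[of 1 "y ^ j" "C2 * 4 ^ j * y powr (- (s + 1))"] by simp
    finally have "norm (c j y) \<le> y powr (s - 1) * (C2 * 4 ^ j * y powr (- (s + 1)))"
      unfolding c_def norm_scaleR abs_of_nonneg[OF powr_ge_zero] by (rule mult_left_mono) simp
    also have "\<dots> = C2 * 4 ^ j * (y powr (s - 1) * y powr (- (s + 1)))" by simp
    also have "y powr (s - 1) * y powr (- (s + 1)) = y powr (- 2)" by (simp flip: powr_add)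
    finally show ?thesis .
  qed
  have ccont: "continuous_on {0<..} (c j)" for j
  proof -
    have "(deriv ^^ j) H holomorphic_on {z. Im z > 0}" by (rule holomorphic_higher_deriv[OF hol oU])
    then have "continuous_on {z. Im z > 0} ((deriv ^^ j) H)" by (rule holomorphic_on_imp_continuous_on)
    then have "continuous_on {0<..} (\<lambda>y. (deriv ^^ j) H (Complex x y))"
      by (rule continuous_on_compose2) (auto intro!: continuous_intros simp: Complex_eq)
    then show ?thesis unfolding c_def by (intro continuous_intros) auto
  qed
  have meas: "f \<in> borel_measurable (lebesgue_on {0<..})" if "continuous_on {0<..} f" for f :: "real \<Rightarrow> complex"
    by (rule continuous_imp_measurable_on_sets_lebesgue[OF that]) auto
  have cint: "c j absolutely_integrable_on {0<..}" if j: "j \<le> d" for j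
  proof (rule absolutely_integrable_powr_bounds[OF meas[OF ccont], of 1 "\<beta> - 1 - real j" "-2"])
    show "-1 < \<beta> - 1 - real j" using j d by linarith
  qed (use cnear cfar in auto)
  define P where "P = (\<Sum>j\<le>d. monom (integral {0<..} (c j)) j)"
  \<comment> \<open>A common lower exponent for all powers of t occurring at t \<le> 8 |h|: s - 1 -
    A comes from H itself, \<beta> - 1 - j from the Taylor terms with j \<le> d.\<close>
  define p where "p = min (s - 1 - A) (\<beta> - 1 - real d)"
  have p: "p > -1" using A d by (simp add: p_def)
  define K1 where "K1 = C * 9 powr \<eta> * 8 powr (s - 1 - A - p) + (\<Sum>j\<le>d. C1 * 4 ^ j * 8 powr (\<beta> - 1 - real j - p))"
  define K2 where "K2 = 2 * C1 * 4 ^ Suc d"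
  define K where "K = K1 * (8 powr (p + 1) / (p + 1)) + K2 * (8 powr (\<beta> - real d - 1) / (real d + 1 - \<beta>))"
  have main: "norm (integral {0<..} (\<lambda>y. y powr (s - 1) *\<^sub>R H (Complex (x + h) y)) - poly P (of_real h)) \<le> K * \<bar>h\<bar> powr \<beta>"
    if h: "h \<noteq> 0" for h
  proof -
    define D where "D = (\<lambda>y. y powr (s - 1) *\<^sub>R H (Complex (x + h) y) - (\<Sum>j\<le>d. c j y * of_real h ^ j))"
    have cj: "(\<lambda>y. c j y * of_real h ^ j) absolutely_integrable_on {0<..}" if "j \<le> d" for j
      using cint[OF that] by (rule set_integrable_mult_left)
    have "integral {0<..} D = integral {0<..} (\<lambda>y. y powr (s - 1) *\<^sub>R H (Complex (x + h) y)) -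
            integral {0<..} (\<lambda>y. \<Sum>j\<le>d. c j y * of_real h ^ j)"
      unfolding D_def by (intro integral_diff set_lebesgue_integral_eq_integral(1) int absolutely_integrable_sum cj) auto
    also have "integral {0<..} (\<lambda>y. \<Sum>j\<le>d. c j y * of_real h ^ j) = (\<Sum>j\<le>d. integral {0<..} (\<lambda>y. c j y * of_real h ^ j))"
      by (intro integral_sum set_lebesgue_integral_eq_integral(1) cj) auto
    also have "\<dots> = (\<Sum>j\<le>d. integral {0<..} (c j) * of_real h ^ j)"
      by simp
    also have "\<dots> = poly P (of_real h)" by (simp add: P_def poly_sum poly_monom)
    finally have eq: "integral {0<..} D = integral {0<..} (\<lambda>y. y powr (s - 1) *\<^sub>R H (Complex (x + h) y)) - poly P (of_real h)" .
    have Hcont: "continuous_on {0<..} (\<lambda>y. H (Complex (x + h) y))"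
      by (rule continuous_on_compose2[OF holomorphic_on_imp_continuous_on[OF hol]])
         (auto intro!: continuous_intros simp: Complex_eq)
    have Dcont: "continuous_on {0<..} D"
      unfolding D_def by (intro continuous_intros Hcont ccont) auto
    \<comment> \<open>The threshold 8 |h| is forced by the Taylor estimate: on the ball of radius
      t/2 it asks for |h| \<le> t/8. Below the threshold there is no cancellation to exploit, and H
      and the Taylor terms are bounded separately, with t + |h| \<le> 9 |h|.\<close>
    have near: "norm (D t) \<le> (K1 * \<bar>h\<bar> powr (\<beta> - 1 - p)) * t powr p" if t: "0 < t" "t \<le> 8 * \<bar>h\<bar>" for t
    proof -
      have "norm (D t) \<le> norm (t powr (s - 1) *\<^sub>R H (Complex (x + h) t)) + (\<Sum>j\<le>d. norm (c j t * of_real h ^ j))"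
        unfolding D_def by (rule order_trans[OF norm_triangle_ineq4 add_left_mono[OF norm_sum]])
      also have "norm (t powr (s - 1) *\<^sub>R H (Complex (x + h) t)) \<le>
                   C * 9 powr \<eta> * 8 powr (s - 1 - A - p) * \<bar>h\<bar> powr (\<beta> - 1 - p) * t powr p"
      proof -
        have "norm (t powr (s - 1) *\<^sub>R H (Complex (x + h) t)) \<le> t powr (s - 1) * (C * t powr (- A) * (t + \<bar>h\<bar>) powr \<eta>)"
          using bound[OF t(1), of h] by (simp add: mult_left_mono)
        also have "\<dots> \<le> t powr (s - 1) * (C * t powr (- A) * (9 * \<bar>h\<bar>) powr \<eta>)"
          using t C \<eta> by (intro mult_left_mono powr_mono2 mult_nonneg_nonneg) auto
        also have "\<dots> = C * 9 powr \<eta> * \<bar>h\<bar> powr \<eta> * t powr (s - 1 - A)"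
        proof -
          have "t powr (s - 1 - A) = t powr (s - 1) * t powr (- A)" by (simp flip: powr_add)
          then show ?thesis by (simp add: powr_mult)
        qed
        also have "\<dots> \<le> C * 9 powr \<eta> * \<bar>h\<bar> powr \<eta> * ((8 * \<bar>h\<bar>) powr (s - 1 - A - p) * t powr p)"
          using t C by (intro mult_left_mono powr_le_powr_scaled mult_nonneg_nonneg) (auto simp: p_def)
        also have "\<dots> = C * 9 powr \<eta> * 8 powr (s - 1 - A - p) * (\<bar>h\<bar> powr \<eta> * \<bar>h\<bar> powr (s - 1 - A - p)) * t powr p"
          by (simp add: powr_mult)
        also have "\<bar>h\<bar> powr \<eta> * \<bar>h\<bar> powr (s - 1 - A - p) = \<bar>h\<bar> powr (\<beta> - 1 - p)"
          by (simp add: \<beta>_def flip: powr_add) (simp add: algebra_simps)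
        finally show ?thesis .
      qed
      also have "(\<Sum>j\<le>d. norm (c j t * of_real h ^ j)) \<le>
           (\<Sum>j\<le>d. C1 * 4 ^ j * 8 powr (\<beta> - 1 - real j - p) * \<bar>h\<bar> powr (\<beta> - 1 - p) * t powr p)"
      proof (rule sum_mono)
        fix j assume j: "j \<in> {..d}"
        have "norm (c j t * of_real h ^ j) \<le> C1 * 4 ^ j * t powr (\<beta> - 1 - real j) * \<bar>h\<bar> ^ j"
          unfolding norm_mult norm_power norm_of_real by (intro mult_right_mono cnear t) auto
        also have "\<dots> \<le> C1 * 4 ^ j * ((8 * \<bar>h\<bar>) powr (\<beta> - 1 - real j - p) * t powr p) * \<bar>h\<bar> ^ j"
          using t C1 j by (intro mult_right_mono mult_left_mono powr_le_powr_scaled mult_nonneg_nonneg) (auto simp: p_def)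
        also have "\<dots> = C1 * 4 ^ j * 8 powr (\<beta> - 1 - real j - p) * (\<bar>h\<bar> powr (\<beta> - 1 - real j - p) * \<bar>h\<bar> powr real j) * t powr p"
          using h by (simp add: powr_mult powr_realpow)
        also have "\<bar>h\<bar> powr (\<beta> - 1 - real j - p) * \<bar>h\<bar> powr real j = \<bar>h\<bar> powr (\<beta> - 1 - p)"
          by (simp add: algebra_simps flip: powr_add)
        finally show "norm (c j t * of_real h ^ j) \<le> C1 * 4 ^ j * 8 powr (\<beta> - 1 - real j - p) * \<bar>h\<bar> powr (\<beta> - 1 - p) * t powr p" .
      qed
      finally show ?thesis by (simp add: K1_def ring_distribs sum_distrib_right)
    qed
    have far: "norm (D t) \<le> (K2 * \<bar>h\<bar> powr (real d + 1)) * t powr (\<beta> - real d - 2)" if t: "t > 8 * \<bar>h\<bar>" for t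
    proof -
      have t0: "t > 0" using t h by auto
      have "Complex (x + h) t = Complex x t + of_real h" by (simp add: complex_eq_iff)
      then have "D t = t powr (s - 1) *\<^sub>R (H (Complex x t + of_real h) - (\<Sum>j\<le>d. (deriv ^^ j) H (Complex x t) / fact j * of_real h ^ j))"
        by (simp add: D_def c_def scaleR_diff_right scaleR_sum_right)
      also have "norm \<dots> = t powr (s - 1) * norm (H (Complex x t + of_real h) - (\<Sum>j\<le>d. (deriv ^^ j) H (Complex x t) / fact j * of_real h ^ j))"
        by simp
      also have "\<dots> \<le> t powr (s - 1) * (2 * (C1 * t powr (\<eta> - A)) * (2 * norm (of_real h :: complex) / (t / 2)) ^ Suc d)"
        using t t0 h Hb[OF t0] by (intro mult_left_mono norm_Taylor_remainder_le holb) auto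
      also have "\<dots> = K2 * \<bar>h\<bar> ^ Suc d * (t powr (s - 1) * t powr (\<eta> - A) / t ^ Suc d)"
        by (simp add: K2_def power_divide power_mult_distrib field_simps)
      also have "\<bar>h\<bar> ^ Suc d = \<bar>h\<bar> powr (real d + 1)"
        using h powr_realpow[of "\<bar>h\<bar>" "Suc d"] by (simp add: add.commute)
      also have "t ^ Suc d = t powr (real d + 1)"
        using t0 powr_realpow[of t "Suc d"] by (simp add: add.commute)
      also have "t powr (s - 1) * t powr (\<eta> - A) / t powr (real d + 1) = t powr (\<beta> - real d - 2)"
        by (simp add: \<beta>_def flip: powr_add powr_diff) (simp add: algebra_simps)
      finally show ?thesis .
    qed
    have "norm (integral {0<..} D) \<le> (K1 * \<bar>h\<bar> powr (\<beta> - 1 - p)) * ((8 * \<bar>h\<bar>) powr (p + 1) / (p + 1)) +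
       (K2 * \<bar>h\<bar> powr (real d + 1)) * ((8 * \<bar>h\<bar>) powr (\<beta> - real d - 2 + 1) / (- (\<beta> - real d - 2) - 1))"
      by (rule norm_integral_powr_bounds[OF meas[OF Dcont] _ p _ near far]) (use h d in auto)
    also have "\<dots> = K1 * (8 powr (p + 1) / (p + 1)) * (\<bar>h\<bar> powr (\<beta> - 1 - p) * \<bar>h\<bar> powr (p + 1)) +
        K2 * (8 powr (\<beta> - real d - 1) / (real d + 1 - \<beta>)) * (\<bar>h\<bar> powr (real d + 1) * \<bar>h\<bar> powr (\<beta> - real d - 1))"
      by (simp add: powr_mult algebra_simps)
    also have "\<bar>h\<bar> powr (\<beta> - 1 - p) * \<bar>h\<bar> powr (p + 1) = \<bar>h\<bar> powr \<beta>" by (simp flip: powr_add)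
    also have "\<bar>h\<bar> powr (real d + 1) * \<bar>h\<bar> powr (\<beta> - real d - 1) = \<bar>h\<bar> powr \<beta>" by (simp flip: powr_add)
    finally show ?thesis unfolding eq K_def by (simp add: algebra_simps)
  qed
  have zero: "integral {0<..} (\<lambda>y. y powr (s - 1) *\<^sub>R H (Complex (x + 0) y)) = poly P 0"
  proof -
    have "poly P 0 = integral {0<..} (c 0)"
      by (simp add: P_def poly_sum poly_monom power_0_left if_distrib sum.delta cong: if_cong)
    then show ?thesis by (simp add: c_def)
  qed
  have "int (degree P) \<le> \<lfloor>\<beta>\<rfloor>"
  proof -
    have "degree P \<le> d"
      unfolding P_def by (rule degree_sum_le) (auto intro: order_trans[OF degree_monom_le])
    then show ?thesis using \<beta>0 by (simp add: d_def le_nat_iff)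
  qed
  moreover have "norm (integral {0<..} (\<lambda>y. y powr (s - 1) *\<^sub>R H (Complex (x + h) y)) - poly P (of_real h)) \<le> K * \<bar>h\<bar> powr \<beta>" for h
    using main[of h] zero by (cases "h = 0") auto
  ultimately show ?thesis unfolding \<beta>_def by blast
qed

section \<open>Bounds for modular forms and their Fourier coefficients\<close>

definition qexp :: "complex \<Rightarrow> complex" where
  "qexp z = exp (2 * of_real pi * \<i> * z)"

lemma norm_qexp: "norm (qexp z) = exp (- 2 * pi * Im z)"
  by (simp add: qexp_def)

lemma qexp_add: "qexp (z + w) = qexp z * qexp w"
  by (simp add: qexp_def distrib_left exp_add)

lemma qexp_of_nat_mult: "qexp (of_nat n * z) = qexp z ^ n"
  unfolding qexp_def exp_of_nat_mult[symmetric] by (simp add: mult_ac)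

lemma qexp_0 [simp]: "qexp 0 = 1"
  by (simp add: qexp_def)

lemma continuous_on_qexp [continuous_intros]: "continuous_on S f \<Longrightarrow> continuous_on S (\<lambda>x. qexp (f x))"
  unfolding qexp_def by (intro continuous_intros)

lemma fourier_expansion_qexp:
  assumes "has_fourier_expansion M r" "Im z > 0"
  shows "(\<lambda>n. r n * qexp (of_nat n * z)) sums M z"
  using assms unfolding has_fourier_expansion_def qexp_def by (simp add: mult.assoc)

lemma
  fixes f :: "nat \<Rightarrow> real \<Rightarrow> complex"
  assumes cont: "\<And>n. continuous_on {a..b} (f n)"
    and bound: "\<And>n t. t \<in> {a..b} \<Longrightarrow> norm (f n t) \<le> m n" and m: "summable m"
  shows continuous_on_suminf: "continuous_on {a..b} (\<lambda>t. \<Sum>n. f n t)"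
    and sums_integral_suminf: "(\<lambda>n. integral {a..b} (f n)) sums integral {a..b} (\<lambda>t. \<Sum>n. f n t)"
proof -
  have u: "uniform_limit {a..b} (\<lambda>n t. \<Sum>i<n. f i t) (\<lambda>t. \<Sum>i. f i t) sequentially"
    by (rule Weierstrass_m_test[OF bound m])
  have c: "continuous_on {a..b} (\<lambda>t. \<Sum>i<n. f i t)" for n
    by (intro continuous_intros cont)
  show "continuous_on {a..b} (\<lambda>t. \<Sum>n. f n t)"
    by (rule uniform_limit_theorem[OF _ u]) (auto intro: always_eventually c)
  obtain I J where I: "\<And>n. ((\<lambda>t. \<Sum>i<n. f i t) has_integral I n) {a..b}"
    and J: "((\<lambda>t. \<Sum>i. f i t) has_integral J) {a..b}" and IJ: "I \<longlonglongrightarrow> J"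
    using uniform_limit_integral[OF u c] by auto
  have "I n = (\<Sum>i<n. integral {a..b} (f i))" for n
    using integral_unique[OF I[of n]] integral_sum[of "{..<n}" f "{a..b}"]
      integrable_continuous_real[OF cont] by simp
  then have "I = (\<lambda>n. \<Sum>i<n. integral {a..b} (f i))" by (rule ext)
  then show "(\<lambda>n. integral {a..b} (f n)) sums integral {a..b} (\<lambda>t. \<Sum>n. f n t)"
    using IJ integral_unique[OF J] unfolding sums_def by simp
qed

lemma integral_qexp:
  "integral {a..a + 1} (\<lambda>t. qexp (of_int j * of_real t)) = (if j = 0 then 1 else 0)"
proof (cases "j = 0")
  case False
  let ?F = "\<lambda>t::real. qexp (of_int j * of_real t) / (2 * of_real pi * \<i> * of_int j)"
  have "((\<lambda>t. qexp (of_int j * of_real t)) has_integral (?F (a + 1) - ?F a)) {a..a + 1}"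
  proof (rule fundamental_theorem_of_calculus)
    fix x :: real
    have "((\<lambda>z. qexp (of_int j * z) / (2 * of_real pi * \<i> * of_int j)) has_field_derivative qexp (of_int j * of_real x)) (at (of_real x))"
      unfolding qexp_def using False by (auto intro!: derivative_eq_intros)
    then show "(?F has_vector_derivative qexp (of_int j * of_real x)) (at x within {a..a + 1})"
      by (rule has_vector_derivative_real_field[THEN has_vector_derivative_at_within])
  qed simp
  moreover have "qexp (of_int j * of_real (a + 1)) = qexp (of_int j * of_real a)"
  proof -
    have "qexp (of_int j) = 1" unfolding qexp_def
      using exp_integer_2pi[of "of_int j"] by (simp add: mult_ac)
    then show ?thesis by (simp add: distrib_left qexp_add)
  qed
  ultimately show ?thesis using False by (simp add: integral_unique)
qed simp

text \<open>As a power series in \<open>qexp\<close>, the expansion converges at height c/2, hence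
  absolutely at height c, where the modulus of the variable is strictly smaller.\<close>

lemma fourier_coeff_summable:
  assumes "has_fourier_expansion M r" "c > 0"
  shows "summable (\<lambda>n. norm (r n) * exp (- 2 * pi * real n * c))"
proof -
  define z where "z = Complex 0 (c / 2)"
  have "summable (\<lambda>n. r n * qexp z ^ n)"
    using sums_summable[OF fourier_expansion_qexp[OF assms(1), of z]] assms(2)
    by (simp add: z_def qexp_of_nat_mult)
  then have "summable (\<lambda>n. norm (r n * qexp (2 * z) ^ n))"
    by (rule powser_insidea) (use assms in \<open>simp add: norm_qexp z_def\<close>)
  moreover have "norm (r n * qexp (2 * z) ^ n) = norm (r n) * exp (- 2 * pi * real n * c)" for n
    by (simp add: norm_mult norm_power norm_qexp z_def exp_of_nat_mult[symmetric])
  ultimately show ?thesis by simp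
qed

text \<open>For n \<ge> 1 and Im z \<ge> c, one factor exp (-2 \<pi> Im z) can be split off, leaving
  the series at height c up to exp (2 \<pi> c). The argument uses the expansion alone, so it also
  serves the auxiliary series \<open>G\<close> of the converse direction.\<close>

lemma modular_form_decay:
  assumes "has_fourier_expansion M r" "c > 0"
  shows "\<exists>K\<ge>0. \<forall>z. Im z \<ge> c \<longrightarrow> norm (M z - r 0) \<le> K * exp (- 2 * pi * Im z)"
proof -
  define K where "K = exp (2 * pi * c) * (\<Sum>n. norm (r (Suc n)) * exp (- 2 * pi * real (Suc n) * c))"
  have sm: "summable (\<lambda>n. norm (r (Suc n)) * exp (- 2 * pi * real (Suc n) * c))"
    using fourier_coeff_summable[OF assms] by (subst summable_Suc_iff)
  have "K \<ge> 0" unfolding K_def by (intro mult_nonneg_nonneg suminf_nonneg sm) auto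
  moreover have "norm (M z - r 0) \<le> K * exp (- 2 * pi * Im z)" if z: "Im z \<ge> c" for z
  proof -
    have "Im z > 0" using z assms(2) by simp
    from fourier_expansion_qexp[OF assms(1) this]
    have s: "(\<lambda>n. r (Suc n) * qexp (of_nat (Suc n) * z)) sums (M z - r 0)"
      by (subst sums_Suc_iff) simp
    have "norm (M z - r 0) \<le> (\<Sum>n. exp (2 * pi * c) * exp (- 2 * pi * Im z) * (norm (r (Suc n)) * exp (- 2 * pi * real (Suc n) * c)))"
      unfolding sums_unique[OF s]
    proof (rule norm_suminf_le)
      fix n
      have "real n * c \<le> real n * Im z" using z by (intro mult_left_mono) auto
      then have "exp (- 2 * pi * real (Suc n) * Im z) \<le> exp (2 * pi * c + - 2 * pi * Im z + - 2 * pi * real (Suc n) * c)"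
        by (simp add: algebra_simps)
      then have "norm (r (Suc n)) * exp (- 2 * pi * real (Suc n) * Im z) \<le>
          norm (r (Suc n)) * exp (2 * pi * c + - 2 * pi * Im z + - 2 * pi * real (Suc n) * c)"
        by (rule mult_left_mono) simp
      then show "norm (r (Suc n) * qexp (of_nat (Suc n) * z)) \<le>
          exp (2 * pi * c) * exp (- 2 * pi * Im z) * (norm (r (Suc n)) * exp (- 2 * pi * real (Suc n) * c))"
        unfolding exp_add by (simp add: norm_mult norm_qexp mult_ac)
    qed (intro summable_mult sm)
    also have "\<dots> = K * exp (- 2 * pi * Im z)"
      unfolding suminf_mult[OF sm] K_def by (simp add: mult_ac)
    finally show ?thesis .
  qed
  ultimately show ?thesis by blast
qed

section \<open>Modular substitutions and pointwise bounds\<close>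

text \<open>Bezout coefficients complete the bottom row (c, d) to a matrix of determinant 1.\<close>

lemma modular_form_transform:
  assumes M: "modular_form k M" and z: "Im z > 0" and cd: "coprime c d"
  shows "\<exists>z'. Im z' = Im z / norm (of_int c * z + of_int d) ^ 2 \<and>
    M z' = (of_int c * z + of_int d) ^ k * M z"
proof -
  define w where "w = of_int c * z + of_int d"
  obtain u v where "u * c + v * d = 1" using bezout_int[of c d] cd by (auto simp: coprime_iff_gcd_eq_1)
  then have uv: "v * d - (- u) * c = 1" by simp
  define z' where "z' = (of_int v * z + of_int (- u)) / w"
  have "M z' = w ^ k * M z"
    using M z uv unfolding modular_form_def z'_def w_def by blast
  moreover have "Im z' = Im z / norm w ^ 2"
  proof -
    have "Im ((of_int v * z + of_int (- u)) * cnj w) = of_int (v * d - (- u) * c) * Im z"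
      by (simp add: w_def algebra_simps)
    then have "Im ((of_int v * z + of_int (- u)) * cnj w) = Im z" unfolding uv by simp
    then show ?thesis unfolding z'_def complex_div_cnj[of _ w] by (simp add: Im_divide_of_real flip: of_real_power)
  qed
  ultimately show ?thesis unfolding w_def by blast
qed

text \<open>Dirichlet's approximation theorem replaces reduction to a fundamental domain. With N
  about y^(-1/2) it yields a fraction h/c such that |c Re z - h| \<le> sqrt y and c y \<le> 2 sqrt
  y, hence |c z - h|^2 \<le> (1 + 4) y. The transformed height is then at least 1/5, a region where
  M is bounded.\<close>

lemma modular_form_bound:
  assumes M: "modular_form k M" and r: "has_fourier_expansion M r"
  shows "\<exists>B\<ge>0. \<forall>z. 0 < Im z \<and> Im z \<le> 1 \<longrightarrow>
    (\<exists>c d :: int. c \<ge> 1 \<and> norm (of_int c * z + of_int d) ^ 2 \<le> 5 * Im z \<and>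
       norm (M z) \<le> B / norm (of_int c * z + of_int d) ^ k)"
proof -
  obtain K where K: "K \<ge> 0" "\<And>z. Im z \<ge> 1 / 5 \<Longrightarrow> norm (M z - r 0) \<le> K * exp (- 2 * pi * Im z)"
    using modular_form_decay[OF r, of "1 / 5"] by auto
  define B where "B = K + norm (r 0)"
  have B: "norm (M z) \<le> B" if z: "Im z \<ge> 1 / 5" for z
  proof -
    have "norm (M z) \<le> norm (M z - r 0) + norm (r 0)" by (metis diff_add_cancel norm_triangle_ineq)
    also have "norm (M z - r 0) \<le> K * exp (- 2 * pi * Im z)" by (rule K(2)[OF z])
    also have "\<dots> \<le> K * 1" using K z by (intro mult_left_mono) auto
    finally show ?thesis by (simp add: B_def)
  qed
  have "\<exists>c d :: int. c \<ge> 1 \<and> norm (of_int c * z + of_int d) ^ 2 \<le> 5 * Im z \<and>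
       norm (M z) \<le> B / norm (of_int c * z + of_int d) ^ k" if z: "0 < Im z" "Im z \<le> 1" for z
  proof -
    define y where "y = Im z"
    have y: "0 < y" "y \<le> 1" using z by (auto simp: y_def)
    define N where "N = nat \<lceil>1 / sqrt y\<rceil>"
    have s: "0 < sqrt y" "sqrt y \<le> 1" using y by auto
    have s1: "1 / sqrt y \<ge> 1" using s by simp
    have N: "1 / sqrt y \<le> real N" "real N \<le> 1 / sqrt y + 1"
      unfolding N_def using s1 by linarith+
    have "real N \<ge> 1" using N(1) s1 by linarith
    then have N0: "N > 0" by simp
    have N1: "1 / real N \<le> sqrt y" using N s N0 by (simp add: field_simps)
    have N2: "real N * sqrt y \<le> 2"
    proof -
      have "real N * sqrt y \<le> (1 / sqrt y + 1) * sqrt y" using N s by (intro mult_right_mono) auto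
      also have "\<dots> = 1 + sqrt y" using s by (simp add: field_simps)
      finally show ?thesis using s(2) by linarith
    qed
    obtain h c where hc: "coprime h c" "0 < c" "c \<le> int N" "\<bar>of_int c * Re z - of_int h\<bar> < 1 / N"
      using Dirichlet_approx_coprime[OF N0] by blast
    define w where "w = of_int c * z + of_int (- h)"
    have "norm w ^ 2 = (of_int c * Re z - of_int h) ^ 2 + (of_int c * y) ^ 2"
      by (simp add: w_def cmod_power2 y_def)
    also have "\<dots> \<le> sqrt y ^ 2 + (2 * sqrt y) ^ 2"
    proof (intro add_mono)
      show "(of_int c * Re z - of_int h)\<^sup>2 \<le> (sqrt y)\<^sup>2"
        using hc(4) N1 s by (intro abs_le_square_iff[THEN iffD1]) auto
      have "of_int c * y \<le> real N * y" using hc y by (intro mult_right_mono) (auto simp: of_int_le_iff[symmetric] simp del: of_int_le_iff)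
      also have "\<dots> = (real N * sqrt y) * sqrt y" using y by simp
      also have "\<dots> \<le> 2 * sqrt y" using N2 s by (intro mult_right_mono) auto
      finally show "(of_int c * y)\<^sup>2 \<le> (2 * sqrt y)\<^sup>2" using hc y by (intro power_mono) auto
    qed
    also have "\<dots> = 5 * y" using y by (simp add: power_mult_distrib)
    finally have w5: "norm w ^ 2 \<le> 5 * y" .
    have "Im w = of_int c * y" by (simp add: w_def y_def)
    then have w0: "w \<noteq> 0" using hc y by auto
    obtain z' where z': "Im z' = y / norm w ^ 2" "M z' = w ^ k * M z"
      using modular_form_transform[OF M z(1), of c "- h"] hc(1)
      unfolding w_def y_def by (auto simp: coprime_commute)
    have "Im z' = y / norm w ^ 2" by (rule z'(1))
    also have "\<dots> \<ge> 1 / 5" using w5 w0 y by (simp add: field_simps)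
    finally have "norm (M z') \<le> B" by (intro B)
    then have "norm w ^ k * norm (M z) \<le> B"
      using z'(2) by (simp add: norm_mult norm_power)
    then have "norm (M z) \<le> B / norm w ^ k" using w0 by (simp add: field_simps)
    then show ?thesis using w5 hc(2) unfolding w_def y_def
      by (intro exI[of _ c] exI[of _ "- h"]) auto
  qed
  moreover have "B \<ge> 0" using K by (simp add: B_def)
  ultimately show ?thesis by blast
qed

text \<open>Uses only |c z + d| \<ge> c Im z \<ge> Im z; this is the growth bound for the case \<mu>
  = \<infinity>.\<close>

lemma modular_form_growth:
  assumes M: "modular_form k M" and r: "has_fourier_expansion M r"
  shows "\<exists>B\<ge>0. \<forall>z. 0 < Im z \<and> Im z \<le> 1 \<longrightarrow> norm (M z) \<le> B / Im z ^ k"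
proof -
  obtain B where B: "B \<ge> 0" and bd: "\<And>z. 0 < Im z \<Longrightarrow> Im z \<le> 1 \<Longrightarrow>
    (\<exists>c d :: int. c \<ge> 1 \<and> norm (of_int c * z + of_int d) ^ 2 \<le> 5 * Im z \<and>
       norm (M z) \<le> B / norm (of_int c * z + of_int d) ^ k)"
    using modular_form_bound[OF M r] by blast
  have "norm (M z) \<le> B / Im z ^ k" if z: "0 < Im z" "Im z \<le> 1" for z
  proof -
    obtain c d :: int where cd: "c \<ge> 1" "norm (M z) \<le> B / norm (of_int c * z + of_int d) ^ k"
      using bd[OF z] by blast
    have "1 * Im z \<le> of_int c * Im z" using cd z by (intro mult_right_mono) auto
    also have "\<dots> \<le> norm (of_int c * z + of_int d)"
      using abs_Im_le_cmod[of "of_int c * z + of_int d"] by simp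
    finally have "Im z ^ k \<le> norm (of_int c * z + of_int d) ^ k" using z by (intro power_mono) auto
    then have "B / norm (of_int c * z + of_int d) ^ k \<le> B / Im z ^ k"
      using B z by (intro divide_left_mono) (auto intro!: mult_pos_pos elim: less_le_trans[rotated])
    then show ?thesis using cd by simp
  qed
  then show ?thesis using B by blast
qed

section \<open>Horizontal mean values and the size of the Fourier coefficients\<close>

lemma integral_Cauchy_kernel_le:
  assumes "(y::real) > 0"
  shows "(\<lambda>x. 1 / ((x - t)\<^sup>2 + y\<^sup>2)) integrable_on {0..1}"
    and "integral {0..1} (\<lambda>x. 1 / ((x - t)\<^sup>2 + y\<^sup>2)) \<le> pi / y"
proof -
  let ?F = "\<lambda>x. arctan ((x - t) / y) / y"
  have nz: "(x - t)\<^sup>2 + y\<^sup>2 > 0" for x using assms by (simp add: sum_power2_gt_zero_iff)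
  have I: "((\<lambda>x. 1 / ((x - t)\<^sup>2 + y\<^sup>2)) has_integral (?F 1 - ?F 0)) {0..1}"
  proof (rule fundamental_theorem_of_calculus)
    fix x :: real
    have "1 + ((x - t) / y)\<^sup>2 = ((x - t)\<^sup>2 + y\<^sup>2) / y\<^sup>2" using assms by (simp add: power_divide add_divide_distrib)
    then have "inverse (1 + ((x - t) / y)\<^sup>2) * (1 / y) / y = 1 / ((x - t)\<^sup>2 + y\<^sup>2)"
      using assms nz[of x] by (simp add: power2_eq_square)
    moreover have "(?F has_field_derivative inverse (1 + ((x - t) / y)\<^sup>2) * (1 / y) / y) (at x within {0..1})"
      using assms by (auto intro!: derivative_eq_intros)
    ultimately show "(?F has_vector_derivative 1 / ((x - t)\<^sup>2 + y\<^sup>2)) (at x within {0..1})"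
      by (simp add: has_real_derivative_iff_has_vector_derivative)
  qed simp
  then show "(\<lambda>x. 1 / ((x - t)\<^sup>2 + y\<^sup>2)) integrable_on {0..1}" by (rule has_integral_integrable)
  have "?F 1 - ?F 0 = (arctan ((1 - t) / y) - arctan ((0 - t) / y)) / y" by (simp add: diff_divide_distrib)
  also have "\<dots> \<le> pi / y"
    using assms arctan_ubound[of "(1 - t) / y"] arctan_lbound[of "(0 - t) / y"]
    by (intro divide_right_mono) auto
  finally show "integral {0..1} (\<lambda>x. 1 / ((x - t)\<^sup>2 + y\<^sup>2)) \<le> pi / y"
    using I by (simp add: integral_unique)
qed

text \<open>The pair (c, d) depends on x, so the bound is enlarged to a sum over all pairs that can
  occur. In |c z + d|^(-k), all but two factors are estimated by |c z + d| \<ge> c y; the remaining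
  square is a Poisson-type kernel with integral at most \<pi>/y. There are O(c) values of d for each
  c, so the sum over c is that of c^(1-k). Averaging thus saves one power of y over the pointwise
  bound.\<close>

lemma integral_modular_form_le:
  assumes M: "modular_form k M" and r: "has_fourier_expansion M r" and k: "k \<ge> 3"
  shows "\<exists>C\<ge>0. \<forall>y. 0 < y \<and> y \<le> 1 \<longrightarrow> integral {0..1} (\<lambda>x. norm (M (Complex x y))) \<le> C / y ^ (k - 1)"
proof -
  obtain B where B: "B \<ge> 0" and bd: "\<And>z. 0 < Im z \<Longrightarrow> Im z \<le> 1 \<Longrightarrow>
    (\<exists>c d :: int. c \<ge> 1 \<and> norm (of_int c * z + of_int d) ^ 2 \<le> 5 * Im z \<and>
       norm (M z) \<le> B / norm (of_int c * z + of_int d) ^ k)"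
    using modular_form_bound[OF M r] by blast
  define S where "S = (\<Sum>n. inverse (real (Suc n) ^ 2))"
  have S: "summable (\<lambda>n. inverse (real (Suc n) ^ 2))"
    by (subst summable_Suc_iff) (rule inverse_power_summable, simp)
  have "integral {0..1} (\<lambda>x. norm (M (Complex x y))) \<le> (8 * pi * B * S) / y ^ (k - 1)" if y: "0 < y" "y \<le> 1" for y
  proof -
    define Q where "Q = nat \<lceil>3 / y\<rceil>"
    \<comment> \<open>The index c stands for the entry c + 1. From |(c+1) z + d|^2 \<le> 5 y one
      gets |(c+1) z + d| \<le> 3, which for x in [0, 1] confines d to the interval from -(c+1) - 3
      to 3 and c + 1 to at most 3/y.\<close>
    define I where "I = (SIGMA c:{..<Q}. {- int c - 4 .. 3 :: int})"
    define w where "w = (\<lambda>x (c, d). of_int (int c + 1) * Complex x y + of_int d)"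
    define t where "t = (\<lambda>(c::nat, d::int). - of_int d / (real c + 1))"
    define K where "K = (\<lambda>i x. B / (real (fst i) + 1) ^ k / y ^ (k - 2) * (1 / ((x - t i)\<^sup>2 + y\<^sup>2)))"
    have fI: "finite I" by (simp add: I_def)
    have k2: "k = k - 2 + 2" using k by simp
    have K0: "K i x \<ge> 0" for i x using B y by (simp add: K_def)
    have Kw: "B / norm (w x i) ^ k \<le> K i x" for i x
    proof -
      obtain c d where i: "i = (c, d)" by (cases i)
      define c' where "c' = real c + 1"
      have c': "c' > 0" by (simp add: c'_def)
      define D where "D = (x - t i)\<^sup>2 + y\<^sup>2"
      have Dy: "D \<ge> y\<^sup>2" "D > 0" using y by (auto simp: D_def sum_power2_gt_zero_iff)
      have "norm (w x i) ^ 2 = (c' * x + of_int d)\<^sup>2 + (c' * y)\<^sup>2"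
        by (simp add: w_def i cmod_power2 c'_def)
      also have "c' * x + of_int d = c' * (x - t i)" using c' by (simp add: t_def i c'_def field_simps)
      finally have n2: "norm (w x i) ^ 2 = c'\<^sup>2 * D" by (simp only: D_def power_mult_distrib distrib_left)
      have ny: "c' * y \<le> norm (w x i)"
        by (rule power2_le_imp_le) (use Dy c' in \<open>auto simp: n2 power_mult_distrib\<close>)
      have "c' ^ k * y ^ (k - 2) * D = (c' * y) ^ (k - 2) * (c'\<^sup>2 * D)"
      proof -
        have "c' ^ k = c' ^ (k - 2) * c'\<^sup>2" by (metis k2 power_add)
        then show ?thesis by (simp only: power_mult_distrib mult_ac)
      qed
      also have "\<dots> \<le> norm (w x i) ^ (k - 2) * norm (w x i) ^ 2"
        unfolding n2 using ny c' y Dy by (intro mult_right_mono power_mono) auto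
      also have "\<dots> = norm (w x i) ^ k" by (metis k2 power_add)
      finally have "B / norm (w x i) ^ k \<le> B / (c' ^ k * y ^ (k - 2) * D)"
        using B c' y Dy ny by (intro divide_left_mono) (auto intro!: mult_pos_pos zero_less_power elim: less_le_trans[rotated])
      then show ?thesis by (simp add: K_def i c'_def D_def)
    qed
    have main: "norm (M (Complex x y)) \<le> (\<Sum>i\<in>I. K i x)" if x: "x \<in> {0..1}" for x
    proof -
      obtain c d :: int where cd: "c \<ge> 1" "norm (of_int c * Complex x y + of_int d) ^ 2 \<le> 5 * y"
         "norm (M (Complex x y)) \<le> B / norm (of_int c * Complex x y + of_int d) ^ k"
        using bd[of "Complex x y"] y by auto
      define n where "n = nat (c - 1)"
      have n: "c = int n + 1" using cd by (simp add: n_def)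
      have "norm (of_int c * Complex x y + of_int d) ^ 2 \<le> 3 ^ 2" using cd y by (auto intro: order_trans)
      then have le3: "norm (of_int c * Complex x y + of_int d) \<le> 3" by (rule power2_le_imp_le) simp
      then have "of_int c * y \<le> 3" "\<bar>of_int c * x + of_int d\<bar> \<le> 3"
        using abs_Im_le_cmod[of "of_int c * Complex x y + of_int d"] abs_Re_le_cmod[of "of_int c * Complex x y + of_int d"]
        by auto
      moreover from this have "of_int c \<le> 3 / y" using y by (simp add: field_simps)
      then have "n < Q" unfolding Q_def using n by linarith
      moreover have "0 \<le> of_int c * x" "of_int c * x \<le> of_int c" using x cd by (auto simp: mult_left_le)
      moreover have "real_of_int c = real n + 1" by (simp add: n)
      ultimately have "n < Q" "real_of_int d \<le> 3" "real_of_int d \<ge> - real n - 4" by linarith+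
      then have "(n, d) \<in> I" unfolding I_def by simp
      have "norm (M (Complex x y)) \<le> B / norm (w x (n, d)) ^ k" using cd(3) by (simp add: w_def n)
      also have "\<dots> \<le> K (n, d) x" by (rule Kw)
      also have "\<dots> \<le> (\<Sum>i\<in>I. K i x)" using \<open>(n, d) \<in> I\<close> fI K0 by (intro member_le_sum) auto
      finally show ?thesis .
    qed
    have Kint: "K i integrable_on {0..1}" for i
      unfolding K_def by (intro integrable_on_mult_right integral_Cauchy_kernel_le y)
    have Kval: "integral {0..1} (K i) \<le> B / (real (fst i) + 1) ^ k / y ^ (k - 2) * (pi / y)" for i
    proof -
      have "integral {0..1} (K i) = B / (real (fst i) + 1) ^ k / y ^ (k - 2) * integral {0..1} (\<lambda>x. 1 / ((x - t i)\<^sup>2 + y\<^sup>2))"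
        unfolding K_def by (rule integral_mult_right)
      also have "\<dots> \<le> B / (real (fst i) + 1) ^ k / y ^ (k - 2) * (pi / y)"
        using B y by (intro mult_left_mono integral_Cauchy_kernel_le) auto
      finally show ?thesis .
    qed
    have cont: "continuous_on {0..1} (\<lambda>x. norm (M (Complex x y)))"
    proof -
      have "M holomorphic_on {z. Im z > 0}" using M by (simp add: modular_form_def)
      then have "continuous_on {0..1} (\<lambda>x. M (Complex x y))"
        by (rule continuous_on_compose2[OF holomorphic_on_imp_continuous_on])
          (use y in \<open>auto intro!: continuous_intros simp: Complex_eq\<close>)
      then show ?thesis by (rule continuous_on_norm)
    qed
    have "integral {0..1} (\<lambda>x. norm (M (Complex x y))) \<le> integral {0..1} (\<lambda>x. \<Sum>i\<in>I. K i x)"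
      using main by (intro integral_le integrable_continuous_real[OF cont] integrable_sum Kint fI) auto
    also have "\<dots> = (\<Sum>i\<in>I. integral {0..1} (K i))" by (rule integral_sum[OF fI Kint])
    also have "\<dots> \<le> (\<Sum>i\<in>I. B / (real (fst i) + 1) ^ k / y ^ (k - 2) * (pi / y))"
      by (intro sum_mono Kval)
    also have "\<dots> = (\<Sum>i\<in>I. B * pi / y ^ (k - 1) * (1 / (real (fst i) + 1) ^ k))"
    proof (rule sum.cong[OF refl])
      have "k - 1 = Suc (k - 2)" using k by simp
      then show "B / (real (fst i) + 1) ^ k / y ^ (k - 2) * (pi / y) = B * pi / y ^ (k - 1) * (1 / (real (fst i) + 1) ^ k)" for i :: "nat \<times> int"
        by simp
    qed
    also have "\<dots> = B * pi / y ^ (k - 1) * (\<Sum>i\<in>I. 1 / (real (fst i) + 1) ^ k)"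
      by (simp only: sum_distrib_left)
    also have "(\<Sum>i\<in>I. 1 / (real (fst i) + 1) ^ k) = (\<Sum>c<Q. \<Sum>d\<in>{- int c - 4..3}. 1 / (real c + 1) ^ k)"
      unfolding I_def by (subst sum.Sigma) (auto simp: case_prod_unfold)
    also have "\<dots> \<le> (\<Sum>c<Q. 8 * inverse (real (Suc c) ^ 2))"
    proof (rule sum_mono)
      fix c
      have "(\<Sum>d\<in>{- int c - 4..3}. 1 / (real c + 1) ^ k) = (real c + 8) / (real c + 1) ^ k"
        by simp
      also have "\<dots> \<le> 8 * (real c + 1) / (real c + 1) ^ k" by (intro divide_right_mono) auto
      also have "\<dots> \<le> 8 * (real c + 1) / (real c + 1) ^ 3"
        using k by (intro divide_left_mono power_increasing mult_pos_pos zero_less_power) auto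
      also have "\<dots> = 8 * inverse (real (Suc c) ^ 2)"
      proof -
        have "8 * a / a ^ 3 = 8 * inverse (a ^ 2)" if "a \<noteq> 0" for a :: real
          using that by (simp add: power3_eq_cube power2_eq_square field_simps)
        from this[of "real c + 1"] show ?thesis by (simp add: add.commute)
      qed
      finally show "(\<Sum>d\<in>{- int c - 4..3}. 1 / (real c + 1) ^ k) \<le> 8 * inverse (real (Suc c) ^ 2)" .
    qed
    also have "\<dots> = 8 * (\<Sum>c<Q. inverse (real (Suc c) ^ 2))" by (simp add: sum_distrib_left)
    also have "(\<Sum>c<Q. inverse (real (Suc c) ^ 2)) \<le> S"
      unfolding S_def by (rule sum_le_suminf[OF S]) auto
    finally have "integral {0..1} (\<lambda>x. norm (M (Complex x y))) \<le> B * pi / y ^ (k - 1) * (8 * S)"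
      using B y by (simp add: mult_left_mono divide_right_mono)
    then show ?thesis by (simp add: mult_ac)
  qed
  moreover have "S \<ge> 0" unfolding S_def by (rule suminf_nonneg[OF S]) simp
  ultimately show ?thesis using B by (intro exI[of _ "8 * pi * B * S"]) auto
qed

lemma fourier_coeff_integral:
  assumes r: "has_fourier_expansion M r" and y: "y > 0"
  shows "r n * exp (- 2 * pi * real n * y) = integral {0..1} (\<lambda>x. M (Complex x y) * qexp (- (of_nat n * of_real x)))"
proof -
  define f where "f = (\<lambda>m x. (r m * exp (- 2 * pi * real m * y)) * qexp (of_int (int m - int n) * of_real x))"
  have eq: "r m * qexp (of_nat m * Complex x y) * qexp (- (of_nat n * of_real x)) = f m x" for m x
    unfolding f_def qexp_def by (simp add: Complex_eq exp_of_real algebra_simps flip: exp_add exp_of_real)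
  have S: "summable (\<lambda>m. norm (r m) * exp (- 2 * pi * real m * y))"
    by (rule fourier_coeff_summable[OF r y])
  have f: "(\<lambda>m. f m x) sums (M (Complex x y) * qexp (- (of_nat n * of_real x)))" for x
    unfolding eq[symmetric] by (intro sums_mult2 fourier_expansion_qexp[OF r]) (use y in simp)
  have "(\<lambda>m. integral {0..1} (f m)) sums integral {0..1} (\<lambda>t. \<Sum>m. f m t)"
    by (rule sums_integral_suminf[OF _ _ S])
       (auto simp: f_def norm_mult norm_qexp intro!: continuous_intros)
  moreover have "integral {0..1} (f m) = (if m = n then r n * exp (- 2 * pi * real n * y) else 0)" for m
    using integral_qexp[of 0 "int m - int n"] unfolding f_def by simp
  ultimately have "(\<lambda>m. if m = n then r n * exp (- 2 * pi * real n * y) else 0) sums integral {0..1} (\<lambda>t. \<Sum>m. f m t)"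
    by simp
  then have "r n * exp (- 2 * pi * real n * y) = integral {0..1} (\<lambda>t. \<Sum>m. f m t)"
    using sums_single[of n "\<lambda>_. r n * exp (- 2 * pi * real n * y)"] sums_unique2 by blast
  then show ?thesis using sums_unique[OF f] by simp
qed

text \<open>At height y = 1/n the exponential factor of the n-th coefficient is a constant, and
  y^(-(k-1)) becomes n^(k-1).\<close>

lemma fourier_coeff_bound:
  assumes M: "modular_form k M" and r: "has_fourier_expansion M r" and k: "k \<ge> 3"
  shows "\<exists>C\<ge>0. \<forall>n\<ge>1. norm (r n) \<le> C * real n ^ (k - 1)"
proof -
  obtain C where C: "C \<ge> 0"
    and le: "\<And>y. 0 < y \<Longrightarrow> y \<le> 1 \<Longrightarrow> integral {0..1} (\<lambda>x. norm (M (Complex x y))) \<le> C / y ^ (k - 1)"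
    using integral_modular_form_le[OF assms] by blast
  have "norm (r n) \<le> (exp (2 * pi) * C) * real n ^ (k - 1)" if n: "n \<ge> 1" for n
  proof -
    define y where "y = 1 / real n"
    have y: "0 < y" "y \<le> 1" using n by (auto simp: y_def)
    have cont: "continuous_on {0..1} (\<lambda>x. M (Complex x y))"
      by (rule continuous_on_compose2[of "{z. Im z > 0}" M])
        (use y M in \<open>auto intro!: continuous_intros holomorphic_on_imp_continuous_on simp: Complex_eq modular_form_def\<close>)
    have "norm (r n * exp (- 2 * pi * real n * y)) \<le> integral {0..1} (\<lambda>x. norm (M (Complex x y)))"
      unfolding fourier_coeff_integral[OF r y(1)]
      by (intro integral_norm_bound_integral integrable_continuous_real continuous_intros cont)
        (auto simp: norm_mult norm_qexp)
    also have "\<dots> \<le> C / y ^ (k - 1)" by (rule le[OF y])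
    also have "\<dots> = C * real n ^ (k - 1)" by (simp add: y_def power_divide)
    finally have "norm (r n) * exp (- 2 * pi) \<le> C * real n ^ (k - 1)"
      using n by (simp add: norm_mult y_def)
    then show ?thesis by (simp add: exp_minus field_simps)
  qed
  then show ?thesis using C by (intro exI[of _ "exp (2 * pi) * C"]) auto
qed

lemma dirichlet_series_summable:
  assumes M: "modular_form k M" and r: "has_fourier_expansion M r" and k: "k \<ge> 3" and s: "s > real k"
  shows "summable (\<lambda>n. norm (r (Suc n)) * real (Suc n) powr (- s))"
proof -
  obtain C where C: "\<And>n. n \<ge> 1 \<Longrightarrow> norm (r n) \<le> C * real n ^ (k - 1)"
    using fourier_coeff_bound[OF M r k] by blast
  have "summable (\<lambda>n. real n powr (real k - 1 - s))"
    using s by (subst summable_real_powr_iff) auto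
  then have "summable (\<lambda>n. C * real (Suc n) powr (real k - 1 - s))"
    by (intro summable_mult) (subst summable_Suc_iff)
  then show ?thesis
  proof (rule summable_comparison_test'[of _ 0])
    fix n :: nat
    have "norm (r (Suc n)) * real (Suc n) powr (- s) \<le> C * real (Suc n) ^ (k - 1) * real (Suc n) powr (- s)"
      by (intro mult_right_mono C) auto
    also have "real (Suc n) ^ (k - 1) = real (Suc n) powr (real k - 1)"
      using k powr_realpow[of "real (Suc n)" "k - 1"] by (simp add: of_nat_diff)
    also have "C * real (Suc n) powr (real k - 1) * real (Suc n) powr (- s) = C * real (Suc n) powr (real k - 1 - s)"
      by (simp flip: powr_add)
    finally show "norm (norm (r (Suc n)) * real (Suc n) powr (- s)) \<le> C * real (Suc n) powr (real k - 1 - s)" by simp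
  qed
qed

section \<open>A periodic kernel with positive frequencies\<close>

lemma summable_power_mult_geometric:
  fixes q :: complex
  assumes "norm q < 1"
  shows "summable (\<lambda>n. norm (of_nat (Suc n) ^ m * q ^ Suc n))"
proof (cases "q = 0")
  case False
  define c where "c = - ln (norm q)"
  have c: "c > 0" using assms False by (simp add: c_def)
  have O: "(\<lambda>n. real (Suc n) powr real m * exp (- (c * real (Suc n)))) \<in> O(\<lambda>n. inverse (real (Suc n) ^ 2))"
    using c by real_asymp
  have "summable (\<lambda>n. inverse (real (Suc n) ^ 2))"
    by (subst summable_Suc_iff) (rule inverse_power_summable, simp)
  then have "summable (\<lambda>n. real (Suc n) powr real m * exp (- (c * real (Suc n))))"
    by (intro summable_comparison_test_bigo[OF _ O]) simp
  moreover have "norm (of_nat (Suc n) ^ m * q ^ Suc n) = real (Suc n) powr real m * exp (- (c * real (Suc n)))" for n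
  proof -
    have "norm q ^ Suc n = exp (real (Suc n) * ln (norm q))"
      using False by (simp add: exp_of_nat_mult del: of_nat_Suc)
    moreover have "norm (of_nat (Suc n) ^ m :: complex) = real (Suc n) powr real m"
      by (subst powr_realpow) (simp_all only: norm_power norm_of_nat of_nat_0_less_iff zero_less_Suc)
    ultimately show ?thesis by (simp only: norm_mult norm_power c_def) (simp add: mult.commute)
  qed
  ultimately show ?thesis by simp
qed simp

text \<open>The polylogarithm of order -m, a rational function whose pole at q = 1 has order m +
  1.\<close>

definition power_geometric :: "nat \<Rightarrow> complex \<Rightarrow> complex" where
  "power_geometric m q = (\<Sum>n. of_nat (Suc n) ^ m * q ^ Suc n)"

lemma power_geometric_sums:
  assumes "norm q < 1"
  shows "(\<lambda>n. of_nat (Suc n) ^ m * q ^ Suc n) sums power_geometric m q"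
  unfolding power_geometric_def
  by (intro summable_sums summable_norm_cancel[OF summable_power_mult_geometric[OF assms]])

text \<open>Subtracting the series multiplied by q from itself replaces l^m by (l + 1)^m - l^m, of
  lower degree in l. This makes an induction on m possible without a closed form.\<close>

lemma power_geometric_recurrence:
  assumes q: "norm q < 1"
  shows "(1 - q) * power_geometric m q = q * (1 + (\<Sum>j<m. of_nat (m choose j) * power_geometric j q))"
proof -
  note S = power_geometric_sums[OF q]
  have 1: "(\<lambda>n. of_nat (Suc (Suc n)) ^ m * q ^ Suc (Suc n)) sums (power_geometric m q - q)"
    using S[of m] by (subst sums_Suc_iff) simp
  have 2: "(\<lambda>n. q * (of_nat (Suc n) ^ m * q ^ Suc n)) sums (q * power_geometric m q)"
    by (intro sums_mult S)
  have 3: "(\<lambda>n. q * (\<Sum>j<m. of_nat (m choose j) * (of_nat (Suc n) ^ j * q ^ Suc n))) sums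
      (q * (\<Sum>j<m. of_nat (m choose j) * power_geometric j q))"
    by (intro sums_mult sums_sum S)
  have binom: "(a + 1) ^ m - a ^ m = (\<Sum>j<m. of_nat (m choose j) * a ^ j)" for a :: complex
    unfolding binomial_ring by (simp add: lessThan_Suc_atMost[symmetric])
  have "of_nat (Suc (Suc n)) ^ m * q ^ Suc (Suc n) - q * (of_nat (Suc n) ^ m * q ^ Suc n) =
      q * (\<Sum>j<m. of_nat (m choose j) * (of_nat (Suc n) ^ j * q ^ Suc n))" for n
  proof -
    have "of_nat (Suc (Suc n)) ^ m * q ^ Suc (Suc n) - q * (of_nat (Suc n) ^ m * q ^ Suc n) =
        q * (((of_nat (Suc n) + 1) ^ m - of_nat (Suc n) ^ m) * q ^ Suc n)"
      by (simp add: algebra_simps)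
    also have "\<dots> = q * (\<Sum>j<m. of_nat (m choose j) * (of_nat (Suc n) ^ j * q ^ Suc n))"
      unfolding binom sum_distrib_right by (simp only: mult.assoc)
    finally show ?thesis .
  qed
  then have "power_geometric m q - q - q * power_geometric m q = q * (\<Sum>j<m. of_nat (m choose j) * power_geometric j q)"
    using sums_unique2[OF sums_diff[OF 1 2]] 3 by simp
  then show ?thesis by (simp add: algebra_simps)
qed

text \<open>By the recurrence, each order j < m contributes a pole of order j + 1 \<le> m, and
  dividing by 1 - q raises it by one. Poles of lower order are absorbed because |1 - q| \<le>
  2.\<close>

lemma power_geometric_bound:
  "\<exists>C\<ge>0. \<forall>q. norm q < 1 \<longrightarrow> norm (power_geometric m q) \<le> C / norm (1 - q) ^ Suc m"
proof (induction m rule: less_induct)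
  case (less m)
  have "\<forall>j. \<exists>C. j < m \<longrightarrow> C \<ge> 0 \<and> (\<forall>q. norm q < 1 \<longrightarrow> norm (power_geometric j q) \<le> C / norm (1 - q) ^ Suc j)"
    using less by blast
  then obtain C where C: "\<And>j. j < m \<Longrightarrow> C j \<ge> 0"
    "\<And>j q. j < m \<Longrightarrow> norm q < 1 \<Longrightarrow> norm (power_geometric j q) \<le> C j / norm (1 - q) ^ Suc j"
    by metis
  define K where "K = 2 ^ m + (\<Sum>j<m. of_nat (m choose j) * (C j * 2 ^ m))"
  have K0: "K \<ge> 0" unfolding K_def using C by (intro add_nonneg_nonneg sum_nonneg) auto
  have "norm (power_geometric m q) \<le> K / norm (1 - q) ^ Suc m" if q: "norm q < 1" for q :: complex
  proof -
    define d where "d = norm (1 - q)"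
    have d: "0 < d" "d \<le> 2"
      using q norm_triangle_ineq4[of 1 q] by (auto simp: d_def)
    have pw: "1 / d ^ j \<le> 2 ^ m / d ^ m" if "j \<le> m" for j
    proof -
      have "d ^ m = d ^ j * d ^ (m - j)" using that by (simp flip: power_add)
      also have "\<dots> \<le> d ^ j * 2 ^ (m - j)" using d by (intro mult_left_mono power_mono) auto
      also have "\<dots> \<le> d ^ j * 2 ^ m" using d by (intro mult_left_mono power_increasing) auto
      finally show ?thesis using d by (simp add: field_simps)
    qed
    have "d * norm (power_geometric m q) = norm q * norm (1 + (\<Sum>j<m. of_nat (m choose j) * power_geometric j q))"
      unfolding d_def norm_mult[symmetric] power_geometric_recurrence[OF q] ..
    also have "\<dots> \<le> 1 * norm (1 + (\<Sum>j<m. of_nat (m choose j) * power_geometric j q))"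
      using q by (intro mult_right_mono) auto
    also have "\<dots> \<le> 1 + (\<Sum>j<m. norm (of_nat (m choose j) * power_geometric j q))"
      by (rule order_trans[OF _ add_mono[OF _ norm_sum]]) (auto intro: norm_triangle_ineq order_trans)
    also have "\<dots> \<le> 2 ^ m / d ^ m + (\<Sum>j<m. of_nat (m choose j) * (C j * (2 ^ m / d ^ m)))"
    proof (intro add_mono sum_mono)
      show "1 \<le> 2 ^ m / d ^ m" using pw[of 0] by simp
      fix j assume j: "j \<in> {..<m}"
      have "norm (of_nat (m choose j) * power_geometric j q) \<le> of_nat (m choose j) * (C j * (1 / d ^ Suc j))"
      proof -
        have "norm (power_geometric j q) \<le> C j * (1 / d ^ Suc j)"
          using C(2)[of j q] j q by (simp add: d_def)
        then show ?thesis unfolding norm_mult norm_of_nat by (rule mult_left_mono) simp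
      qed
      also have "\<dots> \<le> of_nat (m choose j) * (C j * (2 ^ m / d ^ m))"
        using j C(1)[of j] pw[of "Suc j"] by (intro mult_left_mono) auto
      finally show "norm (of_nat (m choose j) * power_geometric j q) \<le> of_nat (m choose j) * (C j * (2 ^ m / d ^ m))" .
    qed
    also have "\<dots> = K / d ^ m" by (simp add: K_def add_divide_distrib sum_divide_distrib)
    finally have "norm (power_geometric m q) \<le> K / d ^ m / d"
      using d by (simp only: pos_le_divide_eq) (simp add: mult.commute)
    then show ?thesis by (simp add: d_def mult.commute)
  qed
  then show ?case using K0 by blast
qed

lemma qexp_eq_1_iff: "qexp w = 1 \<longleftrightarrow> w \<in> \<int>"
proof -
  have "qexp w = 1 \<longleftrightarrow> (\<exists>n::int. w = of_int n)"
    unfolding qexp_def exp_eq_1 by (simp add: complex_eq_iff) (metis mult.commute)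
  then show ?thesis by (auto elim: Ints_cases)
qed

text \<open>The quotient (\<open>qexp\<close> w - 1) / w, completed by 2 \<pi> i at 0, is continuous
  and has no zero on the compact rectangle, since the numerator vanishes only at integers. The width
  3/4 is half a period plus the offset 1/4 later allowed between Re z and the base point.\<close>

lemma norm_one_minus_qexp_ge:
  "\<exists>c>0. \<forall>w. 0 \<le> Im w \<and> Im w \<le> 1 \<and> \<bar>Re w\<bar> \<le> 3 / 4 \<longrightarrow> c * norm w \<le> norm (1 - qexp w)"
proof -
  define S where "S = cbox (Complex (- 3 / 4) 0) (Complex (3 / 4) 1)"
  define g where "g = (\<lambda>w. if w = 0 then 2 * of_real pi * \<i> else (qexp w - 1) / w)"
  have S: "w \<in> S \<longleftrightarrow> 0 \<le> Im w \<and> Im w \<le> 1 \<and> \<bar>Re w\<bar> \<le> 3 / 4" for w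
    by (auto simp: S_def in_cbox_complex_iff)
  have "isCont g w" for w
  proof (cases "w = 0")
    case True
    have "(qexp has_field_derivative 2 * of_real pi * \<i>) (at 0)"
      unfolding qexp_def[abs_def] by (auto intro!: derivative_eq_intros)
    then have "((\<lambda>h. (qexp h - 1) / h) \<longlongrightarrow> 2 * of_real pi * \<i>) (at 0)"
      by (simp add: DERIV_def)
    then have "(g \<longlongrightarrow> 2 * of_real pi * \<i>) (at 0)"
      by (rule Lim_transform_eventually) (auto simp: g_def eventually_at_filter)
    then show ?thesis by (simp add: True isCont_def g_def)
  next
    case False
    have "isCont (\<lambda>w. (qexp w - 1) / w) w" unfolding qexp_def using False by (intro continuous_intros)
    moreover have "\<forall>\<^sub>F v in nhds w. g v = (qexp v - 1) / v"
      using t1_space_nhds[OF False] by eventually_elim (simp add: g_def)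
    ultimately show ?thesis using isCont_cong[of g "\<lambda>w. (qexp w - 1) / w" w] by blast
  qed
  then have "continuous_on S (\<lambda>w. norm (g w))"
    by (intro continuous_on_norm continuous_at_imp_continuous_on) auto
  moreover have "compact S" "S \<noteq> {}" using S[of 0] by (auto simp: S_def)
  ultimately obtain v where v: "v \<in> S" "\<And>w. w \<in> S \<Longrightarrow> norm (g v) \<le> norm (g w)"
    using continuous_attains_inf[of S "\<lambda>w. norm (g w)"] by blast
  have "g v \<noteq> 0"
  proof
    assume "g v = 0"
    then have "v \<noteq> 0" "v \<in> \<int>" unfolding qexp_eq_1_iff[symmetric] by (auto simp: g_def split: if_splits)
    then obtain n where "v = of_int n" "n \<noteq> 0" by (auto elim: Ints_cases)
    then have "\<bar>real_of_int n\<bar> \<le> 3 / 4" using v(1) by (simp add: S)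
    then show False using \<open>n \<noteq> 0\<close> by linarith
  qed
  moreover have "norm (g v) * norm w \<le> norm (1 - qexp w)" if "w \<in> S" for w
    using v(2)[OF that] by (cases "w = 0") (auto simp: g_def norm_divide field_simps norm_minus_commute)
  ultimately show ?thesis using S by (intro exI[of _ "norm (g v)"]) auto
qed

lemma qexp_kernel_bound:
  "\<exists>C\<ge>0. \<forall>w. 0 < Im w \<and> Im w \<le> 1 \<and> \<bar>Re w\<bar> \<le> 3 / 4 \<longrightarrow>
     norm (power_geometric m (qexp w)) \<le> C / norm w ^ Suc m"
proof -
  obtain C where C: "C \<ge> 0" "\<And>q. norm q < 1 \<Longrightarrow> norm (power_geometric m q) \<le> C / norm (1 - q) ^ Suc m"
    using power_geometric_bound[of m] by blast
  obtain c where c: "c > 0" "\<And>w. 0 \<le> Im w \<Longrightarrow> Im w \<le> 1 \<Longrightarrow> \<bar>Re w\<bar> \<le> 3 / 4 \<Longrightarrow> c * norm w \<le> norm (1 - qexp w)"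
    using norm_one_minus_qexp_ge by blast
  have "norm (power_geometric m (qexp w)) \<le> C / c ^ Suc m / norm w ^ Suc m"
    if w: "0 < Im w" "Im w \<le> 1" "\<bar>Re w\<bar> \<le> 3 / 4" for w
  proof -
    have w0: "norm w > 0" using w by auto
    have "norm (power_geometric m (qexp w)) \<le> C / norm (1 - qexp w) ^ Suc m"
      by (rule C) (use w in \<open>simp add: norm_qexp\<close>)
    also have "\<dots> \<le> C / (c * norm w) ^ Suc m"
    proof (rule divide_left_mono)
      show "(c * norm w) ^ Suc m \<le> norm (1 - qexp w) ^ Suc m"
        using c w w0 by (intro power_mono) auto
      have "0 < c * norm w" using c w0 by simp
      moreover have "c * norm w \<le> norm (1 - qexp w)" using c w by auto
      ultimately show "0 < norm (1 - qexp w) ^ Suc m * (c * norm w) ^ Suc m"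
        by (metis less_le_trans mult_pos_pos zero_less_power)
    qed (rule C)
    also have "\<dots> = C / c ^ Suc m / norm w ^ Suc m" by (simp add: power_mult_distrib)
    finally show ?thesis .
  qed
  then show ?thesis using C c by (intro exI[of _ "C / c ^ Suc m"]) auto
qed

text \<open>
  Near \<open>0\<close> a polynomial agrees to any prescribed order with a trigonometric polynomial that has only
  nonpositive frequencies: replace \<open>y = - log (1 - U) / (2 \<pi> i)\<close>, where \<open>U = 1 - qexp (- y)\<close>, by a
  partial sum \<open>L(U)\<close> of the logarithmic series. The error has derivative \<open>U^D\<close>.
\<close>
lemma polynomial_trig_approx:
  fixes P :: "complex poly"
  shows "\<exists>Q C. \<forall>y::real. \<bar>y\<bar> \<le> 1 / 2 \<longrightarrow>
    norm (poly P (of_real y) - poly Q (qexp (- of_real y))) \<le> C * \<bar>y\<bar> ^ Suc D"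
proof -
  define L :: "complex poly" where "L = (\<Sum>l<D. monom (1 / (2 * of_real pi * \<i> * of_nat (Suc l))) (Suc l))"
  define \<phi> where "\<phi> = (\<lambda>z. z - poly L (1 - qexp (- z)))"
  have dL: "poly (pderiv L) U = (\<Sum>l<D. U ^ l) / (2 * of_real pi * \<i>)" for U
  proof -
    have "poly (pderiv (monom (1 / (2 * of_real pi * \<i> * of_nat (Suc l))) (Suc l))) U = U ^ l / (2 * of_real pi * \<i>)" for l
      by (simp add: pderiv_monom poly_monom del: of_nat_Suc)
    then show ?thesis unfolding L_def
      by (induction D) (simp_all add: pderiv_add add_divide_distrib)
  qed
  have der: "(\<phi> has_field_derivative (1 - qexp (- z)) ^ D) (at z)" for z
  proof -
    define U where "U = 1 - qexp (- z)"
    have "(\<phi> has_field_derivative 1 - poly (pderiv L) U * (2 * of_real pi * \<i> * qexp (- z))) (at z)"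
      unfolding \<phi>_def U_def
      by (auto intro!: derivative_eq_intros DERIV_chain2[OF poly_DERIV] simp: qexp_def)
    also have "1 - poly (pderiv L) U * (2 * of_real pi * \<i> * qexp (- z)) = 1 - (1 - U) * (\<Sum>l<D. U ^ l)"
    proof -
      have "a / c * (c * b) = b * a" if "c \<noteq> 0" for a b c :: complex using that by simp
      from this[of "2 * of_real pi * \<i>"] show ?thesis unfolding dL by (simp only: U_def) simp
    qed
    also have "\<dots> = U ^ D" by (simp only: one_diff_power_eq[symmetric]) simp
    finally show ?thesis unfolding U_def .
  qed
  have U: "norm (1 - qexp (- of_real u)) \<le> 2 * pi * \<bar>u\<bar>" for u :: real
  proof -
    have "norm (1 - qexp (- of_real u)) = norm (exp (\<i> * of_real (- 2 * pi * u)) - 1)"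
      by (simp add: qexp_def norm_minus_commute mult_ac)
    also have "\<dots> = 2 * \<bar>sin (- 2 * pi * u / 2)\<bar>" by (rule dist_exp_i_1)
    also have "\<dots> \<le> 2 * \<bar>- 2 * pi * u / 2\<bar>" by (intro mult_left_mono abs_sin_x_le_abs_x) auto
    finally show ?thesis by (simp add: abs_mult)
  qed
  have \<phi>: "norm (\<phi> (of_real y)) \<le> (2 * pi) ^ D * \<bar>y\<bar> ^ Suc D" for y :: real
  proof -
    have "norm (\<phi> (of_real y) - \<phi> 0) \<le> (2 * pi * \<bar>y\<bar>) ^ D * norm (of_real y - 0 :: complex)"
    proof (rule field_differentiable_bound[where S = "closed_segment 0 (of_real y)" and f' = "\<lambda>z. (1 - qexp (- z)) ^ D"])
      fix z :: complex assume z: "z \<in> closed_segment 0 (of_real y)"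
      show "(\<phi> has_field_derivative (1 - qexp (- z)) ^ D) (at z within closed_segment 0 (of_real y))"
        by (rule has_field_derivative_at_within[OF der])
      obtain t where t: "0 \<le> t" "t \<le> 1" "z = of_real (t * y)"
        using z by (auto simp: closed_segment_def scaleR_conv_of_real)
      have "norm (1 - qexp (- z)) \<le> 2 * pi * \<bar>t * y\<bar>" using U[of "t * y"] t(3) by simp
      also have "\<dots> \<le> 2 * pi * \<bar>y\<bar>" using t by (simp add: abs_mult mult_left_le_one_le)
      finally show "norm ((1 - qexp (- z)) ^ D) \<le> (2 * pi * \<bar>y\<bar>) ^ D"
        unfolding norm_power by (intro power_mono) auto
    qed auto
    moreover have "\<phi> 0 = 0" by (simp add: \<phi>_def L_def poly_sum poly_monom)
    ultimately show ?thesis by (simp add: power_mult_distrib mult_ac)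
  qed
  \<comment> \<open>A radius containing both y and its approximation w, so that the mean value
    inequality for P applies on one convex disc.\<close>
  define R where "R = 1 / 2 + (2 * pi) ^ D"
  have R: "R \<ge> 1 / 2" by (simp add: R_def)
  have "compact (poly (pderiv P) ` cball 0 R)"
    by (intro compact_continuous_image continuous_intros) auto
  then obtain B where B: "\<And>z. z \<in> cball 0 R \<Longrightarrow> norm (poly (pderiv P) z) \<le> B"
    using compact_imp_bounded[THEN bounded_iff[THEN iffD1]] by (metis imageI)
  have "norm (poly (pderiv P) 0) \<le> B" using B[of 0] R by simp
  then have B0: "B \<ge> 0" using norm_ge_zero[of "poly (pderiv P) 0"] by linarith
  \<comment> \<open>P after L after 1 - X: a polynomial to be evaluated at \<open>qexp\<close> (-y),
    hence without positive frequencies.\<close>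
  define Q where "Q = pcompose P (pcompose L [:1, -1:])"
  have "norm (poly P (of_real y) - poly Q (qexp (- of_real y))) \<le> (B * (2 * pi) ^ D) * \<bar>y\<bar> ^ Suc D"
    if y: "\<bar>y\<bar> \<le> 1 / 2" for y :: real
  proof -
    define w where "w = poly L (1 - qexp (- of_real y))"
    have yw: "of_real y - w = \<phi> (of_real y)" by (simp add: \<phi>_def w_def)
    have "\<bar>y\<bar> ^ Suc D \<le> 1" using y by (intro power_le_one) auto
    then have "(2 * pi) ^ D * \<bar>y\<bar> ^ Suc D \<le> (2 * pi) ^ D * 1" by (intro mult_left_mono) auto
    then have "norm (\<phi> (of_real y)) \<le> (2 * pi) ^ D" using \<phi>[of y] by linarith
    moreover have w: "w = of_real y - \<phi> (of_real y)" using yw by (simp add: algebra_simps)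
    have "norm w \<le> \<bar>y\<bar> + norm (\<phi> (of_real y))"
      unfolding w by (rule order_trans[OF norm_triangle_ineq4]) simp
    ultimately have "norm w \<le> R" using y unfolding R_def by linarith
    then have "norm (poly P (of_real y) - poly P w) \<le> B * norm (of_real y - w)"
      using y R by (intro field_differentiable_bound[where S = "cball 0 R" and f' = "poly (pderiv P)"])
        (auto intro: has_field_derivative_at_within poly_DERIV B)
    also have "\<dots> \<le> B * ((2 * pi) ^ D * \<bar>y\<bar> ^ Suc D)"
      unfolding yw by (intro mult_left_mono \<phi> B0)
    finally show ?thesis by (simp add: Q_def poly_pcompose w_def)
  qed
  then show ?thesis by blast
qed

text \<open>The kernel picks out the Fourier coefficients of g at frequencies l \<ge> 1, weighted by
  l^m. Its expansion converges uniformly in t because |\<open>qexp\<close> (z - t)| does not depend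
  on the real number t.\<close>

lemma periodic_kernel_sums:
  fixes g :: "real \<Rightarrow> complex"
  assumes g: "continuous_on {u..v} g" and z: "Im z > 0"
  shows "(\<lambda>l. of_nat (Suc l) ^ m * qexp z ^ Suc l * integral {u..v} (\<lambda>t. g t * qexp (- (of_nat (Suc l) * of_real t))))
           sums integral {u..v} (\<lambda>t. g t * power_geometric m (qexp (z - of_real t)))"
proof -
  have q: "norm (qexp (z - of_real t)) < 1" for t using z by (simp add: norm_qexp)
  have qz: "norm (qexp z) < 1" using z by (simp add: norm_qexp)
  define f where "f = (\<lambda>l t. (of_nat (Suc l) ^ m * qexp z ^ Suc l) * (g t * qexp (- (of_nat (Suc l) * of_real t))))"
  have eq: "g t * (of_nat (Suc l) ^ m * qexp (z - of_real t) ^ Suc l) = f l t" for l t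
  proof -
    have "qexp (z - of_real t) ^ Suc l = qexp z ^ Suc l * qexp (- (of_nat (Suc l) * of_real t))"
      unfolding qexp_of_nat_mult[symmetric] qexp_add[symmetric] by (simp only: diff_conv_add_uminus distrib_left mult_minus_right)
    then show ?thesis by (simp only: f_def mult_ac)
  qed
  have "compact (g ` {u..v})" by (rule compact_continuous_image[OF g]) simp
  then obtain B where B: "\<And>t. t \<in> {u..v} \<Longrightarrow> norm (g t) \<le> B"
    using compact_imp_bounded[THEN bounded_iff[THEN iffD1]] by (metis imageI)
  have "(\<lambda>l. integral {u..v} (f l)) sums integral {u..v} (\<lambda>t. \<Sum>l. f l t)"
  proof (rule sums_integral_suminf)
    show "continuous_on {u..v} (f l)" for l unfolding f_def by (intro continuous_intros g)
    show "summable (\<lambda>l. norm (of_nat (Suc l) ^ m * qexp z ^ Suc l) * B)"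
      by (intro summable_mult2 summable_power_mult_geometric qz)
    show "norm (f l t) \<le> norm (of_nat (Suc l) ^ m * qexp z ^ Suc l) * B" if "t \<in> {u..v}" for l t
      unfolding f_def norm_mult[of _ "g t * _"] using B[OF that]
      by (intro mult_left_mono) (auto simp: norm_mult norm_qexp)
  qed
  moreover have "(\<Sum>l. f l t) = g t * power_geometric m (qexp (z - of_real t))" for t
    unfolding eq[symmetric] using sums_unique[OF sums_mult[OF power_geometric_sums[OF q]]] by metis
  moreover have "integral {u..v} (f l) = of_nat (Suc l) ^ m * qexp z ^ Suc l * integral {u..v} (\<lambda>t. g t * qexp (- (of_nat (Suc l) * of_real t)))" for l
    unfolding f_def by (rule integral_mult_right)
  ultimately show ?thesis by simp
qed

section \<open>Positive Fourier coefficients and the local regularity of a sine series\<close>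

lemma sine_eq_qexp: "of_real (sin (2 * pi * u)) = (qexp (of_real u) - qexp (- of_real u)) / (2 * \<i>)"
  unfolding qexp_def sin_of_real[symmetric] sin_exp_eq by (simp add: mult_ac)

text \<open>Against the frequency l + 1, the negative half of the n-th sine leaves the frequency -n
  - l - 2, which is never 0; the positive half survives only for n = l.\<close>

lemma sine_series_fourier_coeff:
  assumes a: "summable (\<lambda>n. norm (a n))"
  defines "f \<equiv> \<lambda>t. \<Sum>n. a n * of_real (sin (2 * pi * real (Suc n) * t))"
  shows "continuous_on {u..v} f"
    and "integral {u..u + 1} (\<lambda>t. f t * qexp (- (of_nat (Suc l) * of_real t))) = a l / (2 * \<i>)"
proof -
  have bd: "norm (a n * of_real (sin (2 * pi * real (Suc n) * t))) \<le> norm (a n)" for n t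
  proof -
    have "norm (a n) * \<bar>sin (2 * pi * real (Suc n) * t)\<bar> \<le> norm (a n) * 1"
      by (intro mult_left_mono abs_sin_le_one) auto
    then show ?thesis by (simp add: norm_mult)
  qed
  show "continuous_on {u..v} f"
    unfolding f_def by (rule continuous_on_suminf[OF _ bd a]) (intro continuous_intros)
  define h where "h = (\<lambda>n t. a n * of_real (sin (2 * pi * real (Suc n) * t)) * qexp (- (of_nat (Suc l) * of_real t)))"
  have "summable (\<lambda>n. a n * of_real (sin (2 * pi * real (Suc n) * t)))" for t
    by (rule summable_norm_cancel, rule summable_comparison_test'[OF a, of 0]) (use bd in simp)
  then have fh: "(\<Sum>n. h n t) = f t * qexp (- (of_nat (Suc l) * of_real t))" for t
    unfolding h_def f_def by (rule suminf_mult2[symmetric])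
  have "(\<lambda>n. integral {u..u + 1} (h n)) sums integral {u..u + 1} (\<lambda>t. \<Sum>n. h n t)"
  proof (rule sums_integral_suminf[OF _ _ a])
    show "continuous_on {u..u + 1} (h n)" for n unfolding h_def by (intro continuous_intros)
    show "norm (h n t) \<le> norm (a n)" for n t
      unfolding h_def norm_mult[of _ "qexp _"] using bd[of n t] by (simp add: norm_qexp)
  qed
  moreover have "integral {u..u + 1} (h n) = (if n = l then a l / (2 * \<i>) else 0)" for n
  proof -
    have "h n t = a n / (2 * \<i>) * (qexp (of_int (int n - int l) * of_real t) - qexp (of_int (- int n - int l - 2) * of_real t))" for t
    proof -
      have "of_real (sin (2 * pi * real (Suc n) * t)) =
        (qexp (of_nat (Suc n) * of_real t) - qexp (- (of_nat (Suc n) * of_real t))) / (2 * \<i>)"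
        using sine_eq_qexp[of "real (Suc n) * t"] by (simp only: mult.assoc of_real_mult of_real_of_nat_eq)
      then have "h n t = a n / (2 * \<i>) * (qexp (of_nat (Suc n) * of_real t) * qexp (- (of_nat (Suc l) * of_real t))
          - qexp (- (of_nat (Suc n) * of_real t)) * qexp (- (of_nat (Suc l) * of_real t)))"
        unfolding h_def by (simp only: left_diff_distrib divide_inverse mult_ac) (simp only: right_diff_distrib mult_ac)
      also have "\<dots> = a n / (2 * \<i>) * (qexp (of_nat (Suc n) * of_real t + - (of_nat (Suc l) * of_real t))
          - qexp (- (of_nat (Suc n) * of_real t) + - (of_nat (Suc l) * of_real t)))"
        unfolding qexp_add ..
      also have "of_nat (Suc n) * of_real t + - (of_nat (Suc l) * of_real t) = (of_int (int n - int l) * of_real t :: complex)"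
        by (simp add: algebra_simps)
      also have "- (of_nat (Suc n) * of_real t) + - (of_nat (Suc l) * of_real t) = (of_int (- int n - int l - 2) * of_real t :: complex)"
        by (simp add: algebra_simps)
      finally show ?thesis .
    qed
    then have "h n = (\<lambda>t. a n / (2 * \<i>) * (qexp (of_int (int n - int l) * of_real t) - qexp (of_int (- int n - int l - 2) * of_real t)))"
      by (rule ext)
    then have "integral {u..u + 1} (h n) = a n / (2 * \<i>) *
       (integral {u..u + 1} (\<lambda>t. qexp (of_int (int n - int l) * of_real t)) - integral {u..u + 1} (\<lambda>t. qexp (of_int (- int n - int l - 2) * of_real t)))"
      by (simp only: integral_mult_right) (subst integral_diff, auto intro!: integrable_continuous_real continuous_intros)
    also have "\<dots> = (if n = l then a l / (2 * \<i>) else 0)"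
      unfolding integral_qexp by auto
    finally show ?thesis .
  qed
  ultimately have "(\<lambda>n. if n = l then a l / (2 * \<i>) else 0) sums integral {u..u + 1} (\<lambda>t. f t * qexp (- (of_nat (Suc l) * of_real t)))"
    unfolding fh by simp
  then show "integral {u..u + 1} (\<lambda>t. f t * qexp (- (of_nat (Suc l) * of_real t))) = a l / (2 * \<i>)"
    using sums_single[of l "\<lambda>_. a l / (2 * \<i>)"] sums_unique2 by blast
qed

text \<open>Every frequency of the product is at most -(l + 1), hence nonzero.\<close>

lemma trig_poly_fourier_coeff:
  "integral {u..u + 1} (\<lambda>t. poly Q (qexp (- of_real (t - x))) * qexp (- (of_nat (Suc l) * of_real t))) = 0"
proof -
  define c where "c = (\<lambda>i. coeff Q i * qexp (of_nat i * of_real x))"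
  have "poly Q (qexp (- of_real (t - x))) * qexp (- (of_nat (Suc l) * of_real t)) =
     (\<Sum>i\<le>degree Q. c i * qexp (of_int (- int i - int (Suc l)) * of_real t))" for t
    unfolding poly_altdef sum_distrib_right
  proof (rule sum.cong[OF refl])
    fix i
    have "qexp (- of_real (t - x)) ^ i * qexp (- (of_nat (Suc l) * of_real t)) =
        qexp (of_nat i * of_real x) * qexp (of_int (- int i - int (Suc l)) * of_real t)"
      unfolding qexp_of_nat_mult[symmetric] qexp_add[symmetric]
      by (rule arg_cong[of _ _ qexp]) (simp add: algebra_simps)
    then show "coeff Q i * qexp (- of_real (t - x)) ^ i * qexp (- (of_nat (Suc l) * of_real t)) =
        c i * qexp (of_int (- int i - int (Suc l)) * of_real t)"
      by (simp only: c_def mult.assoc)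
  qed
  then have "integral {u..u + 1} (\<lambda>t. poly Q (qexp (- of_real (t - x))) * qexp (- (of_nat (Suc l) * of_real t))) =
      (\<Sum>i\<le>degree Q. integral {u..u + 1} (\<lambda>t. c i * qexp (of_int (- int i - int (Suc l)) * of_real t)))"
    by (simp only:) (intro integral_sum integrable_continuous_real continuous_intros, auto)
  also have "\<dots> = 0"
    unfolding integral_mult_right integral_qexp by (intro sum.neutral) auto
  finally show ?thesis .
qed

lemma integral_shifted_powr_le:
  fixes a b u v \<gamma> :: real
  assumes a: "a > 0" and \<gamma>: "\<gamma> > 0" and b: "u \<le> b" "b \<le> v"
  shows "(\<lambda>t. (a + \<bar>t - b\<bar>) powr (- \<gamma> - 1)) integrable_on {u..v}"
    and "integral {u..v} (\<lambda>t. (a + \<bar>t - b\<bar>) powr (- \<gamma> - 1)) \<le> 2 * a powr (- \<gamma>) / \<gamma>"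
proof -
  let ?f = "\<lambda>t. (a + \<bar>t - b\<bar>) powr (- \<gamma> - 1)"
  show I: "?f integrable_on {u..v}"
    using a by (intro integrable_continuous_real continuous_intros) (auto simp: add_pos_nonneg)
  have 1: "(?f has_integral ((a + (b - b)) powr (- \<gamma>) / \<gamma> - (a + (b - u)) powr (- \<gamma>) / \<gamma>)) {u..b}"
  proof (rule fundamental_theorem_of_calculus[OF b(1)])
    fix t assume t: "t \<in> {u..b}"
    then have "((\<lambda>t. (a + (b - t)) powr (- \<gamma>) / \<gamma>) has_field_derivative (a + (b - t)) powr (- \<gamma> - 1)) (at t within {u..b})"
      using a \<gamma> by (auto intro!: derivative_eq_intros simp: field_simps)
    moreover have "\<bar>t - b\<bar> = b - t" using t by auto
    ultimately show "((\<lambda>t. (a + (b - t)) powr (- \<gamma>) / \<gamma>) has_vector_derivative ?f t) (at t within {u..b})"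
      by (simp add: has_real_derivative_iff_has_vector_derivative)
  qed
  have 2: "(?f has_integral (- ((a + (v - b)) powr (- \<gamma>) / \<gamma>) - - ((a + (b - b)) powr (- \<gamma>) / \<gamma>))) {b..v}"
  proof (rule fundamental_theorem_of_calculus[OF b(2)])
    fix t assume t: "t \<in> {b..v}"
    then have "((\<lambda>t. - ((a + (t - b)) powr (- \<gamma>) / \<gamma>)) has_field_derivative (a + (t - b)) powr (- \<gamma> - 1)) (at t within {b..v})"
      using a \<gamma> by (auto intro!: derivative_eq_intros simp: field_simps)
    moreover have "\<bar>t - b\<bar> = t - b" using t by auto
    ultimately show "((\<lambda>t. - ((a + (t - b)) powr (- \<gamma>) / \<gamma>)) has_vector_derivative ?f t) (at t within {b..v})"
      by (simp add: has_real_derivative_iff_has_vector_derivative)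
  qed
  have "0 \<le> (a + (b - u)) powr (- \<gamma>) / \<gamma>" "0 \<le> (a + (v - b)) powr (- \<gamma>) / \<gamma>" using \<gamma> by auto
  then show "integral {u..v} ?f \<le> 2 * a powr (- \<gamma>) / \<gamma>"
    using integral_unique[OF has_integral_combine[OF b 1 2]] by simp
qed

lemma continuous_power_geometric_qexp:
  assumes "Im z > 0"
  shows "continuous_on {u..v} (\<lambda>t. power_geometric m (qexp (z - of_real t)))"
proof -
  have n: "norm (qexp (z - of_real t)) = norm (qexp z)" for t by (simp add: norm_qexp)
  show ?thesis unfolding power_geometric_def
  proof (rule continuous_on_suminf)
    show "summable (\<lambda>l. norm (of_nat (Suc l) ^ m * qexp z ^ Suc l))"
      by (rule summable_power_mult_geometric) (use assms in \<open>simp add: norm_qexp\<close>)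
  qed (auto intro!: continuous_intros simp: norm_mult norm_power n simp del: of_nat_Suc power_Suc)
qed

text \<open>Subtracting the trigonometric polynomial \<open>Q\<close> leaves the positive
  coefficients unchanged and makes the function O(|t - x0|^\<beta>) on a whole period. With V = Im z
  + |t - Re z|, the cone condition gives |t - x0| \<le> E V, and the kernel is O(V^(-m-1)). The
  product V^(\<beta>-m-1) integrates to a multiple of (Im z)^(\<beta>-m) because m >
  \<beta>.\<close>

lemma sine_series_kernel_bound:
  fixes a :: "nat \<Rightarrow> complex" and x0 \<beta> E :: real
  assumes a: "summable (\<lambda>n. norm (a n))" and \<beta>: "0 < \<beta>" "\<beta> < real m" and E: "E \<ge> 1"
  defines "f \<equiv> \<lambda>t. \<Sum>n. a n * of_real (sin (2 * pi * real (Suc n) * t))"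
  assumes holder: "\<forall>\<^sub>F t in at x0. norm (f t - poly P (of_real (t - x0))) \<le> C0 * \<bar>t - x0\<bar> powr \<beta>"
  shows "\<exists>C\<ge>0. \<forall>z. 0 < Im z \<and> Im z \<le> 1 \<and> \<bar>Re z - x0\<bar> \<le> 1 / 4 \<and> \<bar>Re z - x0\<bar> \<le> E * Im z \<longrightarrow>
     norm (\<Sum>l. a l * of_nat (Suc l) ^ m * qexp z ^ Suc l) \<le> C * Im z powr (\<beta> - real m)"
proof -
  \<comment> \<open>The period is centred at x0, so that |t - x0| \<le> 1/2 holds throughout and the
    trigonometric approximation is valid on all of it.\<close>
  define u where "u = x0 - 1 / 2"
  define D where "D = nat \<lceil>\<beta>\<rceil>"
  have D: "\<beta> \<le> real (Suc D)" using \<beta> unfolding D_def by linarith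
  obtain Q C1 where Q: "\<And>y::real. \<bar>y\<bar> \<le> 1 / 2 \<Longrightarrow>
      norm (poly P (of_real y) - poly Q (qexp (- of_real y))) \<le> C1 * \<bar>y\<bar> ^ Suc D"
    using polynomial_trig_approx[of P D] by blast
  define g where "g = (\<lambda>t. f t - poly Q (qexp (- of_real (t - x0))))"
  have fcont: "continuous_on {v..w} f" for v w
    unfolding f_def by (rule sine_series_fourier_coeff(1)[OF a])
  have gcont: "continuous_on {v..w} g" for v w
    unfolding g_def by (intro continuous_intros fcont)
  obtain \<delta> where \<delta>: "\<delta> > 0" and near: "\<And>t. t \<noteq> x0 \<Longrightarrow> dist t x0 < \<delta> \<Longrightarrow>
      norm (f t - poly P (of_real (t - x0))) \<le> C0 * \<bar>t - x0\<bar> powr \<beta>"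
    using holder unfolding eventually_at by auto
  have Qb: "norm (poly P (of_real (t - x0)) - poly Q (qexp (- of_real (t - x0)))) \<le> \<bar>C1\<bar> * \<bar>t - x0\<bar> powr \<beta>"
    if t: "\<bar>t - x0\<bar> \<le> 1 / 2" "t \<noteq> x0" for t
  proof -
    have "norm (poly P (of_real (t - x0)) - poly Q (qexp (- of_real (t - x0)))) \<le> C1 * \<bar>t - x0\<bar> ^ Suc D"
      by (rule Q[OF t(1)])
    also have "\<dots> \<le> \<bar>C1\<bar> * \<bar>t - x0\<bar> ^ Suc D" by (intro mult_right_mono) auto
    also have "\<bar>t - x0\<bar> ^ Suc D = \<bar>t - x0\<bar> powr real (Suc D)" using t by (subst powr_realpow) auto
    also have "\<dots> \<le> \<bar>t - x0\<bar> powr \<beta>" using t D by (intro powr_mono') auto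
    finally show ?thesis by (simp add: mult_left_mono)
  qed
  have "compact (g ` {u..u + 1})" by (rule compact_continuous_image[OF gcont]) simp
  then obtain B where B: "\<And>t. t \<in> {u..u + 1} \<Longrightarrow> norm (g t) \<le> B"
    using compact_imp_bounded[THEN bounded_iff[THEN iffD1]] by (metis imageI)
  \<comment> \<open>The first entry is for t within \<delta> of x0, where the regularity is assumed;
    the second turns mere boundedness elsewhere into a multiple of |t - x0|^\<beta>.\<close>
  define C2 where "C2 = max (\<bar>C0\<bar> + \<bar>C1\<bar>) (\<bar>B\<bar> * \<delta> powr (- \<beta>))"
  have C2: "C2 \<ge> 0" by (simp add: C2_def)
  have gb': "norm (g t) \<le> C2 * \<bar>t - x0\<bar> powr \<beta>" if t: "t \<in> {u..u + 1}" "t \<noteq> x0" for t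
  proof (cases "dist t x0 < \<delta>")
    case True
    have t2: "\<bar>t - x0\<bar> \<le> 1 / 2" using t unfolding u_def atLeastAtMost_iff by linarith
    have "norm (g t) \<le> norm (f t - poly P (of_real (t - x0))) + norm (poly P (of_real (t - x0)) - poly Q (qexp (- of_real (t - x0))))"
      unfolding g_def by (rule order_trans[OF _ norm_triangle_ineq]) simp
    also have "\<dots> \<le> C0 * \<bar>t - x0\<bar> powr \<beta> + \<bar>C1\<bar> * \<bar>t - x0\<bar> powr \<beta>"
      by (intro add_mono near Qb t t2 True)
    also have "\<dots> \<le> (\<bar>C0\<bar> + \<bar>C1\<bar>) * \<bar>t - x0\<bar> powr \<beta>"
      by (simp add: distrib_right mult_right_mono)
    also have "\<dots> \<le> C2 * \<bar>t - x0\<bar> powr \<beta>" by (intro mult_right_mono) (auto simp: C2_def)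
    finally show ?thesis .
  next
    case False
    then have le: "\<delta> \<le> \<bar>t - x0\<bar>" by (simp add: dist_real_def)
    have "norm (g t) \<le> \<bar>B\<bar> * (\<delta> powr (- \<beta>) * \<delta> powr \<beta>)"
      using B[OF t(1)] \<delta> by (simp flip: powr_add)
    also have "\<dots> \<le> \<bar>B\<bar> * (\<delta> powr (- \<beta>) * \<bar>t - x0\<bar> powr \<beta>)"
      using \<delta> \<beta> le by (intro mult_left_mono powr_mono2) auto
    also have "\<dots> \<le> C2 * \<bar>t - x0\<bar> powr \<beta>"
      unfolding mult.assoc[symmetric] by (intro mult_right_mono) (auto simp: C2_def)
    finally show ?thesis .
  qed
  \<comment> \<open>The regularity assumption concerns a punctured neighbourhood; continuity
    supplies the value at x0 itself.\<close>
  have "g x0 = 0"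
  proof -
    have "isCont g x0"
      using gcont[of "x0 - 1" "x0 + 1"] by (rule continuous_on_interior) simp
    then have 1: "((\<lambda>t. norm (g t)) \<longlongrightarrow> norm (g x0)) (at x0)"
      by (intro tendsto_norm) (simp add: isCont_def)
    have "((\<lambda>t. \<bar>t - x0\<bar>) \<longlongrightarrow> 0) (at x0)"
      by (rule tendsto_eq_intros refl | simp)+
    then have "((\<lambda>t. \<bar>t - x0\<bar> powr \<beta>) \<longlongrightarrow> 0) (at x0)"
      using \<beta> by (intro tendsto_zero_powrI[OF _ tendsto_const]) auto
    then have 2: "((\<lambda>t. C2 * \<bar>t - x0\<bar> powr \<beta>) \<longlongrightarrow> C2 * 0) (at x0)"
      by (intro tendsto_mult_left)
    have "\<forall>\<^sub>F t in at x0. norm (g t) \<le> C2 * \<bar>t - x0\<bar> powr \<beta>"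
      unfolding eventually_at
    proof (intro exI[of _ "1 / 2"] conjI ballI impI)
      fix t assume t: "t \<noteq> x0 \<and> dist t x0 < 1 / 2"
      then have "t \<in> {u..u + 1}" unfolding u_def dist_real_def atLeastAtMost_iff by linarith
      with t show "norm (g t) \<le> C2 * \<bar>t - x0\<bar> powr \<beta>" by (intro gb') auto
    qed simp
    from tendsto_le[OF _ 2 1 this] show ?thesis by simp
  qed
  then have gb: "norm (g t) \<le> C2 * \<bar>t - x0\<bar> powr \<beta>" if "t \<in> {u..u + 1}" for t
    using gb'[OF that] by (cases "t = x0") auto
  obtain C3 where C3: "C3 \<ge> 0" and ker: "\<And>w. 0 < Im w \<Longrightarrow> Im w \<le> 1 \<Longrightarrow> \<bar>Re w\<bar> \<le> 3 / 4 \<Longrightarrow>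
     norm (power_geometric m (qexp w)) \<le> C3 / norm w ^ Suc m"
    using qexp_kernel_bound[of m] by blast
  define \<gamma> where "\<gamma> = real m - \<beta>"
  have \<gamma>: "\<gamma> > 0" using \<beta> by (simp add: \<gamma>_def)
  define C4 where "C4 = C2 * E powr \<beta> * C3 * 2 ^ Suc m"
  have C4: "C4 \<ge> 0" using C2 C3 by (simp add: C4_def)
  define C where "C = 2 * (C4 * 2 / \<gamma>)"
  have "norm (\<Sum>l. a l * of_nat (Suc l) ^ m * qexp z ^ Suc l) \<le> C * Im z powr (\<beta> - real m)"
    if z: "0 < Im z" "Im z \<le> 1" "\<bar>Re z - x0\<bar> \<le> 1 / 4" "\<bar>Re z - x0\<bar> \<le> E * Im z" for z
  proof -
    have ub: "u \<le> Re z" "Re z \<le> u + 1" using z(3) unfolding u_def by linarith+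
    define K where "K = (\<lambda>t. power_geometric m (qexp (z - of_real t)))"
    have Kcont: "continuous_on {v..w} K" for v w
      unfolding K_def by (rule continuous_power_geometric_qexp[OF z(1)])
    have coeff: "integral {u..u + 1} (\<lambda>t. g t * qexp (- (of_nat (Suc l) * of_real t))) = a l / (2 * \<i>)" for l
    proof -
      have "integral {u..u + 1} (\<lambda>t. g t * qexp (- (of_nat (Suc l) * of_real t))) =
         integral {u..u + 1} (\<lambda>t. f t * qexp (- (of_nat (Suc l) * of_real t))) -
         integral {u..u + 1} (\<lambda>t. poly Q (qexp (- of_real (t - x0))) * qexp (- (of_nat (Suc l) * of_real t)))"
        unfolding g_def left_diff_distrib
        by (intro integral_diff integrable_continuous_real continuous_intros fcont)
      then show ?thesis
        using sine_series_fourier_coeff(2)[OF a] unfolding trig_poly_fourier_coeff f_def by simp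
    qed
    have "(\<lambda>l. of_nat (Suc l) ^ m * qexp z ^ Suc l * (a l / (2 * \<i>))) sums integral {u..u + 1} (\<lambda>t. g t * K t)"
      using periodic_kernel_sums[OF gcont z(1), of m u "u + 1"] unfolding coeff K_def .
    from sums_mult[OF this, of "2 * \<i>"]
    have "(\<lambda>l. a l * of_nat (Suc l) ^ m * qexp z ^ Suc l) sums (2 * \<i> * integral {u..u + 1} (\<lambda>t. g t * K t))"
      by (simp add: mult_ac)
    then have "norm (\<Sum>l. a l * of_nat (Suc l) ^ m * qexp z ^ Suc l) = 2 * norm (integral {u..u + 1} (\<lambda>t. g t * K t))"
      by (simp add: sums_unique[symmetric] norm_mult)
    also have "norm (integral {u..u + 1} (\<lambda>t. g t * K t)) \<le>
        integral {u..u + 1} (\<lambda>t. C4 * (Im z + \<bar>t - Re z\<bar>) powr (- \<gamma> - 1))"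
    proof (rule integral_norm_bound_integral)
      show "(\<lambda>t. g t * K t) integrable_on {u..u + 1}"
        by (intro integrable_continuous_real continuous_intros gcont Kcont)
      show "(\<lambda>t. C4 * (Im z + \<bar>t - Re z\<bar>) powr (- \<gamma> - 1)) integrable_on {u..u + 1}"
        by (intro integrable_on_mult_right integral_shifted_powr_le(1) \<gamma> z ub)
      fix t assume t: "t \<in> {u..u + 1}"
      define V where "V = Im z + \<bar>t - Re z\<bar>"
      define w where "w = z - of_real t"
      have V: "V > 0" using z by (simp add: V_def)
      have "V / 2 \<le> norm w"
        using abs_Im_le_cmod[of w] abs_Re_le_cmod[of w] z by (auto simp: V_def w_def abs_minus_commute)
      moreover have "\<bar>Re w\<bar> \<le> 3 / 4"
        using t z unfolding w_def u_def atLeastAtMost_iff minus_complex.sel Re_complex_of_real by linarith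
      then have "norm (K t) \<le> C3 / norm w ^ Suc m"
        unfolding K_def w_def[symmetric] using z by (intro ker) (auto simp: w_def)
      ultimately have "norm (K t) \<le> C3 / (V / 2) ^ Suc m"
        using V C3 by (elim order_trans) (intro divide_left_mono power_mono mult_pos_pos zero_less_power, auto)
      also have "\<dots> = C3 * 2 ^ Suc m * V powr (- real (Suc m))"
        using V by (simp only: powr_minus powr_realpow) (simp add: power_divide field_simps)
      finally have Kb: "norm (K t) \<le> C3 * 2 ^ Suc m * V powr (- real (Suc m))" .
      have "\<bar>t - x0\<bar> \<le> \<bar>t - Re z\<bar> + \<bar>Re z - x0\<bar>" by simp
      also have "\<dots> \<le> E * \<bar>t - Re z\<bar> + E * Im z"
        using z E mult_right_mono[of 1 E "\<bar>t - Re z\<bar>"] by auto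
      finally have "\<bar>t - x0\<bar> \<le> E * V" by (simp add: V_def algebra_simps)
      then have "\<bar>t - x0\<bar> powr \<beta> \<le> (E * V) powr \<beta>" using \<beta> by (intro powr_mono2) auto
      then have "norm (g t) \<le> C2 * (E * V) powr \<beta>"
        using gb[OF t] C2 by (elim order_trans) (rule mult_left_mono)
      then have "norm (g t * K t) \<le> (C2 * (E * V) powr \<beta>) * (C3 * 2 ^ Suc m * V powr (- real (Suc m)))"
        unfolding norm_mult using Kb C2 by (intro mult_mono) auto
      also have "\<dots> = C4 * (V powr \<beta> * V powr (- real (Suc m)))"
        using E V by (simp add: C4_def powr_mult mult_ac)
      also have "V powr \<beta> * V powr (- real (Suc m)) = V powr (- \<gamma> - 1)"
        by (simp add: \<gamma>_def algebra_simps flip: powr_add)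
      finally show "norm (g t * K t) \<le> C4 * (Im z + \<bar>t - Re z\<bar>) powr (- \<gamma> - 1)" by (simp add: V_def)
    qed
    also have "\<dots> = C4 * integral {u..u + 1} (\<lambda>t. (Im z + \<bar>t - Re z\<bar>) powr (- \<gamma> - 1))"
      by simp
    also have "\<dots> \<le> C4 * (2 * Im z powr (- \<gamma>) / \<gamma>)"
      by (intro mult_left_mono integral_shifted_powr_le(2) \<gamma> C4 z ub)
    finally show ?thesis by (simp add: C_def \<gamma>_def mult_ac)
  qed
  moreover have "C \<ge> 0" using C4 \<gamma> by (simp add: C_def)
  ultimately show ?thesis by blast
qed

section \<open>Growth above a point and Hoelder regularity\<close>

lemma exp_decay_le_powr:
  fixes p :: real
  assumes "p \<ge> 0"
  shows "\<exists>C\<ge>0. \<forall>y>0. exp (- 2 * pi * y) \<le> C * y powr (- p)"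
proof -
  define n where "n = Suc (nat \<lceil>p\<rceil>)"
  have n: "p \<le> real n" "n > 0" using assms unfolding n_def by linarith+
  have "exp (- 2 * pi * y) \<le> real n ^ n * y powr (- p)" if y: "y > 0" for y :: real
  proof (cases "y \<le> 1")
    case True
    have "exp (- 2 * pi * y) \<le> 1" using y by simp
    also have "\<dots> \<le> real n ^ n" using n by (intro one_le_power) auto
    also have "\<dots> = real n ^ n * y powr 0" using y by simp
    also have "\<dots> \<le> real n ^ n * y powr (- p)"
      using True y assms by (intro mult_left_mono powr_mono') auto
    finally show ?thesis .
  next
    case False
    have "y powr p \<le> y powr real n" using False n by (intro powr_mono) auto
    also have "\<dots> = real n ^ n * (y / real n) ^ n" using y n by (simp add: powr_realpow power_divide)
    also have "\<dots> \<le> real n ^ n * (1 + y / real n) ^ n"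
      using y by (intro mult_left_mono power_mono) auto
    also have "\<dots> \<le> real n ^ n * exp y"
      using y n by (intro mult_left_mono exp_ge_one_plus_x_over_n_power_n) auto
    also have "\<dots> \<le> real n ^ n * exp (2 * pi * y)"
      using y pi_gt3 mult_right_mono[of 1 "2 * pi" y] by (intro mult_left_mono) auto
    finally have "y powr p * exp (- (2 * pi * y)) \<le> real n ^ n"
      by (simp add: exp_minus field_simps)
    then show ?thesis using y by (simp add: powr_minus field_simps)
  qed
  then show ?thesis by (intro exI[of _ "real n ^ n"]) auto
qed

text \<open>The kernel bound concerns the series \<open>G\<close> with coefficients r_l l^(m-s).
  Integrating t^(m-s-1) \<open>G\<close> (z + i t) over t > 0 multiplies the l-th coefficient by a
  constant times l^(s-m) and so returns M - r_0. The bound (Im z + t)^(\<beta>-m) integrates to a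
  multiple of (Im z)^(\<beta>-s), the tail beyond t = Im z being finite because \<beta> < s.\<close>

lemma modular_form_bound_of_holder:
  fixes r :: "nat \<Rightarrow> complex" and s x0 \<beta> E :: real
  assumes r: "has_fourier_expansion M r"
    and S: "summable (\<lambda>n. norm (r (Suc n)) * real (Suc n) powr (- s))"
    and \<beta>: "0 < \<beta>" "\<beta> < s" and E: "E \<ge> 1"
    and holder: "\<forall>\<^sub>F t in at x0. norm (sine_series r s t - poly P (of_real (t - x0))) \<le> C0 * \<bar>t - x0\<bar> powr \<beta>"
  shows "\<exists>C\<ge>0. \<forall>z. 0 < Im z \<and> Im z \<le> 1 \<and> \<bar>Re z - x0\<bar> \<le> 1 / 4 \<and> \<bar>Re z - x0\<bar> \<le> E * Im z \<longrightarrow>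
     norm (M z - r 0) \<le> C * Im z powr (\<beta> - s)"
proof -
  \<comment> \<open>An integer above s: integrality keeps the kernel a polylogarithm of negative
    order, and m > s makes the order of the fractional integral positive.\<close>
  define m where "m = Suc (nat \<lfloor>s\<rfloor>)"
  have m: "s < real m" using \<beta> unfolding m_def by linarith
  define a where "a = (\<lambda>n. r (Suc n) / of_real (real (Suc n) powr s))"
  have na: "norm (a n) = norm (r (Suc n)) * real (Suc n) powr (- s)" for n
    by (simp add: a_def norm_divide powr_minus_divide)
  have a: "summable (\<lambda>n. norm (a n))" unfolding na by (rule S)
  define G where "G = (\<lambda>z. \<Sum>l. a l * of_nat (Suc l) ^ m * qexp z ^ Suc l)"
  have f: "sine_series r s t = (\<Sum>n. a n * of_real (sin (2 * pi * real (Suc n) * t)))" for t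
    by (simp add: sine_series_def a_def)
  obtain C1 where C1: "C1 \<ge> 0" and G1: "\<And>z. 0 < Im z \<Longrightarrow> Im z \<le> 1 \<Longrightarrow> \<bar>Re z - x0\<bar> \<le> 1 / 4 \<Longrightarrow>
      \<bar>Re z - x0\<bar> \<le> E * Im z \<Longrightarrow> norm (G z) \<le> C1 * Im z powr (\<beta> - real m)"
    using sine_series_kernel_bound[OF a \<beta>(1) _ E holder[unfolded f], of m] \<beta> m unfolding G_def by auto
  define r' where "r' = (\<lambda>n. if n = 0 then 0 else a (n - 1) * of_nat n ^ m)"
  obtain A where A: "\<And>n. norm (a n) \<le> A"
    using summable_imp_Bseq[OF a] by (auto simp: Bseq_def)
  \<comment> \<open>The kernel bound stops at height 1, while the vertical ray does not. Higher up,
    \<open>G\<close> decays exponentially, as its constant term vanishes.\<close>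
  have "has_fourier_expansion G r'"
    unfolding has_fourier_expansion_def
  proof (intro allI impI)
    fix z :: complex assume z: "Im z > 0"
    have "summable (\<lambda>l. A * norm (of_nat (Suc l) ^ m * qexp z ^ Suc l))"
      by (intro summable_mult summable_power_mult_geometric) (use z in \<open>simp add: norm_qexp\<close>)
    then have "summable (\<lambda>l. a l * of_nat (Suc l) ^ m * qexp z ^ Suc l)"
      by (rule summable_comparison_test'[of _ 0])
        (simp only: mult.assoc norm_mult[of "a _"], intro mult_right_mono A, auto)
    then have "(\<lambda>l. r' (Suc l) * qexp (of_nat (Suc l) * z)) sums G z"
      unfolding G_def r'_def qexp_of_nat_mult by (simp add: summable_sums)
    then have "(\<lambda>l. r' l * qexp (of_nat l * z)) sums (G z + r' 0 * qexp (of_nat 0 * z))"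
      by (subst sums_Suc_iff[symmetric]) simp
    then show "(\<lambda>n. r' n * exp (2 * of_real pi * \<i> * of_nat n * z)) sums G z"
      by (simp add: r'_def qexp_def mult.assoc)
  qed
  from modular_form_decay[OF this, of 1]
  obtain K where K: "K \<ge> 0" "\<And>z. Im z \<ge> 1 \<Longrightarrow> norm (G z) \<le> K * exp (- 2 * pi * Im z)"
    by (auto simp: r'_def)
  obtain L where L: "L \<ge> 0" "\<And>y. y > 0 \<Longrightarrow> exp (- 2 * pi * y) \<le> L * y powr (- (real m - \<beta>))"
    using exp_decay_le_powr[of "real m - \<beta>"] m \<beta> by auto
  define C2 where "C2 = max C1 (K * L)"
  have C2: "C2 \<ge> 0" using C1 by (simp add: C2_def)
  have GB: "norm (G z) \<le> C2 * Im z powr (\<beta> - real m)"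
    if "0 < Im z" "\<bar>Re z - x0\<bar> \<le> 1 / 4" "\<bar>Re z - x0\<bar> \<le> E * Im z" for z
  proof (cases "Im z \<le> 1")
    case True
    then have "norm (G z) \<le> C1 * Im z powr (\<beta> - real m)" using that by (intro G1)
    also have "\<dots> \<le> C2 * Im z powr (\<beta> - real m)" by (intro mult_right_mono) (auto simp: C2_def)
    finally show ?thesis .
  next
    case False
    then have "norm (G z) \<le> K * exp (- 2 * pi * Im z)" by (intro K) auto
    also have "\<dots> \<le> K * (L * Im z powr (- (real m - \<beta>)))" using that by (intro mult_left_mono L K)
    also have "\<dots> \<le> C2 * Im z powr (\<beta> - real m)"
      unfolding mult.assoc[symmetric] minus_diff_eq by (intro mult_right_mono) (auto simp: C2_def)
    finally show ?thesis .
  qed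
  define \<sigma> where "\<sigma> = real m - s"
  have \<sigma>: "\<sigma> > 0" using m by (simp add: \<sigma>_def)
  define c where "c = Gamma \<sigma> * (2 * pi) powr (- \<sigma>)"
  have c: "c > 0" unfolding c_def using \<sigma> by (intro mult_pos_pos Gamma_real_pos) auto
  define C where "C = C2 * (1 / \<sigma> + 1 / (s - \<beta>)) / c"
  have "norm (M z - r 0) \<le> C * Im z powr (\<beta> - s)"
    if z: "0 < Im z" "Im z \<le> 1" "\<bar>Re z - x0\<bar> \<le> 1 / 4" "\<bar>Re z - x0\<bar> \<le> E * Im z" for z
  proof -
    define y where "y = Im z"
    have y: "y > 0" using z by (simp add: y_def)
    define b where "b = (\<lambda>n. of_real (real (Suc n) powr \<sigma>) * (r (Suc n) * qexp z ^ Suc n))"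
    have bsum: "real (Suc n) powr (- \<sigma>) *\<^sub>R b n = r (Suc n) * qexp (of_nat (Suc n) * z)" for n
    proof -
      have "real (Suc n) powr (- \<sigma>) *\<^sub>R b n = of_real (real (Suc n) powr (- \<sigma>) * real (Suc n) powr \<sigma>) * (r (Suc n) * qexp z ^ Suc n)"
        unfolding b_def scaleR_conv_of_real of_real_mult by (simp only: mult.assoc)
      also have "real (Suc n) powr (- \<sigma>) * real (Suc n) powr \<sigma> = 1" by (simp flip: powr_add)
      finally show ?thesis unfolding qexp_of_nat_mult by simp
    qed
    have bs: "summable (\<lambda>n. norm (b n) * real (Suc n) powr (- \<sigma>))"
    proof -
      have "norm (b n) * real (Suc n) powr (- \<sigma>) = norm (r (Suc n)) * exp (- 2 * pi * real (Suc n) * y)" for n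
        using arg_cong[OF bsum[of n], of norm] by (simp add: norm_mult norm_qexp y_def mult_ac)
      moreover have "summable (\<lambda>n. norm (r (Suc n)) * exp (- 2 * pi * real (Suc n) * y))"
        using fourier_coeff_summable[OF r y] by (subst summable_Suc_iff)
      ultimately show ?thesis by simp
    qed
    have "(\<lambda>n. r (Suc n) * qexp (of_nat (Suc n) * z)) sums (M z - r 0)"
      using fourier_expansion_qexp[OF r z(1)] by (subst sums_Suc_iff) simp
    then have Mz: "(\<Sum>n. real (Suc n) powr (- \<sigma>) *\<^sub>R b n) = M z - r 0"
      unfolding bsum by (simp add: sums_unique[symmetric])
    have Gt: "(\<Sum>n. exp (- 2 * pi * real (Suc n) * t) *\<^sub>R b n) = G (z + Complex 0 t)" for t
      unfolding G_def
    proof (rule suminf_cong)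
      fix n
      have "2 * of_real pi * \<i> * Complex 0 t = of_real (- 2 * pi * t)"
        by (simp add: complex_eq_iff)
      then have "qexp (Complex 0 t) = of_real (exp (- 2 * pi * t))"
        by (simp only: qexp_def exp_of_real)
      then have "qexp (z + Complex 0 t) ^ Suc n = qexp z ^ Suc n * of_real (exp (- 2 * pi * t) ^ Suc n)"
        by (simp only: qexp_add power_mult_distrib of_real_power)
      also have "exp (- 2 * pi * t) ^ Suc n = exp (- 2 * pi * real (Suc n) * t)"
        by (simp only: exp_of_nat_mult[symmetric]) (simp only: mult_ac)
      finally have 1: "qexp (z + Complex 0 t) ^ Suc n = qexp z ^ Suc n * of_real (exp (- 2 * pi * real (Suc n) * t))" .
      have "real (Suc n) powr \<sigma> = real (Suc n) ^ m / real (Suc n) powr s"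
        by (subst powr_realpow[symmetric]) (simp_all add: \<sigma>_def powr_diff)
      then have 2: "of_real (real (Suc n) powr \<sigma>) = (of_nat (Suc n) ^ m / of_real (real (Suc n) powr s) :: complex)"
        by (simp only: of_real_divide of_real_power of_real_of_nat_eq)
      show "exp (- 2 * pi * real (Suc n) * t) *\<^sub>R b n = a n * of_nat (Suc n) ^ m * qexp (z + Complex 0 t) ^ Suc n"
        unfolding 1 b_def 2 a_def scaleR_conv_of_real by (simp only: divide_inverse mult_ac)
    qed
    define F where "F = (\<lambda>t. t powr (\<sigma> - 1) *\<^sub>R G (z + Complex 0 t))"
    have Fabs: "F absolutely_integrable_on {0<..}"
      using Mellin_exp_series_integrable[OF \<sigma> bs] unfolding Gt F_def .
    have Fval: "integral {0<..} F = c *\<^sub>R (M z - r 0)"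
      using Mellin_exp_series[OF \<sigma> bs] unfolding Gt F_def Mz c_def .
    have Fb: "norm (F t) \<le> C2 * (y + t) powr (\<beta> - real m) * t powr (\<sigma> - 1)" if t: "t > 0" for t
    proof -
      \<comment> \<open>The cone widens upwards, so the vertical ray above z remains in it.\<close>
      have "E * y \<le> E * (y + t)" using E t by (intro mult_left_mono) auto
      then have "norm (G (z + Complex 0 t)) \<le> C2 * (y + t) powr (\<beta> - real m)"
        using GB[of "z + Complex 0 t"] z t y by (simp add: y_def)
      then show ?thesis unfolding F_def by (simp add: mult_left_mono mult.commute)
    qed
    have "norm (integral {0<..} F) \<le> (C2 * y powr (\<beta> - real m)) * (y powr (\<sigma> - 1 + 1) / (\<sigma> - 1 + 1)) +
        C2 * (y powr (\<beta> - s - 1 + 1) / (- (\<beta> - s - 1) - 1))"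
    proof (rule norm_integral_powr_bounds)
      show "F \<in> borel_measurable (lebesgue_on {0<..})"
        using Fabs by (simp add: absolutely_integrable_measurable)
      show "norm (F t) \<le> C2 * y powr (\<beta> - real m) * t powr (\<sigma> - 1)" if t: "0 < t" for t
        by (rule order_trans[OF Fb[OF t]])
          (use t y m \<beta> C2 in \<open>intro mult_right_mono mult_left_mono powr_mono2', auto\<close>)
      show "norm (F t) \<le> C2 * t powr (\<beta> - s - 1)" if t: "y < t" for t
      proof -
        have "norm (F t) \<le> C2 * t powr (\<beta> - real m) * t powr (\<sigma> - 1)"
          by (rule order_trans[OF Fb])
            (use t y m \<beta> C2 in \<open>auto intro!: mult_right_mono mult_left_mono powr_mono2'\<close>)
        also have "\<dots> = C2 * (t powr (\<beta> - real m) * t powr (\<sigma> - 1))" by simp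
        also have "t powr (\<beta> - real m) * t powr (\<sigma> - 1) = t powr (\<beta> - s - 1)"
          by (simp add: \<sigma>_def algebra_simps flip: powr_add)
        finally show ?thesis .
      qed
    qed (use y \<sigma> \<beta> in auto)
    also have "\<dots> = C2 * ((y powr (\<beta> - real m) * y powr \<sigma>) / \<sigma> + y powr (\<beta> - s) / (s - \<beta>))"
      by (simp add: algebra_simps)
    also have "y powr (\<beta> - real m) * y powr \<sigma> = y powr (\<beta> - s)"
      by (simp add: \<sigma>_def algebra_simps flip: powr_add)
    finally have "c * norm (M z - r 0) \<le> C2 * (y powr (\<beta> - s) / \<sigma> + y powr (\<beta> - s) / (s - \<beta>))"
      unfolding Fval using c by simp
    then have "norm (M z - r 0) \<le> C2 * (y powr (\<beta> - s) / \<sigma> + y powr (\<beta> - s) / (s - \<beta>)) / c"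
      using c by (simp add: pos_le_divide_eq mult.commute)
    also have "\<dots> = C * y powr (\<beta> - s)" by (simp add: C_def algebra_simps add_divide_distrib)
    finally show ?thesis by (simp add: y_def)
  qed
  moreover have "C \<ge> 0" unfolding C_def using C2 \<sigma> \<beta> c by (intro divide_nonneg_pos mult_nonneg_nonneg) auto
  ultimately show ?thesis by blast
qed

section \<open>From Diophantine lower bounds to regularity\<close>

text \<open>Put \<rho> = |c z + d| / y, so that c \<le> \<rho> and |c x + d| \<le> \<rho> (y + |h|).
  As 1 - \<mu> < 0, the Diophantine bound for c yields c0 \<rho>^(1-\<mu>) \<le> \<rho> (y + |h|),
  that is, \<rho>^\<mu> \<ge> c0 / (y + |h|). This is inserted into |M(z)| \<le> B (\<rho>
  y)^(-k).\<close>

lemma growth_from_diophantine: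
  fixes x \<mu> c0 :: real
  assumes M: "modular_form k M" and r: "has_fourier_expansion M r"
    and \<mu>: "\<mu> > 1" and c0: "c0 > 0"
    and dioph: "\<And>q p :: int. 0 < q \<Longrightarrow> \<bar>of_int q * x - of_int p\<bar> \<ge> c0 * of_int q powr (1 - \<mu>)"
  shows "\<exists>C\<ge>0. \<forall>h y. 0 < y \<and> y \<le> 1 \<longrightarrow>
    norm (M (Complex (x + h) y)) \<le> C * y powr (- real k) * (y + \<bar>h\<bar>) powr (real k / \<mu>)"
proof -
  obtain B where B: "B \<ge> 0" and bd: "\<And>z. 0 < Im z \<Longrightarrow> Im z \<le> 1 \<Longrightarrow>
    (\<exists>c d :: int. c \<ge> 1 \<and> norm (of_int c * z + of_int d) ^ 2 \<le> 5 * Im z \<and>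
       norm (M z) \<le> B / norm (of_int c * z + of_int d) ^ k)"
    using modular_form_bound[OF M r] by blast
  define C where "C = B * c0 powr (- (real k / \<mu>))"
  have "norm (M (Complex (x + h) y)) \<le> C * y powr (- real k) * (y + \<bar>h\<bar>) powr (real k / \<mu>)"
    if y: "0 < y" "y \<le> 1" for h y
  proof -
    define z where "z = Complex (x + h) y"
    obtain c d :: int where cd: "c \<ge> 1" "norm (M z) \<le> B / norm (of_int c * z + of_int d) ^ k"
      using bd[of z] y by (auto simp: z_def)
    define l where "l = norm (of_int c * z + of_int d)"
    define \<rho> where "\<rho> = l / y"
    have "of_int c * y \<le> l"
      unfolding l_def using abs_Im_le_cmod[of "of_int c * z + of_int d"] by (simp add: z_def)
    then have c\<rho>: "of_int c \<le> \<rho>" using y by (simp add: \<rho>_def field_simps)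
    have \<rho>: "\<rho> \<ge> 1" using c\<rho> cd by linarith
    have "\<bar>of_int c * (x + h) + of_int d\<bar> \<le> l"
      unfolding l_def using abs_Re_le_cmod[of "of_int c * z + of_int d"] by (simp add: z_def)
    moreover have "\<bar>of_int c * x - of_int (- d)\<bar> \<le> \<bar>of_int c * (x + h) + of_int d\<bar> + \<bar>of_int c * h\<bar>"
      by (simp add: algebra_simps)
    moreover have "\<bar>of_int c * h\<bar> \<le> \<rho> * \<bar>h\<bar>"
      using cd c\<rho> by (simp add: abs_mult mult_right_mono)
    moreover have "l = \<rho> * y" using y by (simp add: \<rho>_def)
    ultimately have "\<bar>of_int c * x - of_int (- d)\<bar> \<le> \<rho> * (y + \<bar>h\<bar>)"
      by (simp add: distrib_left)
    then have "c0 * of_int c powr (1 - \<mu>) \<le> \<rho> * (y + \<bar>h\<bar>)"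
      using dioph[of c "- d"] cd by simp
    moreover have "c0 * \<rho> powr (1 - \<mu>) \<le> c0 * of_int c powr (1 - \<mu>)"
      using c0 \<mu> cd c\<rho> by (intro mult_left_mono powr_mono2') auto
    ultimately have "c0 * \<rho> powr (1 - \<mu>) \<le> \<rho> * (y + \<bar>h\<bar>)" by linarith
    then have "c0 * \<rho> powr (1 - \<mu>) * \<rho> powr (\<mu> - 1) \<le> \<rho> * (y + \<bar>h\<bar>) * \<rho> powr (\<mu> - 1)"
      by (rule mult_right_mono) simp
    moreover have "c0 * \<rho> powr (1 - \<mu>) * \<rho> powr (\<mu> - 1) = c0"
      using \<rho> by (simp add: mult.assoc flip: powr_add)
    moreover have "\<rho> * (y + \<bar>h\<bar>) * \<rho> powr (\<mu> - 1) = \<rho> powr \<mu> * (y + \<bar>h\<bar>)"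
      using \<rho> by (simp add: powr_diff)
    ultimately have "c0 \<le> \<rho> powr \<mu> * (y + \<bar>h\<bar>)" by linarith
    then have "c0 powr (real k / \<mu>) \<le> (\<rho> powr \<mu> * (y + \<bar>h\<bar>)) powr (real k / \<mu>)"
      using c0 \<mu> by (intro powr_mono2) auto
    also have "\<dots> = \<rho> ^ k * (y + \<bar>h\<bar>) powr (real k / \<mu>)"
      using \<mu> \<rho> y by (simp add: powr_mult powr_powr powr_realpow)
    finally have 1: "1 / \<rho> ^ k \<le> c0 powr (- (real k / \<mu>)) * (y + \<bar>h\<bar>) powr (real k / \<mu>)"
      using \<rho> c0 by (simp add: powr_minus field_simps)
    have "norm (M z) \<le> B / (\<rho> * y) ^ k" using cd(2) y by (simp add: l_def[symmetric] \<rho>_def)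
    also have "\<dots> = B * y powr (- real k) * (1 / \<rho> ^ k)"
      using y by (simp add: power_mult_distrib powr_minus powr_realpow field_simps)
    also have "\<dots> \<le> B * y powr (- real k) * (c0 powr (- (real k / \<mu>)) * (y + \<bar>h\<bar>) powr (real k / \<mu>))"
      using B by (intro mult_left_mono 1) auto
    finally show ?thesis by (simp add: C_def z_def mult_ac)
  qed
  moreover have "C \<ge> 0" using B by (simp add: C_def)
  ultimately show ?thesis by blast
qed

lemma vertical_integral_modular_form:
  assumes r: "has_fourier_expansion M r" and s: "s > 0"
    and S: "summable (\<lambda>n. norm (r (Suc n)) * real (Suc n) powr (- s))"
  defines "f \<equiv> \<lambda>u y. y powr (s - 1) *\<^sub>R (M (Complex u y) - r 0)"
  shows "f u absolutely_integrable_on {0<..}"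
    and "integral {0<..} (f u) - integral {0<..} (f (- u)) =
           of_real (2 * Gamma s * (2 * pi) powr (- s)) * \<i> * sine_series r s u"
proof -
  define b where "b = (\<lambda>u n. r (Suc n) * qexp (of_nat (Suc n) * of_real u))"
  have bs: "summable (\<lambda>n. norm (b u n) * real (Suc n) powr (- s))" for u
    using S by (simp add: b_def norm_mult norm_qexp)
  have eq: "(\<Sum>n. exp (- 2 * pi * real (Suc n) * y) *\<^sub>R b u n) = M (Complex u y) - r 0" if y: "y > 0" for u y
  proof -
    have "exp (- 2 * pi * real (Suc n) * y) *\<^sub>R b u n = r (Suc n) * qexp (of_nat (Suc n) * Complex u y)" for n
    proof -
      have "of_real (exp (- 2 * pi * real (Suc n) * y)) = qexp (of_nat (Suc n) * (\<i> * of_real y))"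
        unfolding qexp_def exp_of_real[symmetric] by (rule arg_cong[of _ _ exp]) (simp add: complex_eq_iff)
      then show ?thesis
        by (simp only: b_def scaleR_conv_of_real Complex_eq distrib_left qexp_add mult_ac)
    qed
    moreover have "(\<lambda>n. r (Suc n) * qexp (of_nat (Suc n) * Complex u y)) sums (M (Complex u y) - r 0)"
      using fourier_expansion_qexp[OF r, of "Complex u y"] y by (subst sums_Suc_iff) simp
    ultimately show ?thesis by (simp add: sums_unique[symmetric])
  qed
  define g where "g = (\<lambda>u y. y powr (s - 1) *\<^sub>R (\<Sum>n. exp (- 2 * pi * real (Suc n) * y) *\<^sub>R b u n))"
  have fg: "f u y = g u y" if "y \<in> {0<..}" for u y
    using eq that by (simp add: f_def g_def)
  show "f u absolutely_integrable_on {0<..}"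
    using Mellin_exp_series_integrable[OF s bs, of u] fg
    by (subst set_integrable_cong[OF refl refl fg]) (auto simp: g_def)
  define c where "c = Gamma s * (2 * pi) powr (- s)"
  have I: "integral {0<..} (f u) = c *\<^sub>R (\<Sum>n. real (Suc n) powr (- s) *\<^sub>R b u n)" for u
    using Mellin_exp_series[OF s bs, of u] integral_cong[of "{0<..}" "f u" "g u"] fg by (simp add: g_def c_def)
  have sm: "summable (\<lambda>n. real (Suc n) powr (- s) *\<^sub>R b u n)" for u
    by (rule summable_norm_cancel) (use bs in \<open>simp add: mult.commute\<close>)
  have "(\<Sum>n. real (Suc n) powr (- s) *\<^sub>R b u n) - (\<Sum>n. real (Suc n) powr (- s) *\<^sub>R b (- u) n) =
      (\<Sum>n. real (Suc n) powr (- s) *\<^sub>R b u n - real (Suc n) powr (- s) *\<^sub>R b (- u) n)"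
    by (rule suminf_diff[OF sm sm])
  also have "\<dots> = (\<Sum>n. 2 * \<i> * (r (Suc n) / of_real (real (Suc n) powr s) * of_real (sin (2 * pi * real (Suc n) * u))))"
  proof (rule suminf_cong)
    fix n
    have "b u n - b (- u) n = r (Suc n) * (2 * \<i> * of_real (sin (2 * pi * (real (Suc n) * u))))"
    proof -
      have "2 * \<i> * of_real (sin (2 * pi * (real (Suc n) * u))) =
          qexp (of_nat (Suc n) * of_real u) - qexp (of_nat (Suc n) * of_real (- u))"
        unfolding sine_eq_qexp by (simp del: of_nat_Suc)
      then show ?thesis by (simp only: b_def right_diff_distrib)
    qed
    then show "real (Suc n) powr (- s) *\<^sub>R b u n - real (Suc n) powr (- s) *\<^sub>R b (- u) n =
        2 * \<i> * (r (Suc n) / of_real (real (Suc n) powr s) * of_real (sin (2 * pi * real (Suc n) * u)))"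
      unfolding scaleR_diff_right[symmetric] by (simp add: scaleR_conv_of_real powr_minus_divide mult_ac)
  qed
  also have "\<dots> = 2 * \<i> * sine_series r s u"
    unfolding sine_series_def
  proof (rule suminf_mult)
    show "summable (\<lambda>n. r (Suc n) / of_real (real (Suc n) powr s) * of_real (sin (2 * pi * real (Suc n) * u)))"
    proof (rule summable_norm_cancel, rule summable_comparison_test'[OF S, of 0])
      fix n :: nat
      have "norm (r (Suc n)) * real (Suc n) powr (- s) * \<bar>sin (2 * pi * real (Suc n) * u)\<bar> \<le> norm (r (Suc n)) * real (Suc n) powr (- s) * 1"
        by (intro mult_left_mono abs_sin_le_one) auto
      then show "norm (norm (r (Suc n) / of_real (real (Suc n) powr s) * of_real (sin (2 * pi * real (Suc n) * u)))) \<le> norm (r (Suc n)) * real (Suc n) powr (- s)"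
        by (simp add: norm_mult norm_divide powr_minus_divide)
    qed
  qed
  finally show "integral {0<..} (f u) - integral {0<..} (f (- u)) =
           of_real (2 * Gamma s * (2 * pi) powr (- s)) * \<i> * sine_series r s u"
    unfolding I scaleR_diff_right[symmetric] by (simp add: c_def scaleR_conv_of_real mult_ac)
qed

text \<open>Growth is required at -x as well, since the second vertical integral is taken over -t.
  The parameters A and \<eta> are kept free, rather than fixed as k and k/\<mu>, so that s - A +
  \<eta> can be moved off the integers.\<close>

lemma pointwise_holder_of_growth:
  fixes x s A \<eta> :: real
  assumes M: "modular_form k M" and r: "has_fourier_expansion M r"
    and S: "summable (\<lambda>n. norm (r (Suc n)) * real (Suc n) powr (- s))"
    and A: "0 < A" "A < s" and \<eta>: "0 \<le> \<eta>" "\<eta> \<le> A" and nonint: "s - A + \<eta> \<notin> \<int>"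
    and growth: "\<And>u. u = x \<or> u = - x \<Longrightarrow> \<exists>C. \<forall>h y. 0 < y \<and> y \<le> 1 \<longrightarrow>
      norm (M (Complex (u + h) y)) \<le> C * y powr (- A) * (y + \<bar>h\<bar>) powr \<eta>"
  shows "pointwise_holder (sine_series r s) x (s - A + \<eta>)"
proof -
  define \<beta> where "\<beta> = s - A + \<eta>"
  define f where "f = (\<lambda>u y. y powr (s - 1) *\<^sub>R (M (Complex u y) - r 0))"
  have s: "s > 0" using A by simp
  have 1: "\<exists>P K. int (degree P) \<le> \<lfloor>\<beta>\<rfloor> \<and>
     (\<forall>h. norm (integral {0<..} (f (u + h)) - poly P (of_real h)) \<le> K * \<bar>h\<bar> powr \<beta>)"
    if u: "u = x \<or> u = - x" for u
  proof -
    obtain C where C: "\<And>h y. 0 < y \<Longrightarrow> y \<le> 1 \<Longrightarrow>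
      norm (M (Complex (u + h) y)) \<le> C * y powr (- A) * (y + \<bar>h\<bar>) powr \<eta>"
      using growth[OF u] by blast
    obtain K where K: "K \<ge> 0" "\<And>z. Im z \<ge> 1 / 2 \<Longrightarrow> norm (M z - r 0) \<le> K * exp (- 2 * pi * Im z)"
      using modular_form_decay[OF r, of "1 / 2"] by auto
    obtain L1 where L1: "L1 \<ge> 0" "\<And>y. y > 0 \<Longrightarrow> exp (- 2 * pi * y) \<le> L1 * y powr (- A)"
      using exp_decay_le_powr[of A] A by auto
    obtain L2 where L2: "L2 \<ge> 0" "\<And>y. y > 0 \<Longrightarrow> exp (- 2 * pi * y) \<le> L2 * y powr (- (s + 1))"
      using exp_decay_le_powr[of "s + 1"] s by auto
    define C' where "C' = max (\<bar>C\<bar> + norm (r 0)) (max (K * L1) (K * L2))"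
    have C'0: "C' \<ge> 0" unfolding C'_def by (rule max.coboundedI1) simp
    show ?thesis unfolding \<beta>_def f_def
    proof (rule vertical_integral_holder[OF _ A \<eta>(1) nonint C'0])
      show "(\<lambda>z. M z - r 0) holomorphic_on {z. Im z > 0}"
        using M by (intro holomorphic_intros) (simp add: modular_form_def)
      show "(\<lambda>y. y powr (s - 1) *\<^sub>R (M (Complex v y) - r 0)) absolutely_integrable_on {0<..}" for v
        by (rule vertical_integral_modular_form(1)[OF r s S])
      show "norm (M z - r 0) \<le> C' * Im z powr (- (s + 1))" if z: "Im z \<ge> 1 / 2" for z
      proof -
        have "norm (M z - r 0) \<le> K * exp (- 2 * pi * Im z)" by (rule K(2)[OF z])
        also have "\<dots> \<le> K * (L2 * Im z powr (- (s + 1)))" using z by (intro mult_left_mono L2 K) auto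
        also have "\<dots> \<le> C' * Im z powr (- (s + 1))"
          unfolding mult.assoc[symmetric] by (intro mult_right_mono) (auto simp: C'_def)
        finally show ?thesis .
      qed
      show "norm (M (Complex (u + h) y) - r 0) \<le> C' * y powr (- A) * (y + \<bar>h\<bar>) powr \<eta>" if y: "y > 0" for h y
      proof (cases "y \<le> 1")
        case True
        \<comment> \<open>From \<eta> \<le> A and y \<le> 1 one gets \<open>Y\<close> \<ge> 1, so
          the constant term r_0 is absorbed into the growth bound.\<close>
        define Y where "Y = y powr (- A) * (y + \<bar>h\<bar>) powr \<eta>"
        have "1 = y powr 0" using y by simp
        also have "\<dots> \<le> y powr (- A + \<eta>)" using y True \<eta> by (intro powr_mono') auto
        also have "\<dots> = y powr (- A) * y powr \<eta>" by (simp only: powr_add)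
        also have "\<dots> \<le> Y" unfolding Y_def using y \<eta> by (intro mult_left_mono powr_mono2) auto
        finally have Y: "Y \<ge> 1" .
        have "norm (M (Complex (u + h) y) - r 0) \<le> norm (M (Complex (u + h) y)) + norm (r 0)"
          by (rule norm_triangle_ineq4)
        also have "norm (M (Complex (u + h) y)) \<le> C * Y"
          using C[OF y True, of h] by (simp add: Y_def mult.assoc)
        also have "C * Y \<le> \<bar>C\<bar> * Y" using Y by (intro mult_right_mono) auto
        also have "norm (r 0) \<le> norm (r 0) * Y" using Y by (simp add: mult_le_cancel_left1)
        also have "\<bar>C\<bar> * Y + norm (r 0) * Y \<le> C' * Y"
          unfolding distrib_right[symmetric] using Y by (intro mult_right_mono) (auto simp: C'_def)
        finally show ?thesis by (simp add: Y_def mult.assoc)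
      next
        case False
        have "norm (M (Complex (u + h) y) - r 0) \<le> K * exp (- 2 * pi * y)"
          using K(2)[of "Complex (u + h) y"] False by simp
        also have "\<dots> \<le> K * (L1 * y powr (- A))" using y by (intro mult_left_mono L1 K) auto
        also have "\<dots> \<le> C' * y powr (- A) * 1"
          unfolding mult.assoc[symmetric] mult_1_right by (intro mult_right_mono) (auto simp: C'_def)
        also have "\<dots> \<le> C' * y powr (- A) * (y + \<bar>h\<bar>) powr \<eta>"
          using False C'0 \<eta> by (intro mult_left_mono ge_one_powr_ge_zero) auto
        finally show ?thesis .
      qed
    qed
  qed
  obtain P1 K1 where P1: "int (degree P1) \<le> \<lfloor>\<beta>\<rfloor>"
    "\<And>h. norm (integral {0<..} (f (x + h)) - poly P1 (of_real h)) \<le> K1 * \<bar>h\<bar> powr \<beta>"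
    using 1[of x] by blast
  obtain P2 K2 where P2: "int (degree P2) \<le> \<lfloor>\<beta>\<rfloor>"
    "\<And>h. norm (integral {0<..} (f (- x + h)) - poly P2 (of_real h)) \<le> K2 * \<bar>h\<bar> powr \<beta>"
    using 1[of "- x"] by blast
  define c where "c = of_real (2 * Gamma s * (2 * pi) powr (- s)) * \<i>"
  have c: "c \<noteq> 0" using Gamma_real_pos[OF s] by (simp add: c_def)
  \<comment> \<open>Near t = x + h the second integral sits at -x - h, hence the substitution of -h
    in its polynomial.\<close>
  define P where "P = smult (1 / c) (P1 - pcompose P2 [:0, -1:])"
  have "norm (sine_series r s t - poly P (of_real (t - x))) \<le> ((K1 + K2) / norm c) * \<bar>t - x\<bar> powr \<beta>" for t
  proof -
    define h where "h = t - x"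
    have "c * sine_series r s t = integral {0<..} (f (x + h)) - integral {0<..} (f (- x + - h))"
      using vertical_integral_modular_form(2)[OF r s S, of t] by (simp add: c_def f_def h_def)
    then have "sine_series r s t - poly P (of_real h) =
       ((integral {0<..} (f (x + h)) - poly P1 (of_real h)) - (integral {0<..} (f (- x + - h)) - poly P2 (of_real (- h)))) / c"
      using c by (simp add: P_def poly_pcompose field_simps)
    also have "norm \<dots> \<le> (K1 * \<bar>h\<bar> powr \<beta> + K2 * \<bar>- h\<bar> powr \<beta>) / norm c"
      unfolding norm_divide
      by (intro divide_right_mono order_trans[OF norm_triangle_ineq4] add_mono P1 P2) auto
    also have "\<dots> = ((K1 + K2) / norm c) * \<bar>h\<bar> powr \<beta>"
      by (simp add: add_divide_distrib distrib_right)
    finally show ?thesis by (simp add: h_def)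
  qed
  moreover have "int (degree P) \<le> \<lfloor>\<beta>\<rfloor>"
  proof -
    have "degree (pcompose P2 [:0, -1:]) \<le> degree P2 * 1"
      using degree_pcompose_le[of P2 "[:0, -1:]"] by simp
    then have "degree (P1 - pcompose P2 [:0, -1:]) \<le> nat \<lfloor>\<beta>\<rfloor>"
      using P1(1) P2(1) by (intro degree_diff_le) linarith+
    then have "degree P \<le> nat \<lfloor>\<beta>\<rfloor>" using degree_smult_le order_trans unfolding P_def by blast
    moreover have "\<lfloor>\<beta>\<rfloor> \<ge> 0" using P1(1) by linarith
    ultimately show ?thesis by linarith
  qed
  ultimately show ?thesis unfolding pointwise_holder_def \<beta>_def
    by (intro exI[of _ P] exI[of _ "(K1 + K2) / norm c"]) simp
qed

lemma ex_nonint_between: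
  fixes a b :: real
  assumes "a < b"
  shows "\<exists>c. a < c \<and> c < b \<and> c \<notin> \<int>"
proof -
  have "uncountable ({a<..<b} - \<int>)"
    using assms by (intro uncountable_minus_countable) (simp_all add: uncountable_open_interval Ints_def)
  then have "{a<..<b} - \<int> \<noteq> {}" by (metis countable_empty)
  then show ?thesis by auto
qed

section \<open>Lower bounds above convergents and the exact exponent\<close>

text \<open>Directly above d/c, the factor c z - d is purely imaginary, equal to i c a, and the
  transformed height is 1/(c^2 a). Once this is at least \<open>Y\<close>, M differs from r_0 by at
  most half of |r_0|.\<close>

lemma modular_form_convergent_lower_bound:
  assumes M: "modular_form k M" and r: "has_fourier_expansion M r" and r0: "r 0 \<noteq> 0"
  shows "\<exists>Y\<ge>1. \<forall>c d a. coprime c d \<and> 0 < c \<and> 0 < a \<and> of_int c ^ 2 * a \<le> 1 / Y \<longrightarrow>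
    norm (r 0) / 2 \<le> (of_int c * a) ^ k * norm (M (Complex (of_int d / of_int c) a))"
proof -
  obtain K where K: "K \<ge> 0" "\<And>z. Im z \<ge> 1 \<Longrightarrow> norm (M z - r 0) \<le> K * exp (- 2 * pi * Im z)"
    using modular_form_decay[OF r, of 1] by auto
  obtain L where L: "L \<ge> 0" "\<And>y. y > 0 \<Longrightarrow> exp (- 2 * pi * y) \<le> L * y powr (- 1)"
    using exp_decay_le_powr[of 1] by auto
  define Y where "Y = max 1 (2 * K * L / norm (r 0))"
  have Y: "Y \<ge> 1" by (simp add: Y_def)
  have high: "norm (r 0) / 2 \<le> norm (M z)" if z: "Im z \<ge> Y" for z
  proof -
    have z1: "Im z \<ge> 1" using z Y by linarith
    have "norm (M z - r 0) \<le> K * exp (- 2 * pi * Im z)" by (rule K(2)[OF z1])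
    also have "\<dots> \<le> K * (L * Im z powr (- 1))" using z1 by (intro mult_left_mono L K) auto
    also have "\<dots> = K * L / Im z" using z1 by (simp add: powr_minus_divide)
    also have "\<dots> \<le> norm (r 0) / 2"
    proof -
      have "2 * K * L / norm (r 0) \<le> Im z" using z by (simp add: Y_def)
      then show ?thesis using r0 z1 by (simp add: field_simps)
    qed
    finally have "norm (M z - r 0) \<le> norm (r 0) / 2" .
    moreover have "norm (r 0) \<le> norm (M z) + norm (M z - r 0)"
      using norm_triangle_ineq4[of "M z" "M z - r 0"] by simp
    ultimately show ?thesis by linarith
  qed
  have "norm (r 0) / 2 \<le> (of_int c * a) ^ k * norm (M (Complex (of_int d / of_int c) a))"
    if cd: "coprime c d" "0 < c" and a: "0 < a" "of_int c ^ 2 * a \<le> 1 / Y" for c d a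
  proof -
    define z where "z = Complex (of_int d / of_int c) a"
    have w: "of_int c * z + of_int (- d) = \<i> * of_real (of_int c * a)"
      using cd by (simp add: z_def complex_eq_iff)
    obtain z' where z': "Im z' = Im z / norm (of_int c * z + of_int (- d)) ^ 2"
       "M z' = (of_int c * z + of_int (- d)) ^ k * M z"
      using modular_form_transform[OF M, of z c "- d"] cd a by (auto simp: z_def)
    have ca: "of_int c * a > 0" using cd a by simp
    have "Im z' = a / (of_int c * a) ^ 2"
      unfolding z'(1) w using cd a by (simp add: norm_mult z_def)
    also have "\<dots> = 1 / (of_int c ^ 2 * a)" using a by (simp add: power2_eq_square)
    also have "\<dots> \<ge> Y" using a Y cd by (simp add: field_simps)
    finally have "norm (r 0) / 2 \<le> norm (M z')" by (rule high)
    also have "\<dots> = (of_int c * a) ^ k * norm (M z)"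
      unfolding z'(2) w using cd a by (simp add: norm_mult norm_power)
    finally show ?thesis by (simp add: z_def)
  qed
  then show ?thesis using Y by blast
qed

lemma frequently_approx_exponent_gt:
  assumes "mu_exponent x > ereal c"
  shows "\<exists>\<^sub>F n in sequentially. approx_exponent x n > c"
proof (rule ccontr)
  assume "\<not> ?thesis"
  then have "\<forall>\<^sub>F n in sequentially. ereal (approx_exponent x n) \<le> ereal c"
    by (simp add: not_frequently not_less)
  then have "mu_exponent x \<le> ereal c" unfolding mu_exponent_def by (rule Limsup_bounded)
  with assms show False by simp
qed

text \<open>At height a above a convergent with denominator Q, the lower bound (Q a)^(-k) meets the
  upper bound a^(\<beta>-s), which forces c1 \<le> Q^k a^\<theta> with \<theta> = k + \<beta> - s.
  Infinitely many convergents allow a \<le> Q^(-\<kappa>), so \<kappa> \<theta> > k would send the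
  right-hand side to 0.\<close>

lemma approx_exponent_bound_of_holder:
  fixes x s \<beta> :: real
  assumes M: "modular_form k M" and r: "has_fourier_expansion M r" and r0: "r 0 \<noteq> 0"
    and x: "x \<notin> \<rat>"
    and S: "summable (\<lambda>n. norm (r (Suc n)) * real (Suc n) powr (- s))"
    and \<beta>: "0 < \<beta>" "\<beta> < s"
    and holder: "\<forall>\<^sub>F t in at x. norm (sine_series r s t - poly P (of_real (t - x))) \<le> C0 * \<bar>t - x\<bar> powr \<beta>"
    and \<kappa>: "ereal \<kappa> < mu_exponent x" and pos: "0 < real k + \<beta> - s" 
  shows "\<kappa> * (real k + \<beta> - s) \<le> real k"
proof (rule ccontr)
  define \<theta> where "\<theta> = real k + \<beta> - s"
  assume "\<not> \<kappa> * (real k + \<beta> - s) \<le> real k"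
  then have gt: "\<kappa> * \<theta> - real k > 0" by (simp add: \<theta>_def)
  have \<theta>: "\<theta> > 0" using pos by (simp add: \<theta>_def)
  obtain E where E: "E \<ge> 1" and low: "\<And>c d a. coprime c d \<Longrightarrow> 0 < c \<Longrightarrow> 0 < a \<Longrightarrow> of_int c ^ 2 * a \<le> 1 / E \<Longrightarrow>
    norm (r 0) / 2 \<le> (of_int c * a) ^ k * norm (M (Complex (of_int d / of_int c) a))"
    using modular_form_convergent_lower_bound[OF M r r0] by blast
  obtain C where C: "C \<ge> 0" and up: "\<And>z. 0 < Im z \<Longrightarrow> Im z \<le> 1 \<Longrightarrow> \<bar>Re z - x\<bar> \<le> 1 / 4 \<Longrightarrow>
      \<bar>Re z - x\<bar> \<le> E * Im z \<Longrightarrow> norm (M z - r 0) \<le> C * Im z powr (\<beta> - s)"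
    using modular_form_bound_of_holder[OF r S \<beta> E holder] by blast
  define c1 where "c1 = norm (r 0) / (2 * (norm (r 0) + C))"
  have nr: "norm (r 0) > 0" using r0 by simp
  have c1: "c1 > 0" unfolding c1_def using nr C by (intro divide_pos_pos mult_pos_pos add_pos_nonneg) simp_all
  \<comment> \<open>The threshold is the solution Q of Q^(-(\<kappa> \<theta> - k)) = c1; beyond it
    the final inequality is contradictory.\<close>
  have "eventually (\<lambda>n. real_of_int (conv_denom x n) > max 2 (c1 powr (- 1 / (\<kappa> * \<theta> - real k)))) sequentially"
    by (rule eventually_conv_denom_gt[OF x])
  then have "eventually (\<lambda>n. approx_exponent x n > \<kappa> \<longrightarrow> approx_exponent x n > \<kappa> \<and>
      real_of_int (conv_denom x n) > max 2 (c1 powr (- 1 / (\<kappa> * \<theta> - real k)))) sequentially"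
    by eventually_elim simp
  then have "\<exists>\<^sub>F n in sequentially. approx_exponent x n > \<kappa> \<and>
      real_of_int (conv_denom x n) > max 2 (c1 powr (- 1 / (\<kappa> * \<theta> - real k)))"
    by (rule frequently_mp[OF _ frequently_approx_exponent_gt[OF \<kappa>]])
  then obtain n where n: "approx_exponent x n > \<kappa>"
      "real_of_int (conv_denom x n) > max 2 (c1 powr (- 1 / (\<kappa> * \<theta> - real k)))"
    using frequently_ex by blast
  define q where "q = conv_denom x n"
  define p where "p = conv_num x n"
  define Q where "Q = real_of_int q"
  have Q: "Q > 2" "Q > c1 powr (- 1 / (\<kappa> * \<theta> - real k))" using n(2) by (auto simp: Q_def q_def)
  have q1: "q > 1" using Q by (simp add: Q_def)
  define \<delta> where "\<delta> = \<bar>x - of_int p / Q\<bar>"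
  have \<delta>_eq: "\<delta> = Q powr (- approx_exponent x n)"
    using approx_exponent_works[OF x, of n] q1 by (simp add: \<delta>_def Q_def q_def p_def)
  have \<delta>0: "\<delta> > 0" using Q by (simp add: \<delta>_eq)
  have "\<delta> \<le> Q powr (- 2)"
    unfolding \<delta>_eq using approx_exponent_ge_2[OF x, of n] q1 Q by (intro powr_mono) (auto simp: q_def)
  also have Qm2: "Q powr (- 2) = 1 / Q ^ 2" using Q by (simp add: powr_minus_divide powr_numeral)
  finally have \<delta>2: "\<delta> \<le> 1 / Q ^ 2" .
  have "2 ^ 2 \<le> Q ^ 2" using Q by (intro power_mono) auto
  then have "4 \<le> Q ^ 2" by simp
  then have Q4: "1 / Q ^ 2 \<le> 1 / 4" by (intro divide_left_mono) auto
  \<comment> \<open>\<open>E\<close> serves twice: the point above the convergent lies exactly on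
    the boundary of the cone of aperture \<open>E\<close>, and \<delta> \<le> 1/Q^2 gives Q^2 a
    \<le> 1/E, the range of the lower bound.\<close>
  define a where "a = \<delta> / E"
  have a0: "a > 0" using \<delta>0 E by (simp add: a_def)
  have a\<delta>: "a \<le> \<delta>" using \<delta>0 E by (simp add: a_def field_simps)
  have a1: "a \<le> 1" using a\<delta> \<delta>2 Q4 by linarith
  define z where "z = Complex (of_int p / Q) a"
  have "norm (M z - r 0) \<le> C * Im z powr (\<beta> - s)"
  proof (rule up)
    show "0 < Im z" "Im z \<le> 1" using a0 a1 by (auto simp: z_def)
    have d: "\<bar>Re z - x\<bar> = \<delta>" by (simp add: z_def \<delta>_def abs_minus_commute)
    show "\<bar>Re z - x\<bar> \<le> 1 / 4" unfolding d using \<delta>2 Q4 by linarith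
    show "\<bar>Re z - x\<bar> \<le> E * Im z" unfolding d using E by (simp add: z_def a_def)
  qed
  then have "norm (M z - r 0) \<le> C * a powr (\<beta> - s)" by (simp add: z_def)
  moreover have "norm (r 0) \<le> norm (r 0) * a powr (\<beta> - s)"
  proof -
    have "1 = a powr 0" using a0 by simp
    also have "\<dots> \<le> a powr (\<beta> - s)" using a0 a1 \<beta> by (intro powr_mono') auto
    finally show ?thesis by (simp add: mult_le_cancel_left1)
  qed
  moreover have "norm (M z) \<le> norm (M z - r 0) + norm (r 0)"
    by (metis diff_add_cancel norm_triangle_ineq)
  ultimately have Mz: "norm (M z) \<le> (norm (r 0) + C) * a powr (\<beta> - s)" by (simp add: algebra_simps)
  have "norm (r 0) / 2 \<le> (Q * a) ^ k * norm (M z)"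
    unfolding Q_def z_def
  proof (rule low)
    show "coprime q p" using coprime_conv[of x n] by (simp add: q_def p_def coprime_commute)
    have "Q ^ 2 * \<delta> \<le> 1" using \<delta>2 Q by (simp add: field_simps)
    then show "of_int q ^ 2 * a \<le> 1 / E" using E by (simp add: a_def Q_def field_simps)
  qed (use q1 a0 in auto)
  also have "\<dots> \<le> (Q * a) ^ k * ((norm (r 0) + C) * a powr (\<beta> - s))"
    using Mz Q a0 by (intro mult_left_mono) auto
  also have "\<dots> = (norm (r 0) + C) * Q ^ k * (a powr real k * a powr (\<beta> - s))"
    using a0 by (simp add: power_mult_distrib powr_realpow mult_ac)
  also have "a powr real k * a powr (\<beta> - s) = a powr \<theta>"
    by (simp add: \<theta>_def algebra_simps flip: powr_add)
  finally have "norm (r 0) \<le> Q ^ k * a powr \<theta> * (2 * (norm (r 0) + C))"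
    by (simp add: algebra_simps)
  moreover have "2 * (norm (r 0) + C) > 0" using nr C by (intro mult_pos_pos add_pos_nonneg) simp_all
  ultimately have "c1 \<le> Q ^ k * a powr \<theta>" unfolding c1_def by (simp only: pos_divide_le_eq)
  also have "\<dots> \<le> Q ^ k * (Q powr (- \<kappa>)) powr \<theta>"
  proof (intro mult_left_mono powr_mono2)
    have "Q powr (- approx_exponent x n) \<le> Q powr (- \<kappa>)" using n(1) Q by (intro powr_mono) auto
    then show "a \<le> Q powr (- \<kappa>)" using a\<delta> \<delta>_eq by linarith
  qed (use Q a0 \<theta> in auto)
  also have "\<dots> = Q powr (real k) * Q powr (- \<kappa> * \<theta>)"
    using Q by (simp add: powr_realpow powr_powr)
  also have "\<dots> = Q powr (- (\<kappa> * \<theta> - real k))" by (simp add: algebra_simps flip: powr_add)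
  also have "\<dots> < (c1 powr (- 1 / (\<kappa> * \<theta> - real k))) powr (- (\<kappa> * \<theta> - real k))"
    using Q gt c1 by (intro powr_less_mono2_neg) auto
  also have "\<dots> = c1"
  proof -
    have "(b powr (- 1 / e)) powr (- e) = b" if "b > 0" "e > 0" for b e :: real
      using that by (simp add: powr_powr)
    then show ?thesis using gt c1 by blast
  qed
  finally show False by simp
qed

text \<open>\<open>L\<close> is k/\<mu> as a real number, equal to 0 when \<mu> = \<infinity>; it is
  below k because \<mu> \<ge> 2.\<close>

theorem holder_exponent_sine_series:
  fixes k :: nat and M :: "complex \<Rightarrow> complex" and r :: "nat \<Rightarrow> complex" and s x L :: real
  assumes k: "k \<ge> 3"
    and M: "modular_form k M" and r: "has_fourier_expansion M r" and r0: "r 0 \<noteq> 0"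
    and x: "x \<notin> \<rat>" and s: "s > real k"
    and L: "ereal (real k) / mu_exponent x = ereal L"
  shows "holder_exponent (sine_series r s) x = ereal (s - real k + L)"
proof (rule antisym)
  have mu2: "mu_exponent x \<ge> 2" using nu_exponent_ge_2[OF x] nu_le_mu_exponent[of x] by (rule order_trans)
  have S: "summable (\<lambda>n. norm (r (Suc n)) * real (Suc n) powr (- s))"
    by (rule dirichlet_series_summable[OF M r k s])
  have Lcases: "(mu_exponent x = \<infinity> \<and> L = 0) \<or> (\<exists>m\<ge>2. mu_exponent x = ereal m \<and> L = real k / m)"
    using mu2 L by (cases "mu_exponent x") auto
  have L0: "0 \<le> L" "L < real k"
    using Lcases k by (auto simp: divide_less_eq)
  show "holder_exponent (sine_series r s) x \<le> ereal (s - real k + L)"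
    unfolding holder_exponent_def
  proof (rule Sup_least)
    fix e assume "e \<in> {ereal \<beta> |\<beta>. \<beta> > 0 \<and> pointwise_holder (sine_series r s) x \<beta>}"
    then obtain \<beta> where \<beta>: "e = ereal \<beta>" "\<beta> > 0" "pointwise_holder (sine_series r s) x \<beta>" by auto
    show "e \<le> ereal (s - real k + L)"
    proof (rule ccontr)
      assume "\<not> e \<le> ereal (s - real k + L)"
      then have gt: "s - real k + L < \<beta>" using \<beta>(1) by simp
      \<comment> \<open>An exponent strictly above s - k + L but below s, as the fractional integral
        demands; it exists since L < k. Lowering the exponent weakens the local estimate because |t
        - x| < 1.\<close>
      define \<gamma> where "\<gamma> = (s - real k + L + min \<beta> s) / 2"
      have \<gamma>: "s - real k + L < \<gamma>" "\<gamma> < s" "\<gamma> \<le> \<beta>" "0 < \<gamma>"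
        using gt L0 s by (auto simp: \<gamma>_def min_def field_simps)
      obtain P C where P: "\<forall>\<^sub>F t in at x. norm (sine_series r s t - poly P (of_real (t - x))) \<le> C * \<bar>t - x\<bar> powr \<beta>"
        using \<beta>(3) unfolding pointwise_holder_def by blast
      have "\<forall>\<^sub>F t in at x. dist t x < 1" by (rule eventually_at_ball'[of 1 x UNIV, THEN eventually_mono]) (auto simp: dist_commute)
      then have P': "\<forall>\<^sub>F t in at x. norm (sine_series r s t - poly P (of_real (t - x))) \<le> \<bar>C\<bar> * \<bar>t - x\<bar> powr \<gamma>"
        using P
      proof eventually_elim
        case (elim t)
        have "C * \<bar>t - x\<bar> powr \<beta> \<le> \<bar>C\<bar> * \<bar>t - x\<bar> powr \<gamma>"
          using elim(1) \<gamma> by (intro mult_mono powr_mono') (auto simp: dist_real_def)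
        with elim(2) show ?case by linarith
      qed
      have pos: "0 < real k + \<gamma> - s" using \<gamma> L0 by linarith
      define \<tau> where "\<tau> = real k / (real k + \<gamma> - s)"
      \<comment> \<open>Any number strictly between \<tau> and \<mu> would do: the midpoint if \<mu>
        is finite, otherwise \<tau> + 1.\<close>
      define \<kappa> where "\<kappa> = (if mu_exponent x = \<infinity> then \<tau> + 1
          else (\<tau> + real_of_ereal (mu_exponent x)) / 2)"
      have "ereal \<kappa> < mu_exponent x \<and> \<kappa> > \<tau>"
      proof (cases "mu_exponent x = \<infinity>")
        case False
        then obtain m where m: "m \<ge> 2" "mu_exponent x = ereal m" "L = real k / m" using Lcases by auto
        have "real k / m < real k + \<gamma> - s" using \<gamma>(1) m(3) by linarith
        then have "\<tau> < m" using pos m(1) by (simp add: \<tau>_def field_simps)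
        then show ?thesis using m(2) by (simp add: \<kappa>_def)
      qed (simp add: \<kappa>_def)
      then have "ereal \<kappa> < mu_exponent x" and gt: "real k < \<kappa> * (real k + \<gamma> - s)"
        using pos by (auto simp: \<tau>_def field_simps)
      from approx_exponent_bound_of_holder[OF M r r0 x S \<gamma>(4,2) P' this(1) pos] gt
      show False by simp
    qed
  qed
  show "ereal (s - real k + L) \<le> holder_exponent (sine_series r s) x"
  proof (rule dense_le)
    fix e assume e: "e < ereal (s - real k + L)"
    have sup: "e \<le> holder_exponent (sine_series r s) x"
      if "e \<le> ereal \<beta>" "\<beta> > 0" "pointwise_holder (sine_series r s) x \<beta>" for \<beta>
      unfolding holder_exponent_def using that by (intro Sup_upper2[of "ereal \<beta>"]) auto
    obtain e' where e': "e \<le> ereal e'" "e' < s - real k + L"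
      using e by (cases e) (auto intro: that[of "s - real k + L - 1"])
    show "e \<le> holder_exponent (sine_series r s) x"
      using Lcases
    proof (elim disjE conjE exE)
      assume "mu_exponent x = \<infinity>" "L = 0"
      \<comment> \<open>With no Diophantine gain available, \<eta> = 0 is kept and the loss is put
        into A = s - \<beta>, slightly larger than k.\<close>
      obtain \<beta> where \<beta>: "max 0 e' < \<beta>" "\<beta> < s - real k" "\<beta> \<notin> \<int>"
        using ex_nonint_between[of "max 0 e'" "s - real k"] e' s \<open>L = 0\<close> by auto
      obtain B where B: "\<And>z. 0 < Im z \<Longrightarrow> Im z \<le> 1 \<Longrightarrow> norm (M z) \<le> B / Im z ^ k" "B \<ge> 0"
        using modular_form_growth[OF M r] by blast
      have "pointwise_holder (sine_series r s) x (s - (s - \<beta>) + 0)"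
      proof (rule pointwise_holder_of_growth[OF M r S])
        show "\<exists>C. \<forall>h y. 0 < y \<and> y \<le> 1 \<longrightarrow>
          norm (M (Complex (u + h) y)) \<le> C * y powr (- (s - \<beta>)) * (y + \<bar>h\<bar>) powr 0" for u
        proof (intro exI[of _ B] allI impI)
          fix h y :: real assume y: "0 < y \<and> y \<le> 1"
          have "norm (M (Complex (u + h) y)) \<le> B / y ^ k" using B(1)[of "Complex (u + h) y"] y by simp
          also have "\<dots> = B * y powr (- real k)" using y by (simp add: powr_minus_divide powr_realpow)
          also have "\<dots> \<le> B * y powr (- (s - \<beta>))" using y \<beta> B(2) by (intro mult_left_mono powr_mono') auto
          finally have "norm (M (Complex (u + h) y)) \<le> B * y powr (- (s - \<beta>))" .
          moreover have "y + \<bar>h\<bar> \<noteq> 0" using y by linarith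
          ultimately show "norm (M (Complex (u + h) y)) \<le> B * y powr (- (s - \<beta>)) * (y + \<bar>h\<bar>) powr 0"
            by simp
        qed
      qed (use \<beta> s k in auto)
      then show ?thesis using \<beta> e' by (intro sup[of \<beta>]) (auto intro: order_trans)
    next
      fix m assume m: "2 \<le> m" "mu_exponent x = ereal m" "L = real k / m"
      have "L > 0" using m k by simp
      obtain \<beta> where \<beta>: "max (s - real k) e' < \<beta>" "\<beta> < s - real k + L" "\<beta> \<notin> \<int>"
        using ex_nonint_between[of "max (s - real k) e'" "s - real k + L"] e' \<open>L > 0\<close> by auto
      define \<eta> where "\<eta> = \<beta> - (s - real k)"
      have \<eta>: "0 < \<eta>" "\<eta> < L" using \<beta> by (auto simp: \<eta>_def)
      \<comment> \<open>Chosen so that k/\<mu> is exactly \<eta>; as \<eta> < L, it exceeds the true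
        exponent m, which the Diophantine bound requires.\<close>
      define \<mu> where "\<mu> = real k / \<eta>"
      have "real k / L < \<mu>" unfolding \<mu>_def using \<eta> k by (intro divide_strict_left_mono) auto
      then have m\<mu>: "m < \<mu>" using m k by simp
      have \<eta>\<mu>: "real k / \<mu> = \<eta>" using \<eta> k by (simp add: \<mu>_def)
      obtain c0 where c0: "c0 > 0"
        "\<And>q p :: int. 0 < q \<Longrightarrow> \<bar>of_int q * x - of_int p\<bar> \<ge> c0 * of_int q powr (1 - \<mu>)"
        using diophantine_lower_bound[OF x, of \<mu>] m(2) m\<mu> by auto
      have "pointwise_holder (sine_series r s) x (s - real k + \<eta>)"
      proof (rule pointwise_holder_of_growth[OF M r S])
        fix u assume u: "u = x \<or> u = - x"
        have "\<bar>of_int q * u - of_int p\<bar> \<ge> c0 * of_int q powr (1 - \<mu>)" if "0 < q" for q p :: int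
          using u c0(2)[OF that, of p] c0(2)[OF that, of "- p"] by (auto simp: abs_minus_commute)
        from growth_from_diophantine[OF M r _ c0(1) this]
        show "\<exists>C. \<forall>h y. 0 < y \<and> y \<le> 1 \<longrightarrow>
          norm (M (Complex (u + h) y)) \<le> C * y powr (- real k) * (y + \<bar>h\<bar>) powr \<eta>"
          using m\<mu> m(1) unfolding \<eta>\<mu> by auto
      qed (use \<eta> L0 s k \<beta>(3) in \<open>auto simp: \<eta>_def\<close>)
      then have "pointwise_holder (sine_series r s) x \<beta>" by (simp add: \<eta>_def)
      then show ?thesis using \<beta> e' s by (intro sup[of \<beta>]) (auto intro: order_trans)
    qed
  qed
qed

theorem theorem1p1:
  fixes k :: nat and M :: "complex \<Rightarrow> complex" and r :: "nat \<Rightarrow> complex" and s x :: real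
  assumes "k \<ge> 4" and "even k"
    and "modular_form k M"
    and "has_fourier_expansion M r"
    and "r 0 \<noteq> 0"
    and "x \<notin> \<rat>"
    and "ereal s > ereal (real k) + ereal (real k) / nu_exponent x - ereal (real k) / mu_exponent x"
  shows "holder_exponent (sine_series r s) x =
           ereal s - ereal (real k) + ereal (real k) / mu_exponent x"
proof -
  have nu2: "nu_exponent x \<ge> 2" and le: "nu_exponent x \<le> mu_exponent x"
    using nu_exponent_ge_2[OF assms(6)] nu_le_mu_exponent .
  \<comment> \<open>Both quotients are finite because \<nu> \<ge> 2, an infinite exponent
    contributing 0; \<open>L\<close> \<le> \<open>N\<close> turns the assumption into s > k.\<close>
  have "\<exists>N L. ereal (real k) / nu_exponent x = ereal N \<and> ereal (real k) / mu_exponent x = ereal L \<and> L \<le> N"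
    using nu2 le by (cases "nu_exponent x"; cases "mu_exponent x") (auto intro!: divide_left_mono)
  then obtain N L where NL: "ereal (real k) / nu_exponent x = ereal N"
    "ereal (real k) / mu_exponent x = ereal L" "L \<le> N" by blast
  then have "s > real k" using assms(7) by simp
  then show ?thesis
    using holder_exponent_sine_series[of k M r x s L] assms NL(2) by simp
qed

end
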